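(* Let $G\subseteq\mathrm{SL}_2(\mathbb{R})$ be a group containing $-I$ whose image in $\mathrm{PSL}_2(\mathbb{R})$ is a Fuchsian group of the first kind. Assume that the representation $\rho$ of $G$ lies in the set $$\left\{\widetilde{\mathbb{I}}\otimes\nu_G^k\ \middle|\ k\in\mathbb{Z},\ H\subseteq G,\ [G:H]<\infty\right\},$$ where $\mathbb{I}:H\to\mathrm{GL}_2(\mathbb{C})$, $\gamma\mapsto\gamma$, and $\widetilde{\mathbb{I}}=\mathrm{Ind}_H^G(\mathbb{I})$. Then there exists a logarithmic vector-valued automorphic form associated with $\rho$ whose components are linearly independent.
   Context: Here $H$ ranges over finite index subgroups of $G$ with $-I\in H$. $\mathbb{H}$ is the upper half plane; matrices act by Möbius transformations. A Fuchsian group of the first kind is a discrete subgroup of $\mathrm{PSL}_2(\mathbb{R})$ whose quotient of $\mathbb{H}$ is a Riemann surface with finitely many punctures and which has a fundamental domain of finite area. Parabolic means trace $\pm2$; cusps are points of $\mathbb{R}\cup\{\infty\}$ fixed by a nontrivial parabolic element of the group; $\mathbb{H}^*_G$ is $\mathbb{H}$ together with the cusps of $G$. $A_{\mathfrak{c}}=\begin{pmatrix}\mathfrak{c}&-1\\1&0\end{pmatrix}$ for $\mathfrak{c}\ne\infty$, $A_\infty=I$; the cusp width $h_{\mathfrak{c}}>0$ is such that the stabilizer of $\mathfrak{c}$ in $\bar G$ is generated by the image of $t_{\mathfrak{c}}=A_{\mathfrak{c}}\begin{pmatrix}1&h_{\mathfrak{c}}\\0&1\end{pmatrix}A_{\mathfrak{c}}^{-1}$.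 Put $\log\widetilde q_{\mathfrak{c}}=2\pi iA_{\mathfrak{c}}^{-1}\tau/h_{\mathfrak{c}}$, $\widetilde q_{\mathfrak{c}}=e^{\log\widetilde q_{\mathfrak{c}}}$. $\Delta_G$ is a fixed scalar-valued automorphic form for $G$ (with some rank-one multiplier) of weight $w_G\ne0$, holomorphic on $\mathbb{H}^*_G$, vanishing at the cusp $\infty$ and nonzero everywhere else on $\mathbb{H}^*_G$ up to $G$-equivalence (with $\infty$ replaced by a chosen cusp if $\infty$ is not a cusp of $G$); $\nu_G$ is the rank one representation of $G$ associated to the weight one form $\Delta_G^{1/w_G}$, i.e. $\Delta_G^{1/w_G}|_1\gamma=\nu_G(\gamma)\Delta_G^{1/w_G}$, where $f|_k\gamma(\tau)=(c\tau+d)^{-k}f(\gamma\tau)$. A representation is logarithmic if at all parabolic elements its values have only eigenvalues of absolute value 1 and at some parabolic element its value is not diagonalizable. A (weakly holomorphic) logarithmic vvaf of weight $k\in\mathbb{Z}$ associated to a logarithmic $\rho$ of rank $m$ (with $\rho(I)=e^{i\pi k}\rho(-I)$) is a holomorphic $\mathbb{X}:\mathbb{H}\to\mathbb{C}^m$ with $\mathbb{X}|_k\gamma=\rho(\gamma)\mathbb{X}$ for all $\gamma\in G$ and at every cusp $\mathfrak{c}$ an expansion $\mathbb{X}(\tau)=\epsilon_{\mathfrak{c}}(\tau)\sum_\lambda\sum_{j=0}^{m(\lambda)-1}(\log\widetilde q_{\mathfrak{c}})^j\widetilde q_{\mathfrak{c}}^{\,\mu(\lambda)}\sum_{n\ge-M_{\mathfrak{c}}}\mathbb{X}^{\mathfrak{c}}[\lambda,j,n]\widetilde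 q_{\mathfrak{c}}^{\,n}$ with $M_{\mathfrak{c}}$ finite, where $\epsilon_\infty=1$, $\epsilon_{\mathfrak{c}}(\tau)=(\tau-\mathfrak{c})^{-k}$ for $\mathfrak{c}\neq\infty$, $\lambda$ runs over the eigenvalues of $\rho(t_{\mathfrak{c}})$ attached to Jordan blocks, $m(\lambda)$ is the block size, $\lambda=e^{2\pi i\mu(\lambda)}$, $0\le\mu(\lambda)<1$. The components are the coordinate functions. *)

theory Defs
  imports
    "HOL-Analysis.Analysis"
    "HOL-Algebra.Generated_Groups"
    "Jordan_Normal_Form.Jordan_Normal_Form"
begin

(* Elements of SL_2(R) are HOL-Analysis matrices (they carry the usual topology); the values of
   representations are matrices of Jordan_Normal_Form, whose size is a natural number. *)

no_notation vec_index (infixl "$" 100)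
notation vec_index (infixl "$v" 100)

section \<open>The groups SL(2,R) and PSL(2,R)\<close>

type_synonym mat2 = "real ^ 2 ^ 2"

abbreviation I2 :: mat2 where "I2 \<equiv> Finite_Cartesian_Product.mat 1"

definition mk2 :: "real \<Rightarrow> real \<Rightarrow> real \<Rightarrow> real \<Rightarrow> mat2" where
  "mk2 a b c d = vector [vector [a, b], vector [c, d]]"

definition SL2R :: "mat2 monoid" where
  "SL2R = \<lparr>carrier = {A. Determinants.det A = 1}, mult = (**), one = I2\<rparr>"

definition PSL2R :: "mat2 set monoid" where
  "PSL2R = SL2R Mod {I2, - I2}"

definition to_PSL :: "mat2 \<Rightarrow> mat2 set" where
  "to_PSL A = {I2, - I2} #>\<^bsub>SL2R\<^esub> A"

definition PSL2R_topology :: "mat2 set topology" where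
  "PSL2R_topology = topology (\<lambda>U. U \<subseteq> carrier PSL2R \<and>
     openin (top_of_set (carrier SL2R)) {A \<in> carrier SL2R. to_PSL A \<in> U})"

lemma openin_PSL2R_topology:
  "openin PSL2R_topology U \<longleftrightarrow> U \<subseteq> carrier PSL2R \<and>
     openin (top_of_set (carrier SL2R)) {A \<in> carrier SL2R. to_PSL A \<in> U}"
proof -
  define pre where "pre U = {A \<in> carrier SL2R. to_PSL A \<in> U}" for U
  have pre_Int: "pre (S \<inter> T) = pre S \<inter> pre T" for S T
    by (auto simp only: pre_def)
  have pre_Union: "pre (\<Union>K) = \<Union>(pre ` K)" for K
    by (auto simp only: pre_def)
  have "istopology (\<lambda>U. U \<subseteq> carrier PSL2R \<and> openin (top_of_set (carrier SL2R)) (pre U))"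
    unfolding istopology_def pre_Int pre_Union
    by (intro conjI allI impI openin_Int openin_Union) blast+
  then show ?thesis
    unfolding PSL2R_topology_def pre_def by (simp only: topology_inverse')
qed

section \<open>The action on the upper half plane and its boundary\<close>

definition upper_half_plane :: "complex set" where
  "upper_half_plane = {\<tau>. Im \<tau> > 0}"

definition moebius :: "mat2 \<Rightarrow> complex \<Rightarrow> complex" where
  "moebius A \<tau> = (of_real (A $ 1 $ 1) * \<tau> + of_real (A $ 1 $ 2)) /
                 (of_real (A $ 2 $ 1) * \<tau> + of_real (A $ 2 $ 2))"

datatype boundary_point = Fin real | Infty

fun moebius_bd :: "mat2 \<Rightarrow> boundary_point \<Rightarrow> boundary_point" where
  "moebius_bd A (Fin x) =
     (if A $ 2 $ 1 * x + A $ 2 $ 2 = 0 then Infty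
      else Fin ((A $ 1 $ 1 * x + A $ 1 $ 2) / (A $ 2 $ 1 * x + A $ 2 $ 2)))"
| "moebius_bd A Infty = (if A $ 2 $ 1 = 0 then Infty else Fin (A $ 1 $ 1 / A $ 2 $ 1))"

section \<open>Fuchsian groups of the first kind\<close>

definition hyperbolic_area :: "complex set \<Rightarrow> ennreal" where
  "hyperbolic_area F = (\<integral>\<^sup>+ z \<in> F. ennreal (1 / (Im z)\<^sup>2) \<partial>lborel)"

definition complex_atlas :: "'s topology \<Rightarrow> ('s set \<times> ('s \<Rightarrow> complex)) set \<Rightarrow> bool" where
  "complex_atlas S \<A> \<longleftrightarrow>
     (\<Union>(U, \<phi>)\<in>\<A>. U) = topspace S \<and>
     (\<forall>(U, \<phi>)\<in>\<A>. openin S U \<and> open (\<phi> ` U) \<and>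
        homeomorphic_map (subtopology S U) (top_of_set (\<phi> ` U)) \<phi>) \<and>
     (\<forall>(U, \<phi>)\<in>\<A>. \<forall>(V, \<psi>)\<in>\<A>. (\<psi> \<circ> inv_into U \<phi>) holomorphic_on \<phi> ` (U \<inter> V))"

definition compact_riemann_surface :: "'s topology \<Rightarrow> ('s set \<times> ('s \<Rightarrow> complex)) set \<Rightarrow> bool" where
  "compact_riemann_surface S \<A> \<longleftrightarrow>
     compact_space S \<and> Hausdorff_space S \<and> connected_space S \<and> complex_atlas S \<A>"

(* The quotient of the upper half plane by \<Gamma>, with the complex structure making the projection
   holomorphic, is a compact Riemann surface minus a finite set P.  Every compact Riemann surface
   has the cardinality of the continuum, so taking its points in the type complex (merely as a set
   of labels: the topology S is arbitrary) is no restriction. *)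
definition quotient_finitely_punctured :: "mat2 set set \<Rightarrow> bool" where
  "quotient_finitely_punctured \<Gamma> \<longleftrightarrow>
     (\<exists>(S :: complex topology) \<A> P \<pi>.
        compact_riemann_surface S \<A> \<and> finite P \<and> P \<subseteq> topspace S \<and>
        quotient_map (top_of_set upper_half_plane) (subtopology S (topspace S - P)) \<pi> \<and>
        (\<forall>z\<in>upper_half_plane. \<forall>w\<in>upper_half_plane.
           \<pi> z = \<pi> w \<longleftrightarrow> (\<exists>\<gamma>\<in>\<Gamma>. \<exists>A\<in>\<gamma>. w = moebius A z)) \<and>
        (\<forall>(U, \<phi>)\<in>\<A>. (\<phi> \<circ> \<pi>) holomorphic_on {z \<in> upper_half_plane. \<pi> z \<in> U}))"

definition fundamental_domain :: "mat2 set set \<Rightarrow> complex set \<Rightarrow> bool" where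
  "fundamental_domain \<Gamma> F \<longleftrightarrow>
     F \<subseteq> upper_half_plane \<and> F = closure (interior F) \<inter> upper_half_plane \<and>
     (\<Union>\<gamma>\<in>\<Gamma>. \<Union>A\<in>\<gamma>. moebius A ` F) = upper_half_plane \<and>
     (\<forall>\<gamma>\<in>\<Gamma>. \<gamma> \<noteq> \<one>\<^bsub>PSL2R\<^esub> \<longrightarrow>
        (\<forall>A\<in>\<gamma>. interior F \<inter> moebius A ` interior F = {}))"

definition fuchsian_first_kind :: "mat2 set set \<Rightarrow> bool" where
  "fuchsian_first_kind \<Gamma> \<longleftrightarrow>
     subgroup \<Gamma> PSL2R \<and> subtopology PSL2R_topology \<Gamma> = discrete_topology \<Gamma> \<and>
     quotient_finitely_punctured \<Gamma> \<and>
     (\<exists>F. fundamental_domain \<Gamma> F \<and> hyperbolic_area F < \<infinity>)"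

section \<open>Cusps\<close>

definition parabolic :: "mat2 \<Rightarrow> bool" where
  "parabolic A \<longleftrightarrow> A \<in> carrier SL2R \<and> (A $ 1 $ 1 + A $ 2 $ 2 = 2 \<or> A $ 1 $ 1 + A $ 2 $ 2 = - 2)"

definition is_cusp :: "mat2 set \<Rightarrow> boundary_point \<Rightarrow> bool" where
  "is_cusp G c \<longleftrightarrow> (\<exists>A\<in>G. parabolic A \<and> A \<noteq> I2 \<and> A \<noteq> - I2 \<and> moebius_bd A c = c)"

fun cusp_mat :: "boundary_point \<Rightarrow> mat2" where
  "cusp_mat (Fin x) = mk2 x (-1) 1 0"
| "cusp_mat Infty = I2"

definition cusp_translation :: "boundary_point \<Rightarrow> real \<Rightarrow> mat2" where
  "cusp_translation c h = cusp_mat c ** mk2 1 h 0 1 ** matrix_inv (cusp_mat c)"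

definition cusp_width :: "mat2 set \<Rightarrow> boundary_point \<Rightarrow> real" where
  "cusp_width G c = (THE h. h > 0 \<and>
     generate PSL2R {to_PSL (cusp_translation c h)} = to_PSL ` {A \<in> G. moebius_bd A c = c})"

definition cusp_generator :: "mat2 set \<Rightarrow> boundary_point \<Rightarrow> mat2" where
  "cusp_generator G c = cusp_translation c (cusp_width G c)"

definition log_q :: "mat2 set \<Rightarrow> boundary_point \<Rightarrow> complex \<Rightarrow> complex" where
  "log_q G c \<tau> =
     2 * of_real pi * \<i> * moebius (matrix_inv (cusp_mat c)) \<tau> / of_real (cusp_width G c)"

definition q_cusp :: "mat2 set \<Rightarrow> boundary_point \<Rightarrow> complex \<Rightarrow> complex" where
  "q_cusp G c \<tau> = exp (log_q G c \<tau>)"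

section \<open>Slash action and the form Delta\<close>

(* The weight is real so that Delta may have any real weight.  For an integral weight the
   principal power is the ordinary one, and only then is this an action. *)
definition slash :: "real \<Rightarrow> mat2 \<Rightarrow> (complex \<Rightarrow> complex) \<Rightarrow> complex \<Rightarrow> complex" where
  "slash k A f \<tau> =
     (of_real (A $ 2 $ 1) * \<tau> + of_real (A $ 2 $ 2)) powr (- of_real k) * f (moebius A \<tau>)"

fun cusp_factor :: "real \<Rightarrow> boundary_point \<Rightarrow> complex \<Rightarrow> complex" where
  "cusp_factor k (Fin x) \<tau> = (\<tau> - of_real x) powr (- of_real k)"
| "cusp_factor k Infty \<tau> = 1"

definition scalar_expansion ::
    "mat2 set \<Rightarrow> real \<Rightarrow> boundary_point \<Rightarrow> (complex \<Rightarrow> complex) \<Rightarrow> real \<Rightarrow> (nat \<Rightarrow> complex) \<Rightarrow> bool" where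
  "scalar_expansion G w c f \<mu> a \<longleftrightarrow> 0 \<le> \<mu> \<and> \<mu> < 1 \<and>
     (\<forall>\<tau>\<in>upper_half_plane. (\<lambda>n. a n * q_cusp G c \<tau> ^ n) summable_on UNIV \<and>
        f \<tau> = cusp_factor w c \<tau> * exp (of_real \<mu> * log_q G c \<tau>) *
               (\<Sum>\<^sub>\<infinity>n. a n * q_cusp G c \<tau> ^ n))"

(* c0 is the cusp at which Delta vanishes; it is Infty whenever Infty is a cusp.  The value of
   Delta at a cusp c is a 0 if \<mu> = 0, and 0 if \<mu> > 0. *)
definition Delta_form :: "mat2 set \<Rightarrow> boundary_point \<Rightarrow> real \<Rightarrow> (complex \<Rightarrow> complex) \<Rightarrow> bool" where
  "Delta_form G c0 w \<Delta> \<longleftrightarrow>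
     w \<noteq> 0 \<and> is_cusp G c0 \<and> (is_cusp G Infty \<longrightarrow> c0 = Infty) \<and>
     \<Delta> holomorphic_on upper_half_plane \<and>
     (\<forall>\<tau>\<in>upper_half_plane. \<Delta> \<tau> \<noteq> 0) \<and>
     (\<exists>v. \<forall>\<gamma>\<in>G. v \<gamma> \<noteq> 0 \<and> (\<forall>\<tau>\<in>upper_half_plane. slash w \<gamma> \<Delta> \<tau> = v \<gamma> * \<Delta> \<tau>)) \<and>
     (\<forall>c. is_cusp G c \<longrightarrow> (\<exists>\<mu> a. scalar_expansion G w c \<Delta> \<mu> a \<and>
        (\<mu> > 0 \<or> a 0 = 0 \<longleftrightarrow> (\<exists>\<gamma>\<in>G. c = moebius_bd \<gamma> c0))))"

(* \<nu> is the character of the weight one form Delta^(1/w) = exp (L / w), L a holomorphic logarithm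
   of Delta.  Changing L multiplies this form by a constant, so \<nu> is determined on G. *)
definition Delta_character ::
    "mat2 set \<Rightarrow> real \<Rightarrow> (complex \<Rightarrow> complex) \<Rightarrow> (mat2 \<Rightarrow> complex) \<Rightarrow> bool" where
  "Delta_character G w \<Delta> \<nu> \<longleftrightarrow>
     (\<exists>L. L holomorphic_on upper_half_plane \<and>
        (\<forall>\<tau>\<in>upper_half_plane. exp (L \<tau>) = \<Delta> \<tau>) \<and>
        (\<forall>\<gamma>\<in>G. \<forall>\<tau>\<in>upper_half_plane.
           slash 1 \<gamma> (\<lambda>z. exp (L z / of_real w)) \<tau> = \<nu> \<gamma> * exp (L \<tau> / of_real w)))"

section \<open>Representations\<close>

definition GL :: "nat \<Rightarrow> complex Matrix.mat monoid" where
  "GL m = units_of (ring_mat TYPE(complex) m ())"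

definition representation :: "mat2 set \<Rightarrow> nat \<Rightarrow> (mat2 \<Rightarrow> complex Matrix.mat) \<Rightarrow> bool" where
  "representation G m \<rho> \<longleftrightarrow> \<rho> \<in> hom (SL2R\<lparr>carrier := G\<rparr>) (GL m)"

definition std_rep :: "mat2 \<Rightarrow> complex Matrix.mat" where
  "std_rep A = mat_of_rows_list 2
     [[of_real (A $ 1 $ 1), of_real (A $ 1 $ 2)], [of_real (A $ 2 $ 1), of_real (A $ 2 $ 2)]]"

definition left_transversal :: "mat2 set \<Rightarrow> mat2 set \<Rightarrow> mat2 list \<Rightarrow> bool" where
  "left_transversal G H rs \<longleftrightarrow>
     set rs \<subseteq> G \<and> (\<forall>g\<in>G. \<exists>!i. i < length rs \<and> matrix_inv (rs ! i) ** g \<in> H)"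

(* The block matrix whose (i,j) block is \<sigma> (r_i^-1 \<gamma> r_j), where \<sigma> (of rank n) is extended by 0
   outside H. *)
definition induced_rep ::
    "nat \<Rightarrow> mat2 list \<Rightarrow> mat2 set \<Rightarrow> (mat2 \<Rightarrow> complex Matrix.mat) \<Rightarrow> mat2 \<Rightarrow> complex Matrix.mat" where
  "induced_rep n rs H \<sigma> \<gamma> = Matrix.mat (length rs * n) (length rs * n) (\<lambda>(a, b).
     let h = matrix_inv (rs ! (a div n)) ** \<gamma> ** (rs ! (b div n))
     in if h \<in> H then \<sigma> h $$ (a mod n, b mod n) else 0)"

definition twisted_induced_reps :: "mat2 set \<Rightarrow> (mat2 \<Rightarrow> complex) \<Rightarrow> (mat2 \<Rightarrow> complex Matrix.mat) set" where
  "twisted_induced_reps G \<nu> =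
     {\<rho>. \<exists>(k :: int) H rs.
        subgroup H (SL2R\<lparr>carrier := G\<rparr>) \<and> - I2 \<in> H \<and>
        finite (rcosets\<^bsub>SL2R\<lparr>carrier := G\<rparr>\<^esub> H) \<and> left_transversal G H rs \<and>
        (\<forall>\<gamma>\<in>G. \<rho> \<gamma> = (\<nu> \<gamma> powi k) \<cdot>\<^sub>m induced_rep 2 rs H std_rep \<gamma>)}"

definition diagonalizable :: "complex Matrix.mat \<Rightarrow> bool" where
  "diagonalizable A \<longleftrightarrow> (\<exists>D. diagonal_mat D \<and> similar_mat A D)"

definition logarithmic_rep :: "mat2 set \<Rightarrow> (mat2 \<Rightarrow> complex Matrix.mat) \<Rightarrow> bool" where
  "logarithmic_rep G \<rho> \<longleftrightarrow>
     (\<forall>\<gamma>\<in>G. parabolic \<gamma> \<longrightarrow> (\<forall>ev. eigenvalue (\<rho> \<gamma>) ev \<longrightarrow> cmod ev = 1)) \<and>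
     (\<exists>\<gamma>\<in>G. parabolic \<gamma> \<and> \<not> diagonalizable (\<rho> \<gamma>))"

section \<open>Logarithmic vector-valued automorphic forms\<close>

definition \<mu>_exponent :: "complex \<Rightarrow> real" where
  "\<mu>_exponent ev = Arg2pi ev / (2 * pi)"

(* The p-th entry (m(\<lambda>), \<lambda>) of blocks is the size and eigenvalue of the p-th Jordan block. *)
definition log_expansion ::
    "mat2 set \<Rightarrow> nat \<Rightarrow> (mat2 \<Rightarrow> complex Matrix.mat) \<Rightarrow> int \<Rightarrow> boundary_point \<Rightarrow>
     (complex \<Rightarrow> complex Matrix.vec) \<Rightarrow> bool" where
  "log_expansion G m \<rho> k c X \<longleftrightarrow>
     (\<exists>blocks (M :: int) (x :: nat \<Rightarrow> nat \<Rightarrow> int \<Rightarrow> complex Matrix.vec).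
        jordan_nf (\<rho> (cusp_generator G c)) blocks \<and>
        (\<forall>p j n. x p j n \<in> carrier_vec m) \<and>
        (\<forall>\<tau>\<in>upper_half_plane. \<forall>i<m.
           (\<forall>p<length blocks. \<forall>j<fst (blocks ! p).
              (\<lambda>n. (x p j n $v i) * q_cusp G c \<tau> powi n) summable_on {- M..}) \<and>
           X \<tau> $v i = cusp_factor (of_int k) c \<tau> *
             (\<Sum>p<length blocks. \<Sum>j<fst (blocks ! p).
                log_q G c \<tau> ^ j *
                exp (of_real (\<mu>_exponent (snd (blocks ! p))) * log_q G c \<tau>) *
                (\<Sum>\<^sub>\<infinity>n\<in>{- M..}. (x p j n $v i) * q_cusp G c \<tau> powi n))))"

definition logarithmic_vvaf ::
    "mat2 set \<Rightarrow> nat \<Rightarrow> (mat2 \<Rightarrow> complex Matrix.mat) \<Rightarrow> int \<Rightarrow>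
     (complex \<Rightarrow> complex Matrix.vec) \<Rightarrow> bool" where
  "logarithmic_vvaf G m \<rho> k X \<longleftrightarrow>
     representation G m \<rho> \<and> logarithmic_rep G \<rho> \<and>
     \<rho> I2 = exp (\<i> * of_real pi * of_int k) \<cdot>\<^sub>m \<rho> (- I2) \<and>
     (\<forall>\<tau>\<in>upper_half_plane. X \<tau> \<in> carrier_vec m) \<and>
     (\<forall>i<m. (\<lambda>\<tau>. X \<tau> $v i) holomorphic_on upper_half_plane) \<and>
     (\<forall>\<gamma>\<in>G. \<forall>\<tau>\<in>upper_half_plane. \<forall>i<m.
        slash (of_int k) \<gamma> (\<lambda>z. X z $v i) \<tau> = (\<rho> \<gamma> *\<^sub>v X \<tau>) $v i) \<and>
     (\<forall>c. is_cusp G c \<longrightarrow> log_expansion G m \<rho> k c X)"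

definition independent_components :: "nat \<Rightarrow> (complex \<Rightarrow> complex Matrix.vec) \<Rightarrow> bool" where
  "independent_components m X \<longleftrightarrow>
     (\<forall>a :: nat \<Rightarrow> complex. (\<forall>\<tau>\<in>upper_half_plane. (\<Sum>i<m. a i * (X \<tau> $v i)) = 0) \<longrightarrow>
        (\<forall>i<m. a i = 0))"

end

theory Submission
  imports
    "HOL-Complex_Analysis.Complex_Analysis"
    "Jordan_Normal_Form.Jordan_Normal_Form_Existence"
    Defs
begin

text \<open>Let \<open>f\<^sub>S(\<tau>)\<close> be the Poincare series \<open>\<Sum> (a\<tau> + b - z\<^sub>0* (c\<tau> + d))\<^sup>-\<^sup>s\<close> over the matrices
  \<open>(a, b; c, d)\<close> of a set \<open>S\<close>, where \<open>z\<^sub>0*\<close> is the conjugate of an interior point \<open>z\<^sub>0\<close> of a fundamental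
  domain.  A crude count of the elements of a discrete group gives absolute convergence for \<open>s \<ge> 10\<close>,
  and the bound \<open>|a\<tau> + b - z\<^sub>0* (c\<tau> + d)| \<ge> C\<^sup>-\<^sup>1 (|a| + |b| + |c| + |d|)\<close>, uniform for \<open>|Re \<tau>| \<le> x\<close> and
  \<open>Im \<tau> \<ge> y\<close>, shows that the series is bounded near every cusp.  The slash action permutes the
  series of the cosets \<open>H r\<^sub>i\<^sup>-\<^sup>1\<close>; at \<open>\<tau> = r\<^sub>i z\<^sub>0\<close> the terms \<open>\<plusminus>r\<^sub>i\<^sup>-\<^sup>1\<close> outweigh all others together
  when \<open>s\<close> is large, since \<open>z\<^sub>0\<close> has trivial stabilizer, so these series are linearly independent.

  The form is then \<open>\<Delta>\<^bsup>k/w\<^esup>\<close> times the vector with blocks \<open>f\<^sub>i r\<^sub>i\<^sup>-\<^sup>1 (\<tau>, 1)\<^sup>T\<close>.  Its expansion at a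
  cusp comes from solving \<open>u(\<tau> + h) = J u(\<tau>)\<close> for a Jordan block \<open>J\<close> in the basis of the binomial
  coefficients \<open>\<tau>/h\<close> over \<open>j\<close>.  That the induced matrices form a representation, and their value
  at \<open>-I\<close>, follow from equivariance and independence.\<close>

unbundle no fps_syntax
no_notation fps_nth (infixl \<open>$\<close> 75)
no_notation vec_index (infixl "$" 100)

section \<open>The action of SL(2,R) on the upper half plane\<close>

text \<open>\<open>std_rep\<close> on H is the restriction of a representation of all of G, so
  inducing it gives the tensor product of that representation with the permutation representation on
  the cosets of H. A form for the product is a product of forms: the vector (\<tau>, 1), of weight
  -1, and scalar functions of weight s that G permutes like the cosets. Scalar Poincare series
  therefore suffice, and their convergence is untouched by the growth of \<rho> at the cusps. The
  conjugate of z0 lies in the lower half plane, so no term has a pole; s is even so that the terms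
  of A and -A reinforce each other. The obstacle is independence: independent functions f_i need not
  remain independent when the products \<tau> f_i are added. A cusp removes it, because it supplies
  infinitely many translations but only finitely many permutations of the cosets, so two of them
  permute alike and their relations can be subtracted. The same cusp makes \<rho> logarithmic: along
  the powers of its generator \<rho> grows linearly, which is slower than every exponential and yet
  unbounded.\<close>

lemma mk2_entries [simp]:
  "mk2 a b c d $ 1 $ 1 = a" "mk2 a b c d $ 1 $ 2 = b"
  "mk2 a b c d $ 2 $ 1 = c" "mk2 a b c d $ 2 $ 2 = d"
  by (simp_all add: mk2_def)

lemma mat2_eq_iff:
  "(A :: mat2) = B \<longleftrightarrow> A $ 1 $ 1 = B $ 1 $ 1 \<and> A $ 1 $ 2 = B $ 1 $ 2 \<and>
     A $ 2 $ 1 = B $ 2 $ 1 \<and> A $ 2 $ 2 = B $ 2 $ 2"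
  by (auto simp: Finite_Cartesian_Product.vec_eq_iff forall_2)

lemma mat2_mult_entry: "((A :: mat2) ** B) $ i $ j = A $ i $ 1 * B $ 1 $ j + A $ i $ 2 * B $ 2 $ j"
  by (simp add: matrix_matrix_mult_def sum_2)

lemma mat2_one_entries [simp]:
  "I2 $ 1 $ 1 = 1" "I2 $ 1 $ 2 = 0" "I2 $ 2 $ 1 = 0" "I2 $ 2 $ 2 = 1"
  by (simp_all add: Finite_Cartesian_Product.mat_def)

lemma SL2R_carrier: "A \<in> carrier SL2R \<longleftrightarrow> A $ 1 $ 1 * A $ 2 $ 2 - A $ 1 $ 2 * A $ 2 $ 1 = 1"
  by (simp add: SL2R_def det_2)

lemma SL2R_simps [simp]: "A \<otimes>\<^bsub>SL2R\<^esub> B = A ** B" "\<one>\<^bsub>SL2R\<^esub> = I2"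
  by (simp_all add: SL2R_def)

text \<open>The adjugate. It inverts matrices of determinant one by a formula, whereas
  \<open>matrix_inv\<close> is a choice, so identities can be checked entry by entry.\<close>

definition inv2 :: "mat2 \<Rightarrow> mat2" where
  "inv2 A = mk2 (A $ 2 $ 2) (- A $ 1 $ 2) (- A $ 2 $ 1) (A $ 1 $ 1)"

lemma inv2_entries [simp]:
  "inv2 A $ 1 $ 1 = A $ 2 $ 2" "inv2 A $ 1 $ 2 = - A $ 1 $ 2"
  "inv2 A $ 2 $ 1 = - A $ 2 $ 1" "inv2 A $ 2 $ 2 = A $ 1 $ 1"
  by (simp_all add: inv2_def)

lemma inv2_mult:
  assumes "A \<in> carrier SL2R"
  shows "inv2 A ** A = I2" "A ** inv2 A = I2"
  using assms by (auto simp: mat2_eq_iff mat2_mult_entry SL2R_carrier algebra_simps)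

lemma matrix_inv_SL2R:
  assumes "A \<in> carrier SL2R"
  shows "matrix_inv A = inv2 A"
  unfolding matrix_inv_def
proof (rule some_equality)
  show "A ** inv2 A = I2 \<and> inv2 A ** A = I2" by (simp add: inv2_mult assms)
  show "B = inv2 A" if "A ** B = I2 \<and> B ** A = I2" for B
    using that inv2_mult[OF assms] by (metis matrix_mul_assoc matrix_mul_lid matrix_mul_rid)
qed

lemma inv2_carrier [simp]: "A \<in> carrier SL2R \<Longrightarrow> inv2 A \<in> carrier SL2R"
  by (simp add: SL2R_carrier algebra_simps)

lemma mult_carrier [simp]:
  "A \<in> carrier SL2R \<Longrightarrow> B \<in> carrier SL2R \<Longrightarrow> A ** B \<in> carrier SL2R"
  by (simp add: SL2R_def det_mul)

lemma I2_carrier [simp]: "I2 \<in> carrier SL2R" "- I2 \<in> carrier SL2R"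
  by (simp_all add: SL2R_carrier)

lemma minus_carrier [simp]: "- A \<in> carrier SL2R \<longleftrightarrow> A \<in> carrier SL2R"
  by (simp add: SL2R_carrier)

lemma mat2_mult_minus: "(- A) ** B = - (A ** B)" "A ** (- B) = - (A ** B)" for A B :: mat2
  by (simp_all add: mat2_eq_iff mat2_mult_entry)

lemma inv2_inv2 [simp]: "inv2 (inv2 A) = A"
  by (simp add: mat2_eq_iff)

lemma inv2_mult_distrib: "inv2 (A ** B) = inv2 B ** inv2 A"
  by (simp add: mat2_eq_iff mat2_mult_entry)

lemma inv2_cancel:
  assumes "A \<in> carrier SL2R"
  shows "inv2 A ** (A ** B) = B" "A ** (inv2 A ** B) = B"
    "(B ** A) ** inv2 A = B" "(B ** inv2 A) ** A = B"
  using inv2_mult[OF assms] by (simp_all add: matrix_mul_assoc) (simp_all flip: matrix_mul_assoc)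

lemma group_SL2R: "Group.group SL2R"
proof (rule groupI)
  fix x assume "x \<in> carrier SL2R"
  then show "\<exists>y\<in>carrier SL2R. y \<otimes>\<^bsub>SL2R\<^esub> x = \<one>\<^bsub>SL2R\<^esub>"
    by (intro bexI[of _ "inv2 x"]) (auto simp: inv2_mult)
qed (auto simp: matrix_mul_assoc)

lemma inv_SL2R: "A \<in> carrier SL2R \<Longrightarrow> inv\<^bsub>SL2R\<^esub> A = inv2 A"
  using group.inv_equality[OF group_SL2R, of "inv2 A" A] by (simp add: inv2_mult)

abbreviation numer :: "mat2 \<Rightarrow> complex \<Rightarrow> complex" where
  "numer A \<tau> \<equiv> of_real (A $ 1 $ 1) * \<tau> + of_real (A $ 1 $ 2)"

abbreviation autom :: "mat2 \<Rightarrow> complex \<Rightarrow> complex" where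
  "autom A \<tau> \<equiv> of_real (A $ 2 $ 1) * \<tau> + of_real (A $ 2 $ 2)"

lemma autom_nonzero:
  assumes "A \<in> carrier SL2R" "\<tau> \<in> upper_half_plane"
  shows "autom A \<tau> \<noteq> 0"
proof
  assume "autom A \<tau> = 0"
  then have "A $ 2 $ 1 * Im \<tau> = 0" "A $ 2 $ 1 * Re \<tau> + A $ 2 $ 2 = 0"
    by (auto simp: complex_eq_iff)
  with assms show False
    by (auto simp: upper_half_plane_def SL2R_carrier)
qed

lemma Im_numer_cnj_autom:
  assumes "A \<in> carrier SL2R"
  shows "Im (numer A \<tau> * cnj (autom A \<tau>)) = Im \<tau>"
proof -
  have "Im (numer A \<tau> * cnj (autom A \<tau>)) = (A $ 1 $ 1 * A $ 2 $ 2 - A $ 1 $ 2 * A $ 2 $ 1) * Im \<tau>"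
    by (simp add: algebra_simps)
  then show ?thesis using assms by (simp add: SL2R_carrier)
qed

lemma moebius_upper_half_plane:
  assumes "A \<in> carrier SL2R" "\<tau> \<in> upper_half_plane"
  shows "moebius A \<tau> \<in> upper_half_plane"
proof -
  have nz: "autom A \<tau> \<noteq> 0" by (rule autom_nonzero[OF assms])
  have "moebius A \<tau> = numer A \<tau> * cnj (autom A \<tau>) / of_real ((norm (autom A \<tau>))\<^sup>2)"
    using nz unfolding moebius_def complex_norm_square 
    by (subst mult_divide_mult_cancel_right) (simp_all only: complex_cnj_zero_iff simp_thms)
  then have "Im (moebius A \<tau>) = Im \<tau> / (norm (autom A \<tau>))\<^sup>2"
    by (simp only: Im_divide_of_real Im_numer_cnj_autom[OF assms(1)])
  with assms(2) nz show ?thesis by (simp add: upper_half_plane_def)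
qed

lemma
  assumes "B \<in> carrier SL2R" "\<tau> \<in> upper_half_plane"
  shows numer_mult: "numer (A ** B) \<tau> = numer A (moebius B \<tau>) * autom B \<tau>"
    and autom_mult: "autom (A ** B) \<tau> = autom A (moebius B \<tau>) * autom B \<tau>"
  using autom_nonzero[OF assms] by (simp_all add: moebius_def mat2_mult_entry field_simps)

lemma moebius_mult:
  assumes "B \<in> carrier SL2R" "\<tau> \<in> upper_half_plane"
  shows "moebius (A ** B) \<tau> = moebius A (moebius B \<tau>)"
  using autom_nonzero[OF assms] numer_mult[OF assms] autom_mult[OF assms]
  by (simp add: moebius_def[of "A ** B"] moebius_def[of A])

lemma moebius_I2 [simp]: "moebius I2 \<tau> = \<tau>"
  by (simp add: moebius_def)

lemma moebius_minus [simp]: "moebius (- A) \<tau> = moebius A \<tau>"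
proof -
  have "numer (- A) \<tau> = - numer A \<tau>" "autom (- A) \<tau> = - autom A \<tau>" by simp_all
  then show ?thesis unfolding moebius_def by (simp only: minus_divide_divide)
qed

lemma moebius_inv2:
  assumes "A \<in> carrier SL2R" "\<tau> \<in> upper_half_plane"
  shows "moebius (inv2 A) (moebius A \<tau>) = \<tau>" "moebius A (moebius (inv2 A) \<tau>) = \<tau>"
  using moebius_mult[OF assms, of "inv2 A"] moebius_mult[of "inv2 A" \<tau> A] assms
  by (simp_all add: inv2_mult)

lemma moebius_holomorphic:
  "A \<in> carrier SL2R \<Longrightarrow> moebius A holomorphic_on upper_half_plane"
  unfolding moebius_def using autom_nonzero by (intro holomorphic_intros) auto

lemma open_upper_half_plane [simp]: "open upper_half_plane"
  unfolding upper_half_plane_def by (rule open_halfspace_Im_gt)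

lemma slash_of_int:
  assumes "A \<in> carrier SL2R" "\<tau> \<in> upper_half_plane"
  shows "slash (of_int k) A f \<tau> = autom A \<tau> powi (- k) * f (moebius A \<tau>)"
proof -
  have "autom A \<tau> powr (- of_real (of_int k)) = autom A \<tau> powr (of_int (- k))" by simp
  also have "\<dots> = autom A \<tau> powi (- k)"
    using autom_nonzero[OF assms] by (intro complex_powr_of_int) auto
  finally show ?thesis unfolding slash_def by simp
qed

section \<open>Counting elements of a discrete group\<close>

text \<open>The entrywise l1 norm is submultiplicative and, since the adjugate only permutes entries
  up to sign, takes the same value at a matrix and at its inverse in SL(2,R).\<close>

definition mnorm :: "mat2 \<Rightarrow> real" where
  "mnorm A = \<bar>A $ 1 $ 1\<bar> + \<bar>A $ 1 $ 2\<bar> + \<bar>A $ 2 $ 1\<bar> + \<bar>A $ 2 $ 2\<bar>"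

lemma mnorm_mult: "mnorm (A ** B) \<le> mnorm A * mnorm B"
proof -
  have "\<bar>x * y + z * w\<bar> \<le> \<bar>x\<bar> * \<bar>y\<bar> + \<bar>z\<bar> * \<bar>w\<bar>" for x y z w :: real
    by (rule order_trans[OF abs_triangle_ineq]) (simp add: abs_mult)
  then have "\<bar>(A ** B) $ i $ j\<bar> \<le> \<bar>A $ i $ 1\<bar> * \<bar>B $ 1 $ j\<bar> + \<bar>A $ i $ 2\<bar> * \<bar>B $ 2 $ j\<bar>" for i j
    by (simp add: mat2_mult_entry)
  from this[of 1 1] this[of 1 2] this[of 2 1] this[of 2 2]
  have "mnorm (A ** B) \<le>
      (\<bar>A $ 1 $ 1\<bar> + \<bar>A $ 2 $ 1\<bar>) * (\<bar>B $ 1 $ 1\<bar> + \<bar>B $ 1 $ 2\<bar>) +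
      (\<bar>A $ 1 $ 2\<bar> + \<bar>A $ 2 $ 2\<bar>) * (\<bar>B $ 2 $ 1\<bar> + \<bar>B $ 2 $ 2\<bar>)"
    unfolding mnorm_def by (simp add: algebra_simps)
  also have "\<dots> \<le> mnorm A * mnorm B"
  proof -
    have "0 \<le> (\<bar>A $ 1 $ 1\<bar> + \<bar>A $ 2 $ 1\<bar>) * (\<bar>B $ 2 $ 1\<bar> + \<bar>B $ 2 $ 2\<bar>)"
      "0 \<le> (\<bar>A $ 1 $ 2\<bar> + \<bar>A $ 2 $ 2\<bar>) * (\<bar>B $ 1 $ 1\<bar> + \<bar>B $ 1 $ 2\<bar>)" by simp_all
    then show ?thesis unfolding mnorm_def by (simp add: algebra_simps)
  qed
  finally show ?thesis .
qed

lemma mnorm_inv2 [simp]: "mnorm (inv2 A) = mnorm A"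
  by (simp add: mnorm_def)

lemma mnorm_nonneg [simp]: "0 \<le> mnorm A"
  by (simp add: mnorm_def)

lemma mnorm_entry: "\<bar>A $ i $ j\<bar> \<le> mnorm A"
  using exhaust_2[of i] exhaust_2[of j] by (auto simp: mnorm_def)

text \<open>The determinant 1 is a difference of two products of entries and hence at most the
  square of the norm.\<close>

lemma mnorm_ge_1:
  assumes "A \<in> carrier SL2R"
  shows "1 \<le> mnorm A"
proof -
  have "1 = A $ 1 $ 1 * A $ 2 $ 2 - A $ 1 $ 2 * A $ 2 $ 1"
    using assms by (simp add: SL2R_carrier)
  also have "\<dots> \<le> \<bar>A $ 1 $ 1\<bar> * \<bar>A $ 2 $ 2\<bar> + \<bar>A $ 1 $ 2\<bar> * \<bar>A $ 2 $ 1\<bar>"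
    unfolding abs_mult[symmetric] by linarith
  also have "\<dots> \<le> mnorm A * mnorm A"
  proof -
    have "0 \<le> \<bar>A $ 1 $ 1\<bar> * mnorm A" "0 \<le> \<bar>A $ 1 $ 2\<bar> * mnorm A" by (simp_all)
    have "\<bar>A $ 1 $ 1\<bar> * \<bar>A $ 2 $ 2\<bar> \<le> \<bar>A $ 1 $ 1\<bar> * mnorm A"
      "\<bar>A $ 1 $ 2\<bar> * \<bar>A $ 2 $ 1\<bar> \<le> \<bar>A $ 1 $ 2\<bar> * mnorm A"
      by (intro mult_left_mono mnorm_entry; simp)+
    moreover have "(\<bar>A $ 1 $ 1\<bar> + \<bar>A $ 1 $ 2\<bar>) * mnorm A \<le> mnorm A * mnorm A"
      by (intro mult_right_mono) (auto simp: mnorm_def)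
    ultimately show ?thesis by (simp add: algebra_simps)
  qed
  finally have "1\<^sup>2 \<le> (mnorm A)\<^sup>2" by (simp add: power2_eq_square)
  then show ?thesis by (rule power2_le_imp_le) simp
qed

lemma mnorm_pos: "A \<in> carrier SL2R \<Longrightarrow> 0 < mnorm A"
  using mnorm_ge_1 by fastforce

lemma norm_le_mnorm: "norm A \<le> mnorm A"
proof -
  have "norm A \<le> (\<Sum>i\<in>UNIV. norm (A $ i))"
    unfolding norm_vec_def by (rule L2_set_le_sum) simp
  also have "\<dots> \<le> (\<Sum>i\<in>UNIV. \<Sum>j\<in>UNIV. \<bar>A $ i $ j\<bar>)"
    by (intro sum_mono norm_le_l1_cart)
  finally show ?thesis by (simp add: sum_2 mnorm_def)
qed

lemma
  assumes "subgroup G SL2R"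
  shows subgroup_SL2R_subset: "G \<subseteq> carrier SL2R"
    and subgroup_SL2R_one: "I2 \<in> G"
    and subgroup_SL2R_mult: "A \<in> G \<Longrightarrow> B \<in> G \<Longrightarrow> A ** B \<in> G"
    and subgroup_SL2R_inv2: "A \<in> G \<Longrightarrow> inv2 A \<in> G"
proof -
  show sub: "G \<subseteq> carrier SL2R" "I2 \<in> G" "A \<in> G \<Longrightarrow> B \<in> G \<Longrightarrow> A ** B \<in> G"
    using subgroup.subset[OF assms] subgroup.one_closed[OF assms] subgroup.m_closed[OF assms, of A B] by auto
  show "inv2 A \<in> G" if "A \<in> G"
    using subgroup.m_inv_closed[OF assms that] inv_SL2R[of A] that sub(1) by auto
qed

lemma to_PSL_eq: "to_PSL A = {A, - A}"
  by (auto simp: to_PSL_def r_coset_def mat2_mult_minus)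

lemma to_PSL_eq_iff: "to_PSL A = to_PSL B \<longleftrightarrow> A = B \<or> A = - B"
  by (auto simp: to_PSL_eq doubleton_eq_iff)

text \<open>Discreteness of the image in PSL(2,R), restated inside SL(2,R) and in terms of
  \<open>mnorm\<close>, which is the form the counting argument needs.\<close>

definition isolated_identity :: "mat2 set \<Rightarrow> bool" where
  "isolated_identity G \<longleftrightarrow> (\<exists>\<epsilon>>0. \<forall>A\<in>G. mnorm (A - I2) < \<epsilon> \<longrightarrow> A = I2)"

lemma isolated_identity_discrete:
  assumes G: "subgroup G SL2R"
    and discrete: "subtopology PSL2R_topology (to_PSL ` G) = discrete_topology (to_PSL ` G)"
  shows "isolated_identity G"
proof -
  have sub: "G \<subseteq> carrier SL2R" and one: "I2 \<in> G"
    using subgroup_SL2R_subset[OF G] subgroup_SL2R_one[OF G] by auto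
  have "openin (subtopology PSL2R_topology (to_PSL ` G)) {to_PSL I2}"
    unfolding discrete using one by simp
  then obtain U where U: "openin PSL2R_topology U" "{to_PSL I2} = U \<inter> to_PSL ` G"
    by (auto simp: openin_subtopology)
  then have "openin (top_of_set (carrier SL2R)) {A \<in> carrier SL2R. to_PSL A \<in> U}"
    by (simp add: openin_PSL2R_topology)
  moreover have "I2 \<in> {A \<in> carrier SL2R. to_PSL A \<in> U}" using U by auto
  ultimately obtain e where e: "e > 0"
    "\<And>A. A \<in> carrier SL2R \<Longrightarrow> dist A I2 < e \<Longrightarrow> to_PSL A \<in> U"
    unfolding openin_euclidean_subtopology_iff by blast
  \<comment> \<open>The topology on PSL(2,R) cannot tell I from -I; the radius 1 does, because -I
    has distance 4 from I.\<close>
  have "A = I2" if A: "A \<in> G" "mnorm (A - I2) < min e 1" for A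
  proof -
    have "dist A I2 < e" using norm_le_mnorm[of "A - I2"] A by (simp add: dist_norm)
    then have "to_PSL A \<in> U \<inter> to_PSL ` G" using e A sub by auto
    then have "A = I2 \<or> A = - I2" using U(2) by (metis singletonD to_PSL_eq_iff)
    moreover have "mnorm (- I2 - I2) = 4" by (simp add: mnorm_def)
    ultimately show ?thesis using A by auto
  qed
  then show ?thesis unfolding isolated_identity_def
    using \<open>e > 0\<close> by (intro exI[of _ "min e 1"]) auto
qed

text \<open>Pigeonhole on boxes of side 1/(kn) in the space of entries: if A and B lie in one box,
  then \<open>inv2 A ** B - I2 = inv2 A ** (B - A)\<close> has norm at most n * 4/(kn) = 4/k <
  \<epsilon>, so A = B. About 2kn^2 floor values are possible for each of the four entries, which
  gives the exponent 8.\<close>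

lemma mnorm_count:
  assumes G: "subgroup G SL2R" and iso: "isolated_identity G"
  shows "\<exists>C. \<forall>n\<ge>1. finite {A \<in> G. mnorm A \<le> real n} \<and>
    real (card {A \<in> G. mnorm A \<le> real n}) \<le> C * real n ^ 8"
proof -
  have sub: "G \<subseteq> carrier SL2R"
    by (rule subgroup_SL2R_subset[OF G])
  obtain \<epsilon> where \<epsilon>: "\<epsilon> > 0" "\<And>A. A \<in> G \<Longrightarrow> mnorm (A - I2) < \<epsilon> \<Longrightarrow> A = I2"
    using iso by (auto simp: isolated_identity_def)
  obtain k :: nat where k: "real k > 4 / \<epsilon>" by (meson reals_Archimedean2)
  have kpos: "k > 0" using k \<epsilon> by (intro gr0I) (auto simp: field_simps)
  have main: "finite {A \<in> G. mnorm A \<le> real n} \<and>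
      card {A \<in> G. mnorm A \<le> real n} \<le> (4 * (k * n\<^sup>2)) ^ 4" if n: "n \<ge> 1" for n
  proof -
    let ?S = "{A \<in> G. mnorm A \<le> real n}"
    define K where "K = real (k * n)"
    have K: "K > 0" using n kpos by (simp add: K_def)
    define f where "f A = (\<lfloor>A $ 1 $ 1 * K\<rfloor>, \<lfloor>A $ 1 $ 2 * K\<rfloor>, \<lfloor>A $ 2 $ 1 * K\<rfloor>, \<lfloor>A $ 2 $ 2 * K\<rfloor>)"
      for A :: mat2
    let ?J = "{- int (k * n\<^sup>2) - 1 .. int (k * n\<^sup>2)}"
    have inj: "inj_on f ?S"
    proof (rule inj_onI)
      fix A B assume A: "A \<in> ?S" and B: "B \<in> ?S" and eq: "f A = f B"
      have fl: "\<bar>x - y\<bar> * K < 1" if "\<lfloor>x * K\<rfloor> = \<lfloor>y * K\<rfloor>" for x y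
      proof -
        have "\<bar>x * K - y * K\<bar> < 1" using that by linarith
        then show ?thesis using K by (metis abs_mult abs_of_pos left_diff_distrib)
      qed
      have "mnorm (B - A) * K < 4"
        using eq fl[of "B $ 1 $ 1" "A $ 1 $ 1"] fl[of "B $ 1 $ 2" "A $ 1 $ 2"]
          fl[of "B $ 2 $ 1" "A $ 2 $ 1"] fl[of "B $ 2 $ 2" "A $ 2 $ 2"]
        unfolding mnorm_def f_def by (simp add: distrib_right)
      then have 1: "mnorm (B - A) * real n < 4 / real k"
        using kpos by (simp add: K_def field_simps)
      have AS: "A \<in> carrier SL2R" using A sub by auto
      have "inv2 A ** B - I2 = inv2 A ** (B - A)"
        unfolding inv2_mult(1)[OF AS, symmetric] by (simp add: mat2_eq_iff mat2_mult_entry algebra_simps)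
      then have "mnorm (inv2 A ** B - I2) \<le> mnorm A * mnorm (B - A)"
        by (metis mnorm_inv2 mnorm_mult)
      also have "\<dots> \<le> real n * mnorm (B - A)"
        using A by (intro mult_right_mono) auto
      also have "\<dots> < 4 / real k" using 1 by (simp add: mult.commute)
      also have "\<dots> < \<epsilon>" using k \<epsilon>(1) kpos by (simp add: field_simps)
      finally have "mnorm (inv2 A ** B - I2) < \<epsilon>" .
      moreover have "inv2 A ** B \<in> G"
        using A B by (intro subgroup_SL2R_mult[OF G] subgroup_SL2R_inv2[OF G]) auto
      ultimately have "inv2 A ** B = I2" using \<epsilon>(2) by blast
      then show "A = B" using inv2_cancel(2)[OF AS, of B] by simp
    qed
    have img: "f ` ?S \<subseteq> ?J \<times> ?J \<times> ?J \<times> ?J"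
    proof -
      have "\<lfloor>A $ i $ j * K\<rfloor> \<in> ?J" if "A \<in> ?S" for A i j
      proof -
        have "\<bar>A $ i $ j * K\<bar> \<le> real n * K"
          using mnorm_entry[of A i j] that K by (auto simp: abs_mult intro!: mult_right_mono)
        also have "\<dots> = real (k * n\<^sup>2)" by (simp add: K_def power2_eq_square)
        finally show ?thesis unfolding atLeastAtMost_iff by linarith
      qed
      then show ?thesis by (auto simp: f_def simp del: atLeastAtMost_iff)
    qed
    have fin: "finite ?S" by (rule inj_on_finite[OF inj img]) simp
    have "card ?S \<le> card (?J \<times> ?J \<times> ?J \<times> ?J)"
      by (rule card_inj_on_le[OF inj img]) simp
    also have "\<dots> = (2 * (k * n\<^sup>2) + 2) ^ 4"
    proof -
      have "card ?J = 2 * (k * n\<^sup>2) + 2"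
        unfolding card_atLeastAtMost_int by linarith
      then show ?thesis by (simp only: card_cartesian_product) (simp add: power4_eq_xxxx)
    qed
    also have "\<dots> \<le> (4 * (k * n\<^sup>2)) ^ 4"
    proof (rule power_mono)
      have "1 \<le> k * n\<^sup>2" using kpos n by simp
      then show "2 * (k * n\<^sup>2) + 2 \<le> 4 * (k * n\<^sup>2)" by linarith
    qed simp
    finally show ?thesis using fin by simp
  qed
  show ?thesis
  proof (intro exI[of _ "real (4 * k) ^ 4"] allI impI conjI)
    fix n :: nat assume n: "n \<ge> 1"
    have "real (card {A \<in> G. mnorm A \<le> real n}) \<le> real ((4 * (k * n\<^sup>2)) ^ 4)"
      using main[OF n] by (simp only: of_nat_le_iff)
    also have "\<dots> = real (4 * k) ^ 4 * real n ^ 8"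
      by (simp add: power_mult_distrib flip: power_mult)
    finally show "real (card {A \<in> G. mnorm A \<le> real n}) \<le> real (4 * k) ^ 4 * real n ^ 8" .
  qed (use main in auto)
qed

text \<open>Grouped by the integer part n of the norm, at most C (n+1)^8 \<le> 2^8 C n^8 elements
  contribute at most n^(-10) each, and the sum of 1/n^2 converges. The exponent 10 is the 8 of the
  count plus 2.\<close>

lemma mnorm_summable:
  assumes G: "subgroup G SL2R" and iso: "isolated_identity G" and s: "s \<ge> 10"
  shows "(\<lambda>A. inverse (mnorm A) ^ s) summable_on G"
proof -
  have sub: "G \<subseteq> carrier SL2R" by (rule subgroup_SL2R_subset[OF G])
  obtain C where C: "\<And>n. n \<ge> 1 \<Longrightarrow> finite {A \<in> G. mnorm A \<le> real n}"
    "\<And>n. n \<ge> 1 \<Longrightarrow> real (card {A \<in> G. mnorm A \<le> real n}) \<le> C * real n ^ 8"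
    using mnorm_count[OF G iso] by auto
  have C0: "C \<ge> 0" using C(2)[of 1] by simp
  define B where "B = 2 ^ 8 * C * (\<Sum>n. inverse (real n ^ 2))"
  have summ: "summable (\<lambda>n. inverse (real n ^ 2))"
    by (rule inverse_power_summable) simp
  have "sum (\<lambda>A. inverse (mnorm A) ^ s) F \<le> B" if F: "finite F" "F \<subseteq> G" for F
  proof -
    define lv where "lv A = nat \<lfloor>mnorm A\<rfloor>" for A
    have lv: "1 \<le> lv A" "real (lv A) \<le> mnorm A" "mnorm A \<le> real (Suc (lv A))" if "A \<in> F" for A
    proof -
      have "1 \<le> mnorm A" using mnorm_ge_1[of A] that F sub by auto
      then have *: "1 \<le> \<lfloor>mnorm A\<rfloor>" by linarith
      have "1 \<le> lv A" unfolding lv_def using * by linarith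
      moreover have "real (lv A) = of_int \<lfloor>mnorm A\<rfloor>" using * by (simp add: lv_def)
      ultimately show "1 \<le> lv A" "real (lv A) \<le> mnorm A" "mnorm A \<le> real (Suc (lv A))"
        unfolding of_nat_Suc by linarith+
    qed
    have "sum (\<lambda>A. inverse (mnorm A) ^ s) F \<le> (\<Sum>A\<in>F. inverse (real (lv A)) ^ 10)"
    proof (rule sum_mono)
      fix A assume A: "A \<in> F"
      have "inverse (mnorm A) ^ s \<le> inverse (mnorm A) ^ 10"
        using lv[OF A] s by (intro power_decreasing) (auto simp: inverse_le_1_iff)
      also have "\<dots> \<le> inverse (real (lv A)) ^ 10"
        using lv[OF A] by (intro power_mono le_imp_inverse_le) auto
      finally show "inverse (mnorm A) ^ s \<le> inverse (real (lv A)) ^ 10" .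
    qed
    also have "\<dots> = (\<Sum>n\<in>lv ` F. \<Sum>A | A \<in> F \<and> lv A = n. inverse (real (lv A)) ^ 10)"
      using sum.group[OF F(1) finite_imageI[OF F(1), of lv], of lv "\<lambda>A. inverse (real (lv A)) ^ 10"]
      by simp
    also have "\<dots> \<le> (\<Sum>n\<in>lv ` F. 2 ^ 8 * C * inverse (real n ^ 2))"
    proof (rule sum_mono)
      fix n assume "n \<in> lv ` F"
      then have n: "n \<ge> 1" using lv by auto
      have "(\<Sum>A | A \<in> F \<and> lv A = n. inverse (real (lv A)) ^ 10) =
          real (card {A. A \<in> F \<and> lv A = n}) * inverse (real n) ^ 10"
        by simp
      also have "\<dots> \<le> (C * real (Suc n) ^ 8) * inverse (real n) ^ 10"
      proof (rule mult_right_mono)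
        have "card {A. A \<in> F \<and> lv A = n} \<le> card {A \<in> G. mnorm A \<le> real (Suc n)}"
          using lv F by (intro card_mono C) auto
        then show "real (card {A. A \<in> F \<and> lv A = n}) \<le> C * real (Suc n) ^ 8"
          using C(2)[of "Suc n"] by linarith
      qed simp
      also have "\<dots> \<le> (C * (2 * real n) ^ 8) * inverse (real n) ^ 10"
        using C0 n by (intro mult_right_mono mult_left_mono power_mono) auto
      also have "\<dots> = 2 ^ 8 * C * inverse (real n ^ 2)"
        using n by (simp add: field_simps power_mult_distrib flip: power_add)
      finally show "(\<Sum>A | A \<in> F \<and> lv A = n. inverse (real (lv A)) ^ 10) \<le>
          2 ^ 8 * C * inverse (real n ^ 2)" .
    qed
    also have "\<dots> = 2 ^ 8 * C * (\<Sum>n\<in>lv ` F. inverse (real n ^ 2))"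
      by (simp add: sum_distrib_left)
    also have "\<dots> \<le> B"
      unfolding B_def using C0 summ F by (intro mult_left_mono sum_le_suminf) auto
    finally show ?thesis .
  qed
  then show ?thesis
    by (intro nonneg_bdd_above_summable_on bdd_aboveI2[where M = B]) auto
qed

text \<open>Meant for a matrix B that carries infinity to a cusp: B need not belong to G, so the
  translated set of matrices is not covered by summability over the group.\<close>

lemma mnorm_summable_translate:
  assumes S: "S \<subseteq> carrier SL2R" and B: "B \<in> carrier SL2R"
    and sum: "(\<lambda>A. inverse (mnorm A) ^ s) summable_on S"
  shows "(\<lambda>A. inverse (mnorm A) ^ s) summable_on (\<lambda>A. A ** B) ` S"
proof -
  have inj: "inj_on (\<lambda>A. A ** B) S"
    by (rule inj_on_inverseI[where g = "\<lambda>A. A ** inv2 B"]) (rule inv2_cancel(3)[OF B])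
  have "(\<lambda>A. inverse (mnorm (A ** B)) ^ s) summable_on S"
  proof (rule summable_on_comparison_test)
    show "(\<lambda>A. mnorm B ^ s * inverse (mnorm A) ^ s) summable_on S"
      by (intro summable_on_cmult_right sum)
    fix A assume A: "A \<in> S"
    have "mnorm A \<le> mnorm (A ** B) * mnorm B"
      using mnorm_mult[of "A ** B" "inv2 B"] inv2_cancel(3)[OF B, of A] by simp
    then have "inverse (mnorm (A ** B)) \<le> mnorm B * inverse (mnorm A)"
      using mnorm_pos[of A] mnorm_pos[of "A ** B"] A S B by (auto simp: field_simps)
    then show "inverse (mnorm (A ** B)) ^ s \<le> mnorm B ^ s * inverse (mnorm A) ^ s"
      unfolding power_mult_distrib[symmetric] by (intro power_mono) auto
  qed auto
  then show ?thesis by (subst summable_on_reindex[OF inj]) (simp add: o_def)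
qed

section \<open>Poincare series\<close>

text \<open>For A in SL(2,R) this is \<open>autom A \<tau>\<close> times the difference of
  \<open>moebius A \<tau>\<close> and the conjugate of \<open>z0\<close>. Its power -s is thus the
  weight s slash, by A, of the function that sends \<tau> to the power -s of \<tau> minus that
  conjugate.\<close>

definition pker :: "complex \<Rightarrow> mat2 \<Rightarrow> complex \<Rightarrow> complex" where
  "pker z0 A \<tau> = numer A \<tau> - cnj z0 * autom A \<tau>"

lemma pker_mult:
  assumes "B \<in> carrier SL2R" "\<tau> \<in> upper_half_plane"
  shows "pker z0 (A ** B) \<tau> = pker z0 A (moebius B \<tau>) * autom B \<tau>"
  unfolding pker_def numer_mult[OF assms] autom_mult[OF assms] by (simp add: algebra_simps)

lemma pker_norm_square:
  assumes "A \<in> carrier SL2R"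
  shows "(norm (pker z0 A \<tau>))\<^sup>2 = (norm (numer A \<tau> - z0 * autom A \<tau>))\<^sup>2 + 4 * Im z0 * Im \<tau>"
proof -
  have "(norm (p - cnj z * q))\<^sup>2 = (norm (p - z * q))\<^sup>2 + 4 * Im z * Im (p * cnj q)" for p q z
    unfolding cmod_power2 by (simp add: power2_eq_square algebra_simps)
  from this[of "numer A \<tau>" z0 "autom A \<tau>"] show ?thesis
    unfolding pker_def Im_numer_cnj_autom[OF assms] .
qed

text \<open>With p and q as numerator and denominator, \<open>pker_norm_square\<close> bounds p - z0
  q by the kernel. The difference of the two is a nonzero constant times q, so q is bounded, and
  then p. The imaginary and then the real part of a real linear form in \<tau> bound its
  coefficients. There is no upper limit on Im \<tau>, so the estimate reaches up to the
  cusp.\<close>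

lemma mnorm_le_pker:
  assumes z0: "Im z0 > 0" and X: "X \<ge> 0" and Y: "Y > 0"
  shows "\<exists>C>0. \<forall>A\<in>carrier SL2R. \<forall>\<tau>. \<bar>Re \<tau>\<bar> \<le> X \<longrightarrow> Im \<tau> \<ge> Y \<longrightarrow> mnorm A \<le> C * norm (pker z0 A \<tau>)"
proof -
  define v where "v = Im z0"
  define C1 where "C1 = 1 + norm z0 / v"
  define C2 where "C2 = 1 / Y + (1 + X / Y)"
  define C where "C = C2 * (1 / v + C1)"
  have v: "v > 0" using z0 by (simp add: v_def)
  have C2: "C2 > 0" using X Y by (simp add: C2_def add_pos_nonneg)
  have C1: "C1 > 0" using v by (simp add: C1_def add_pos_nonneg)
  have "mnorm A \<le> C * norm (pker z0 A \<tau>)"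
    if A: "A \<in> carrier SL2R" and \<tau>: "\<bar>Re \<tau>\<bar> \<le> X" "Im \<tau> \<ge> Y" for A \<tau>
  proof -
    let ?e = "norm (pker z0 A \<tau>)" and ?p = "numer A \<tau>" and ?q = "autom A \<tau>"
    have "(norm (?p - z0 * ?q))\<^sup>2 \<le> ?e\<^sup>2"
      unfolding pker_norm_square[OF A] using z0 Y \<tau> by simp
    then have 1: "norm (?p - z0 * ?q) \<le> ?e" by (rule power2_le_imp_le) simp
    have "2 * v * norm ?q = norm (pker z0 A \<tau> - (?p - z0 * ?q))"
    proof -
      have "pker z0 A \<tau> - (?p - z0 * ?q) = (z0 - cnj z0) * ?q"
        by (simp add: pker_def algebra_simps)
      moreover have "norm (z0 - cnj z0) = 2 * v"
        using v by (simp add: complex_diff_cnj v_def norm_mult)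
      ultimately show ?thesis by (simp add: norm_mult)
    qed
    also have "\<dots> \<le> 2 * ?e" using norm_triangle_ineq4[of "pker z0 A \<tau>" "?p - z0 * ?q"] 1 by linarith
    finally have q: "norm ?q \<le> 1 / v * ?e" using v by (simp add: field_simps)
    have "norm ?p = norm ((?p - z0 * ?q) + z0 * ?q)" by simp
    also have "\<dots> \<le> norm (?p - z0 * ?q) + norm (z0 * ?q)" by (rule norm_triangle_ineq)
    also have "\<dots> \<le> ?e + norm z0 * (1 / v * ?e)"
      unfolding norm_mult using 1 q by (intro add_mono mult_left_mono) auto
    also have "\<dots> = C1 * ?e" by (simp add: C1_def algebra_simps)
    finally have p: "norm ?p \<le> C1 * ?e" .
    have coeff: "\<bar>c\<bar> + \<bar>d\<bar> \<le> C2 * norm (of_real c * \<tau> + of_real d)" for c d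
    proof -
      let ?r = "norm (of_real c * \<tau> + of_real d)"
      have "\<bar>c\<bar> * Y \<le> \<bar>c\<bar> * Im \<tau>" using \<tau> by (intro mult_left_mono) auto
      also have "\<dots> = \<bar>Im (of_real c * \<tau> + of_real d)\<bar>" using \<tau> Y by (simp add: abs_mult)
      also have "\<dots> \<le> ?r" by (rule abs_Im_le_cmod)
      finally have c: "\<bar>c\<bar> \<le> ?r / Y" using Y by (simp add: field_simps)
      have "\<bar>c * Re \<tau>\<bar> \<le> ?r / Y * X" unfolding abs_mult using c \<tau> X by (intro mult_mono) auto
      moreover have "\<bar>c * Re \<tau> + d\<bar> \<le> ?r" using abs_Re_le_cmod[of "of_real c * \<tau> + of_real d"] by simp
      ultimately have "\<bar>d\<bar> \<le> ?r + ?r / Y * X" by linarith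
      with c show ?thesis by (simp add: C2_def algebra_simps)
    qed
    have "mnorm A \<le> C2 * norm ?p + C2 * norm ?q"
      using coeff[of "A $ 1 $ 1" "A $ 1 $ 2"] coeff[of "A $ 2 $ 1" "A $ 2 $ 2"]
      unfolding mnorm_def by linarith
    also have "\<dots> \<le> C2 * (C1 * ?e) + C2 * (1 / v * ?e)"
      using p q C2 by (intro add_mono mult_left_mono) auto
    also have "\<dots> = C * ?e" by (simp add: C_def algebra_simps)
    finally show ?thesis .
  qed
  moreover have "C > 0" using C1 C2 v by (simp add: C_def add_pos_pos)
  ultimately show ?thesis by blast
qed

definition psum :: "complex \<Rightarrow> nat \<Rightarrow> mat2 set \<Rightarrow> complex \<Rightarrow> complex" where
  "psum z0 s S \<tau> = (\<Sum>\<^sub>\<infinity>A\<in>S. inverse (pker z0 A \<tau>) ^ s)"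

text \<open>One majorant, independent of the point of the half strip, serves for convergence, for
  boundedness near a cusp and for the Weierstrass test.\<close>

lemma pker_majorant:
  assumes z0: "Im z0 > 0" and X: "X \<ge> 0" and Y: "Y > 0"
  obtains C where "\<And>A \<tau>. A \<in> carrier SL2R \<Longrightarrow> \<bar>Re \<tau>\<bar> \<le> X \<Longrightarrow> Im \<tau> \<ge> Y \<Longrightarrow>
      norm (inverse (pker z0 A \<tau>) ^ s) \<le> C * inverse (mnorm A) ^ s"
proof -
  obtain C where C: "C > 0" "\<And>A \<tau>. A \<in> carrier SL2R \<Longrightarrow> \<bar>Re \<tau>\<bar> \<le> X \<Longrightarrow> Im \<tau> \<ge> Y \<Longrightarrow>
      mnorm A \<le> C * norm (pker z0 A \<tau>)"
    using mnorm_le_pker[OF assms] by blast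
  have "norm (inverse (pker z0 A \<tau>) ^ s) \<le> C ^ s * inverse (mnorm A) ^ s"
    if A: "A \<in> carrier SL2R" and \<tau>: "\<bar>Re \<tau>\<bar> \<le> X" "Im \<tau> \<ge> Y" for A \<tau>
  proof -
    have m: "mnorm A > 0" by (rule mnorm_pos[OF A])
    then have "norm (pker z0 A \<tau>) > 0"
      using C(2)[OF A \<tau>] C(1) by (metis less_le_trans mult_zero_right norm_ge_zero not_le order_le_less)
    then have "inverse (norm (pker z0 A \<tau>)) \<le> C * inverse (mnorm A)"
      using C(2)[OF A \<tau>] m by (simp add: field_simps)
    then show ?thesis
      unfolding norm_power norm_inverse power_mult_distrib[symmetric] by (intro power_mono) auto
  qed
  then show thesis by (rule that)
qed

lemma pker_summable:
  assumes z0: "Im z0 > 0" and S: "S \<subseteq> carrier SL2R"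
    and sum: "(\<lambda>A. inverse (mnorm A) ^ s) summable_on S" and \<tau>: "\<tau> \<in> upper_half_plane"
  shows "(\<lambda>A. norm (inverse (pker z0 A \<tau>) ^ s)) summable_on S"
proof -
  have "Im \<tau> > 0" using \<tau> by (simp add: upper_half_plane_def)
  then obtain C where C: "\<And>A \<tau>'. A \<in> carrier SL2R \<Longrightarrow> \<bar>Re \<tau>'\<bar> \<le> \<bar>Re \<tau>\<bar> \<Longrightarrow> Im \<tau>' \<ge> Im \<tau> \<Longrightarrow>
      norm (inverse (pker z0 A \<tau>') ^ s) \<le> C * inverse (mnorm A) ^ s"
    using pker_majorant[OF z0 abs_ge_zero] by blast
  show ?thesis
  proof (rule summable_on_comparison_test)
    show "(\<lambda>A. C * inverse (mnorm A) ^ s) summable_on S"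
      by (intro summable_on_cmult_right sum)
  qed (use C S in auto)
qed

lemma psum_bounded:
  assumes z0: "Im z0 > 0" and X: "X \<ge> 0" and Y: "Y > 0" and S: "S \<subseteq> carrier SL2R"
    and sum: "(\<lambda>A. inverse (mnorm A) ^ s) summable_on S"
  obtains C where "\<And>\<tau>. \<bar>Re \<tau>\<bar> \<le> X \<Longrightarrow> Im \<tau> \<ge> Y \<Longrightarrow> norm (psum z0 s S \<tau>) \<le> C"
proof -
  obtain C where C: "\<And>A \<tau>. A \<in> carrier SL2R \<Longrightarrow> \<bar>Re \<tau>\<bar> \<le> X \<Longrightarrow> Im \<tau> \<ge> Y \<Longrightarrow>
      norm (inverse (pker z0 A \<tau>) ^ s) \<le> C * inverse (mnorm A) ^ s"
    using pker_majorant[OF z0 X Y] by blast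
  have "norm (psum z0 s S \<tau>) \<le> (\<Sum>\<^sub>\<infinity>A\<in>S. C * inverse (mnorm A) ^ s)"
    if \<tau>: "\<bar>Re \<tau>\<bar> \<le> X" "Im \<tau> \<ge> Y" for \<tau>
  proof -
    have "\<tau> \<in> upper_half_plane" using \<tau> Y by (simp add: upper_half_plane_def)
    note summ = pker_summable[OF z0 S sum this]
    have "norm (psum z0 s S \<tau>) \<le> (\<Sum>\<^sub>\<infinity>A\<in>S. norm (inverse (pker z0 A \<tau>) ^ s))"
      unfolding psum_def by (rule norm_infsum_bound[OF summ])
    also have "\<dots> \<le> (\<Sum>\<^sub>\<infinity>A\<in>S. C * inverse (mnorm A) ^ s)"
      using C S \<tau> by (intro infsum_mono summ summable_on_cmult_right sum) auto
    finally show ?thesis .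
  qed
  then show thesis by (rule that)
qed

lemma psum_holomorphic:
  assumes z0: "Im z0 > 0" and S: "S \<subseteq> carrier SL2R"
    and sum: "(\<lambda>A. inverse (mnorm A) ^ s) summable_on S"
  shows "psum z0 s S holomorphic_on upper_half_plane"
proof -
  have "psum z0 s S field_differentiable (at \<tau>)" if \<tau>: "\<tau> \<in> upper_half_plane" for \<tau>
  proof -
    have pos: "Im \<tau> > 0" using \<tau> by (simp add: upper_half_plane_def)
    \<comment> \<open>Half the height keeps the closed disc of radius r in a half strip on which the
      majorant is uniform.\<close>
    define r where "r = Im \<tau> / 2"
    have r: "r > 0" using pos by (simp add: r_def)
    have cball: "\<bar>Re w\<bar> \<le> \<bar>Re \<tau>\<bar> + r \<and> Im w \<ge> r" if "w \<in> cball \<tau> r" for w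
      using that abs_Re_le_cmod[of "\<tau> - w"] abs_Im_le_cmod[of "\<tau> - w"]
      by (simp add: dist_norm r_def) linarith
    then have uhp: "w \<in> upper_half_plane" if "w \<in> cball \<tau> r" for w
      using that r by (fastforce simp: upper_half_plane_def)
    have "\<bar>Re \<tau>\<bar> + r \<ge> 0" using r by simp
    then obtain C where C: "\<And>A w. A \<in> carrier SL2R \<Longrightarrow> \<bar>Re w\<bar> \<le> \<bar>Re \<tau>\<bar> + r \<Longrightarrow> Im w \<ge> r \<Longrightarrow>
        norm (inverse (pker z0 A w) ^ s) \<le> C * inverse (mnorm A) ^ s"
      using pker_majorant[OF z0 _ r] by blast
    have "uniform_limit (cball \<tau> r) (\<lambda>F w. \<Sum>A\<in>F. inverse (pker z0 A w) ^ s)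
        (psum z0 s S) (finite_subsets_at_top S)"
      unfolding psum_def
      by (rule Weierstrass_m_test_general[where M = "\<lambda>A. C * inverse (mnorm A) ^ s"])
        (use C S cball in \<open>auto intro!: summable_on_cmult_right sum\<close>)
    moreover have nz: "pker z0 A w \<noteq> 0" if "A \<in> S" "w \<in> cball \<tau> r" for A w
    proof -
      have "0 < 4 * Im z0 * Im w"
        using uhp[OF that(2)] z0 by (simp add: upper_half_plane_def)
      then have "0 < (norm (pker z0 A w))\<^sup>2"
        using that S by (subst pker_norm_square) (auto intro: add_nonneg_pos)
      then show ?thesis by auto
    qed
    have "eventually (\<lambda>F. continuous_on (cball \<tau> r) (\<lambda>w. \<Sum>A\<in>F. inverse (pker z0 A w) ^ s) \<and>
        (\<lambda>w. \<Sum>A\<in>F. inverse (pker z0 A w) ^ s) holomorphic_on ball \<tau> r) (finite_subsets_at_top S)"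
    proof (rule eventually_finite_subsets_at_top_weakI)
      fix F assume F: "finite F" "F \<subseteq> S"
      have "(\<lambda>w. \<Sum>A\<in>F. inverse (pker z0 A w) ^ s) holomorphic_on cball \<tau> r"
        using F nz unfolding pker_def by (intro holomorphic_intros) auto
      then show "continuous_on (cball \<tau> r) (\<lambda>w. \<Sum>A\<in>F. inverse (pker z0 A w) ^ s) \<and>
          (\<lambda>w. \<Sum>A\<in>F. inverse (pker z0 A w) ^ s) holomorphic_on ball \<tau> r"
        using holomorphic_on_imp_continuous_on holomorphic_on_subset ball_subset_cball by blast
    qed
    ultimately have "psum z0 s S holomorphic_on ball \<tau> r"
      by (elim holomorphic_uniform_limit[rotated]) simp_all
    then show ?thesis
      using r by (intro holomorphic_on_imp_differentiable_at[of _ "ball \<tau> r"]) auto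
  qed
  then show ?thesis
    by (simp add: holomorphic_on_def field_differentiable_at_within)
qed

lemma psum_translate:
  assumes S: "S \<subseteq> carrier SL2R" and B: "B \<in> carrier SL2R" and \<tau>: "\<tau> \<in> upper_half_plane"
  shows "inverse (autom B \<tau>) ^ s * psum z0 s S (moebius B \<tau>) = psum z0 s ((\<lambda>A. A ** B) ` S) \<tau>"
proof -
  have inj: "inj_on (\<lambda>A. A ** B) S"
    by (rule inj_on_inverseI[where g = "\<lambda>A. A ** inv2 B"]) (rule inv2_cancel(3)[OF B])
  have "psum z0 s ((\<lambda>A. A ** B) ` S) \<tau> = (\<Sum>\<^sub>\<infinity>A\<in>S. inverse (pker z0 (A ** B) \<tau>) ^ s)"
    unfolding psum_def by (subst infsum_reindex[OF inj]) (simp add: o_def)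
  also have "\<dots> = (\<Sum>\<^sub>\<infinity>A\<in>S. inverse (autom B \<tau>) ^ s * inverse (pker z0 A (moebius B \<tau>)) ^ s)"
    by (intro infsum_cong) (simp add: pker_mult[OF B \<tau>] power_mult_distrib)
  also have "\<dots> = inverse (autom B \<tau>) ^ s * psum z0 s S (moebius B \<tau>)"
    unfolding psum_def by (rule infsum_cmult_right')
  finally show ?thesis ..
qed

text \<open>Divided by the common modulus of the terms of I and -I, every other term is a power of
  some \<open>x A\<close> < 1. Finitely many of them are made small by a large exponent, and the
  tail is already small at the exponent 10. Together they stay below 2, the normalized contribution
  of I and -I.\<close>

lemma exists_dominating_weight:
  assumes G: "subgroup G SL2R" and iso: "isolated_identity G" and z0: "z0 \<in> upper_half_plane"
    and free: "\<And>A. A \<in> G \<Longrightarrow> moebius A z0 = z0 \<Longrightarrow> A = I2 \<or> A = - I2"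
  obtains s where "even s" "s \<ge> 10"
    "(\<Sum>\<^sub>\<infinity>A\<in>G - {I2, - I2}. norm (inverse (pker z0 A z0) ^ s)) < 2 * inverse (2 * Im z0) ^ s"
proof -
  let ?G = "G - {I2, - I2}"
  have sub: "G \<subseteq> carrier SL2R" by (rule subgroup_SL2R_subset[OF G])
  have v: "Im z0 > 0" using z0 by (simp add: upper_half_plane_def)
  define x where "x A = 2 * Im z0 * norm (inverse (pker z0 A z0))" for A
  have x0: "x A \<ge> 0" for A using v by (simp add: x_def)
  have x1: "x A < 1" if A: "A \<in> ?G" for A
  proof -
    have AS: "A \<in> carrier SL2R" using A sub by auto
    have nz: "autom A z0 \<noteq> 0" by (rule autom_nonzero[OF AS z0])
    have "moebius A z0 \<noteq> z0" using free A by blast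
    then have "numer A z0 - z0 * autom A z0 \<noteq> 0"
      using nz by (auto simp: moebius_def field_simps)
    then have "0 < (norm (numer A z0 - z0 * autom A z0))\<^sup>2" by simp
    then have "(2 * Im z0)\<^sup>2 < (norm (pker z0 A z0))\<^sup>2"
      unfolding pker_norm_square[OF AS] by (simp add: power2_eq_square)
    then have "2 * Im z0 < norm (pker z0 A z0)" by (rule power_less_imp_less_base) simp
    moreover have "x A = 2 * Im z0 / norm (pker z0 A z0)"
      by (simp add: x_def norm_inverse divide_inverse)
    moreover have "0 < norm (pker z0 A z0)"
      using \<open>2 * Im z0 < norm (pker z0 A z0)\<close> v by linarith
    ultimately show ?thesis by (simp only: divide_less_eq_1_pos)
  qed
  have xs: "(\<lambda>A. x A ^ s) summable_on T" if "s \<ge> 10" "T \<subseteq> ?G" for s T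
  proof -
    have "(\<lambda>A. norm (inverse (pker z0 A z0) ^ s)) summable_on G"
      by (intro pker_summable v sub z0 mnorm_summable G iso that)
    then have "(\<lambda>A. (2 * Im z0) ^ s * norm (inverse (pker z0 A z0) ^ s)) summable_on G"
      by (rule summable_on_cmult_right)
    then show ?thesis using that(2)
      by (auto simp: x_def power_mult_distrib norm_power intro: summable_on_subset_banach)
  qed
  \<comment> \<open>A tail below one at the exponent 10 stays below one for every larger exponent,
    since each \<open>x A\<close> is less than one.\<close>
  obtain S where S: "finite S" "S \<subseteq> ?G" "(\<Sum>\<^sub>\<infinity>A\<in>?G - S. x A ^ 10) < 1"
  proof -
    have "((\<lambda>A. x A ^ 10) has_sum (\<Sum>\<^sub>\<infinity>A\<in>?G. x A ^ 10)) ?G"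
      using xs[of 10 ?G] by simp
    then have "\<forall>\<^sub>F F in finite_subsets_at_top ?G.
        dist (sum (\<lambda>A. x A ^ 10) F) (\<Sum>\<^sub>\<infinity>A\<in>?G. x A ^ 10) < 1"
      unfolding has_sum_def by (rule tendstoD) simp
    then obtain S where S: "finite S" "S \<subseteq> ?G"
      "dist (sum (\<lambda>A. x A ^ 10) S) (\<Sum>\<^sub>\<infinity>A\<in>?G. x A ^ 10) < 1"
      unfolding eventually_finite_subsets_at_top by blast
    have "(\<Sum>\<^sub>\<infinity>A\<in>?G - S. x A ^ 10) = (\<Sum>\<^sub>\<infinity>A\<in>?G. x A ^ 10) - (\<Sum>\<^sub>\<infinity>A\<in>S. x A ^ 10)"
      using S by (intro infsum_Diff xs) auto
    with S have "(\<Sum>\<^sub>\<infinity>A\<in>?G - S. x A ^ 10) < 1" by (simp add: dist_real_def)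
    with S(1,2) show thesis by (rule that)
  qed
  have "(\<lambda>s. \<Sum>A\<in>S. x A ^ s) \<longlonglongrightarrow> (\<Sum>A\<in>S. 0)"
    using S x0 x1 by (intro tendsto_sum LIMSEQ_power_zero) auto
  then have "\<forall>\<^sub>F s in sequentially. (\<Sum>A\<in>S. x A ^ s) < 1"
    by (intro order_tendstoD) auto
  then obtain N where N: "\<And>s. s \<ge> N \<Longrightarrow> (\<Sum>A\<in>S. x A ^ s) < 1"
    by (auto simp: eventually_sequentially)
  \<comment> \<open>Even, at least 10 and at least \<open>N\<close>.\<close>
  define s where "s = 2 * (N + 5)"
  have s: "s \<ge> 10" "s \<ge> N" "even s" by (auto simp: s_def)
  have "(\<Sum>\<^sub>\<infinity>A\<in>?G. x A ^ s) = (\<Sum>\<^sub>\<infinity>A\<in>S. x A ^ s) + (\<Sum>\<^sub>\<infinity>A\<in>?G - S. x A ^ s)"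
    using S s by (subst infsum_Diff) (auto intro!: xs)
  also have "(\<Sum>\<^sub>\<infinity>A\<in>?G - S. x A ^ s) \<le> (\<Sum>\<^sub>\<infinity>A\<in>?G - S. x A ^ 10)"
    using s x0 x1 by (intro infsum_mono xs power_decreasing) (auto intro: less_imp_le)
  finally have "(\<Sum>\<^sub>\<infinity>A\<in>?G. x A ^ s) < 2"
    using N[OF s(2)] S by simp
  also have "(\<Sum>\<^sub>\<infinity>A\<in>?G. x A ^ s) = (2 * Im z0) ^ s * (\<Sum>\<^sub>\<infinity>A\<in>?G. norm (inverse (pker z0 A z0) ^ s))"
    unfolding x_def by (simp add: power_mult_distrib norm_power infsum_cmult_right')
  finally have "(\<Sum>\<^sub>\<infinity>A\<in>?G. norm (inverse (pker z0 A z0) ^ s)) < 2 * inverse (2 * Im z0) ^ s"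
    using v by (simp add: field_simps)
  with s show thesis by (intro that)
qed

lemma sum_infsum_disjoint_le:
  fixes f :: "'a \<Rightarrow> real"
  assumes "finite I" "disjoint_family_on T I" "\<And>i. i \<in> I \<Longrightarrow> T i \<subseteq> A"
    and f: "f summable_on A" "\<And>x. x \<in> A \<Longrightarrow> f x \<ge> 0"
  shows "(\<Sum>i\<in>I. infsum f (T i)) \<le> infsum f A"
proof -
  have *: "(\<Sum>i\<in>I. infsum f (T i)) = infsum f (\<Union>i\<in>I. T i) \<and> f summable_on (\<Union>i\<in>I. T i)"
    using assms(1-3)
  proof (induction I rule: finite_induct)
    case (insert i I)
    have IH: "(\<Sum>j\<in>I. infsum f (T j)) = infsum f (\<Union>j\<in>I. T j)" "f summable_on (\<Union>j\<in>I. T j)"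
      using insert by (auto simp: disjoint_family_on_def)
    have "T i \<inter> (\<Union>j\<in>I. T j) = {}"
      using insert.hyps insert.prems(1) by (fastforce simp: disjoint_family_on_def)
    moreover have "f summable_on T i"
      using f(1) insert.prems(2) by (rule summable_on_subset_banach) auto
    ultimately show ?case
      using IH insert.hyps by (simp add: infsum_Un_disjoint summable_on_Un_disjoint)
  qed simp
  moreover have "infsum f (\<Union>i\<in>I. T i) \<le> infsum f A"
    using * assms by (intro infsum_mono2) auto
  ultimately show ?thesis by simp
qed

section \<open>Cosets of a finite index subgroup and the independence of their series\<close>

locale transversal =
  fixes G H :: "mat2 set" and rs :: "mat2 list"
  assumes G: "subgroup G SL2R" and H: "subgroup H SL2R" and HG: "H \<subseteq> G"
    and minus_one: "- I2 \<in> H" and trans: "left_transversal G H rs"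
begin

text \<open>The right coset of H attached to the left coset of the representative. Right cosets are
  the ones permuted by right multiplication, which is how the slash action moves the terms of a
  series.\<close>

definition coset :: "nat \<Rightarrow> mat2 set" where
  "coset i = (\<lambda>h. h ** inv2 (rs ! i)) ` H"

lemma G_SL2R: "A \<in> G \<Longrightarrow> A \<in> carrier SL2R"
  using subgroup_SL2R_subset[OF G] by auto

lemma H_SL2R: "A \<in> H \<Longrightarrow> A \<in> carrier SL2R"
  using subgroup_SL2R_subset[OF H] by auto

lemma rs_G: "i < length rs \<Longrightarrow> rs ! i \<in> G"
  using trans by (auto simp: left_transversal_def)

lemma rs_SL2R: "i < length rs \<Longrightarrow> rs ! i \<in> carrier SL2R"
  using rs_G G_SL2R by blast

lemma transversal_unique: "g \<in> G \<Longrightarrow> \<exists>!i. i < length rs \<and> inv2 (rs ! i) ** g \<in> H"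
proof -
  assume "g \<in> G"
  then have "\<exists>!i. i < length rs \<and> matrix_inv (rs ! i) ** g \<in> H"
    using trans by (auto simp: left_transversal_def)
  then show ?thesis using matrix_inv_SL2R[OF rs_SL2R] by (metis (no_types, lifting))
qed

text \<open>Inversion turns the condition on j into the transversal property for the element
  \<open>inv2 \<gamma> ** rs ! i\<close>. In other words, each block row of an induced matrix has
  exactly one nonzero block.\<close>

lemma block_unique:
  assumes \<gamma>: "\<gamma> \<in> G" and i: "i < length rs"
  shows "\<exists>!j. j < length rs \<and> inv2 (rs ! i) ** \<gamma> ** rs ! j \<in> H"
proof -
  have "inv2 (rs ! i) ** \<gamma> ** rs ! j \<in> H \<longleftrightarrow> inv2 (rs ! j) ** (inv2 \<gamma> ** rs ! i) \<in> H" for j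
  proof -
    have "inv2 (inv2 (rs ! i) ** \<gamma> ** rs ! j) = inv2 (rs ! j) ** (inv2 \<gamma> ** rs ! i)"
      by (simp add: inv2_mult_distrib)
    then show ?thesis using subgroup_SL2R_inv2[OF H] by (metis inv2_inv2)
  qed
  moreover have "inv2 \<gamma> ** rs ! i \<in> G"
    by (intro subgroup_SL2R_mult[OF G] subgroup_SL2R_inv2[OF G] \<gamma> rs_G i)
  ultimately show ?thesis using transversal_unique by simp
qed

lemma coset_subset: "i < length rs \<Longrightarrow> coset i \<subseteq> G"
  using HG by (auto simp: coset_def intro!: subgroup_SL2R_mult[OF G] subgroup_SL2R_inv2[OF G] rs_G)

lemma H_right_mult:
  assumes k: "k \<in> H"
  shows "(\<lambda>h. h ** k) ` H = H"
proof
  show "(\<lambda>h. h ** k) ` H \<subseteq> H" using subgroup_SL2R_mult[OF H _ k] by auto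
  show "H \<subseteq> (\<lambda>h. h ** k) ` H"
  proof
    fix h assume "h \<in> H"
    then have "h ** inv2 k \<in> H" using subgroup_SL2R_mult[OF H] subgroup_SL2R_inv2[OF H k] by blast
    then show "h \<in> (\<lambda>h. h ** k) ` H"
      by (rule rev_image_eqI) (simp add: inv2_cancel(4) H_SL2R k)
  qed
qed

lemma coset_mult:
  assumes j: "j < length rs" and k: "inv2 (rs ! i) ** \<gamma> ** rs ! j \<in> H"
  shows "(\<lambda>A. A ** \<gamma>) ` coset i = coset j"
proof -
  let ?k = "inv2 (rs ! i) ** \<gamma> ** rs ! j"
  have "h ** inv2 (rs ! i) ** \<gamma> = (h ** ?k) ** inv2 (rs ! j)" for h :: mat2
    using inv2_mult(2)[OF rs_SL2R[OF j]] by (simp flip: matrix_mul_assoc)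
  then have "(\<lambda>A. A ** \<gamma>) ` coset i = (\<lambda>h. h ** inv2 (rs ! j)) ` (\<lambda>h. h ** ?k) ` H"
    by (simp add: coset_def image_image)
  then show ?thesis unfolding H_right_mult[OF k] coset_def .
qed

lemma psum_coset_slash:
  assumes \<gamma>: "\<gamma> \<in> G" and i: "i < length rs" and j: "j < length rs"
    and k: "inv2 (rs ! i) ** \<gamma> ** rs ! j \<in> H" and \<tau>: "\<tau> \<in> upper_half_plane"
  shows "inverse (autom \<gamma> \<tau>) ^ s * psum z0 s (coset i) (moebius \<gamma> \<tau>) = psum z0 s (coset j) \<tau>"
proof -
  have "coset i \<subseteq> carrier SL2R" using coset_subset[OF i] G_SL2R by auto
  from psum_translate[OF this G_SL2R[OF \<gamma>] \<tau>] show ?thesis by (simp add: coset_mult[OF j k])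
qed

text \<open>Let a_l be a coefficient of largest modulus and evaluate the relation at r_l z0. There
  the series of coset l has modulus at least 2c - g_l, where 2c comes from I and -I and g_l bounds
  its remaining terms, while the other series contribute at most |a_l| times the sum of the other
  g_j. As all g_j together stay below 2c, a_l must vanish.\<close>

lemma psum_independent:
  assumes iso: "isolated_identity G" and z0: "z0 \<in> upper_half_plane"
    and s: "even s" "s \<ge> 10"
    and dom: "(\<Sum>\<^sub>\<infinity>A\<in>G - {I2, - I2}. norm (inverse (pker z0 A z0) ^ s)) < 2 * inverse (2 * Im z0) ^ s"
    and rel: "\<And>\<tau>. \<tau> \<in> upper_half_plane \<Longrightarrow> (\<Sum>i<length rs. a i * psum z0 s (coset i) \<tau>) = 0"
    and i: "i < length rs"
  shows "a i = 0"
proof -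
  define n where "n = length rs"
  define f where "f A = norm (inverse (pker z0 A z0) ^ s)" for A
  define c where "c = inverse (2 * Im z0) ^ s"
  have v: "Im z0 > 0" using z0 by (simp add: upper_half_plane_def)
  have sub: "G \<subseteq> carrier SL2R" using G_SL2R by auto
  have summ: "f summable_on T" if "T \<subseteq> G" for T
    using pker_summable[OF v sub mnorm_summable[OF G iso s(2)] z0] that
    unfolding f_def by (rule summable_on_subset_banach)
  obtain l where l: "l < n" "\<And>j. j < n \<Longrightarrow> norm (a j) \<le> norm (a l)"
  proof -
    have "Max ((\<lambda>j. norm (a j)) ` {..<n}) \<in> (\<lambda>j. norm (a j)) ` {..<n}"
      using i by (intro Max_in) (auto simp: n_def)
    then obtain l where "l < n" "norm (a l) = Max ((\<lambda>j. norm (a j)) ` {..<n})" by auto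
    then show thesis by (intro that[of l]) auto
  qed
  have lS: "rs ! l \<in> carrier SL2R" using rs_SL2R l by (simp add: n_def)
  \<comment> \<open>Translating by r_l moves the evaluation from r_l z0 to z0 and turns coset l into
    H itself, which contains I and -I.\<close>
  define T where "T j = (\<lambda>A. A ** rs ! l) ` coset j" for j
  have T_G: "T j \<subseteq> G" if "j < n" for j
    using coset_subset[of j] rs_G[of l] l that subgroup_SL2R_mult[OF G] unfolding T_def n_def by blast
  have T_l: "T l = H"
    unfolding T_def coset_def image_image inv2_cancel(4)[OF lS] by simp
  have T_unique: "j = j'" if jj: "j < n" "j' < n" "g \<in> T j" "g \<in> T j'" for g j j'
  proof -
    have "inv2 (rs ! j) ** (rs ! l ** inv2 g) \<in> H" if j: "j < n" "g \<in> T j" for j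
    proof -
      obtain h where h: "h \<in> H" "g = h ** inv2 (rs ! j) ** rs ! l"
        using j by (auto simp: T_def coset_def)
      have "inv2 (rs ! j) ** (rs ! l ** inv2 g) = inv2 h"
        using rs_SL2R[of j] j lS
        by (simp add: h(2) inv2_mult_distrib inv2_cancel n_def)
      then show ?thesis using subgroup_SL2R_inv2[OF H h(1)] by simp
    qed
    moreover have "rs ! l ** inv2 g \<in> G"
      using T_G jj rs_G[of l] l by (intro subgroup_SL2R_mult[OF G] subgroup_SL2R_inv2[OF G]) (auto simp: n_def)
    ultimately show ?thesis using transversal_unique jj unfolding n_def by blast
  qed
  have one_T: "I2 \<in> T l" "- I2 \<in> T l"
    using T_l minus_one subgroup_SL2R_one[OF H] by auto
  have T_ne: "T j - {I2, - I2} = T j" if "j < n" "j \<noteq> l" for j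
    using T_unique[of j l] one_T that l by blast
  define g where "g j = infsum f (T j - {I2, - I2})" for j
  have "(\<Sum>j<n. g j) \<le> infsum f (G - {I2, - I2})"
    unfolding g_def
  proof (rule sum_infsum_disjoint_le)
    show "disjoint_family_on (\<lambda>j. T j - {I2, - I2}) {..<n}"
      using T_unique by (fastforce simp: disjoint_family_on_def)
    show "T j - {I2, - I2} \<subseteq> G - {I2, - I2}" if "j \<in> {..<n}" for j using T_G[of j] that by auto
  qed (auto intro!: summ simp: f_def)
  then have sum_g: "(\<Sum>j<n. g j) < 2 * c"
    using dom unfolding f_def c_def by (rule le_less_trans)
  have psum_le: "norm (psum z0 s S z0) \<le> infsum f S" if "S \<subseteq> G" for S
    using summ[OF that] unfolding psum_def f_def by (rule norm_infsum_bound)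
  have lower: "norm (psum z0 s H z0) \<ge> 2 * c - g l"
  proof -
    have summH: "(\<lambda>A. inverse (pker z0 A z0) ^ s) summable_on T" if "T \<subseteq> G" for T
      using summ[OF that] unfolding f_def by (rule abs_summable_summable)
    have "psum z0 s (H - {I2, - I2}) z0 = psum z0 s H z0 - psum z0 s {I2, - I2} z0"
      unfolding psum_def using T_l one_T HG by (intro infsum_Diff summH) auto
    moreover have "psum z0 s {I2, - I2} z0 = 2 * inverse (z0 - cnj z0) ^ s"
    proof -
      have ne: "I2 \<noteq> - I2" by (simp add: mat2_eq_iff)
      have "pker z0 I2 z0 = z0 - cnj z0" "pker z0 (- I2) z0 = - (z0 - cnj z0)"
        by (simp_all add: pker_def)
      \<comment> \<open>Here evenness of s is used: the terms of I and -I add up instead of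
        cancelling.\<close>
      moreover have "inverse (- (z0 - cnj z0)) ^ s = inverse (z0 - cnj z0) ^ s"
        unfolding inverse_minus_eq using s(1) by (rule power_minus_even)
      ultimately show ?thesis using ne by (simp only: psum_def) simp
    qed
    moreover have "norm (2 * inverse (z0 - cnj z0) ^ s) = 2 * c"
      using v by (simp add: norm_mult norm_power norm_inverse c_def complex_diff_cnj)
    moreover have "norm (psum z0 s (H - {I2, - I2}) z0) \<le> g l"
      using psum_le[of "H - {I2, - I2}"] HG by (auto simp: g_def T_l)
    ultimately show ?thesis
      using norm_triangle_ineq2[of "2 * inverse (z0 - cnj z0) ^ s" "- psum z0 s (H - {I2, - I2}) z0"]
      by (simp add: algebra_simps)
  qed
  have "(\<Sum>j<n. a j * psum z0 s (T j) z0) = 0"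
  proof -
    have "(\<Sum>j<n. a j * psum z0 s (T j) z0) =
        (\<Sum>j<n. inverse (autom (rs ! l) z0) ^ s * (a j * psum z0 s (coset j) (moebius (rs ! l) z0)))"
    proof (rule sum.cong)
      fix j assume "j \<in> {..<n}"
      then have "coset j \<subseteq> carrier SL2R" using coset_subset[of j] sub by (auto simp: n_def)
      from psum_translate[OF this lS z0]
      show "a j * psum z0 s (T j) z0 =
          inverse (autom (rs ! l) z0) ^ s * (a j * psum z0 s (coset j) (moebius (rs ! l) z0))"
        by (simp add: T_def flip: psum_translate)
    qed simp
    also have "\<dots> = 0"
      unfolding sum_distrib_left[symmetric] using rel[OF moebius_upper_half_plane[OF lS z0]] by (simp add: n_def)
    finally show ?thesis .
  qed
  then have "a l * psum z0 s (T l) z0 = - (\<Sum>j\<in>{..<n} - {l}. a j * psum z0 s (T j) z0)"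
    using l by (subst (asm) sum.remove[of _ l]) (auto simp: add_eq_0_iff)
  then have "norm (a l) * norm (psum z0 s H z0) = norm (\<Sum>j\<in>{..<n} - {l}. a j * psum z0 s (T j) z0)"
    unfolding T_l by (simp flip: norm_mult)
  also have "\<dots> \<le> (\<Sum>j\<in>{..<n} - {l}. norm (a j * psum z0 s (T j) z0))" by (rule norm_sum)
  also have "\<dots> \<le> (\<Sum>j\<in>{..<n} - {l}. norm (a l) * g j)"
  proof (rule sum_mono)
    fix j assume j: "j \<in> {..<n} - {l}"
    then have "norm (psum z0 s (T j) z0) \<le> g j"
      using psum_le[OF T_G, of j] T_ne[of j] by (simp add: g_def)
    then show "norm (a j * psum z0 s (T j) z0) \<le> norm (a l) * g j"
      unfolding norm_mult using l j by (intro mult_mono) auto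
  qed
  also have "\<dots> = norm (a l) * ((\<Sum>j<n. g j) - g l)"
    using l by (simp add: sum_distrib_left sum.remove[of "{..<n}" l])
  finally have *: "norm (a l) * norm (psum z0 s H z0) \<le> norm (a l) * ((\<Sum>j<n. g j) - g l)" .
  have "norm (a l) = 0"
  proof (rule ccontr)
    assume "norm (a l) \<noteq> 0"
    with * have "norm (psum z0 s H z0) \<le> (\<Sum>j<n. g j) - g l" by simp
    with lower sum_g show False by linarith
  qed
  then show ?thesis using l(2)[of i] i by (simp add: n_def)
qed

end

section \<open>Growth and periodic expansions\<close>

text \<open>Exponential growth in Im \<tau> matches a pole of finite order in q. Bounded vertical
  strips are enough for periodic functions, and they keep polynomials in \<tau> in the class; the
  constants may depend on the strip.\<close>

definition exp_growth :: "(complex \<Rightarrow> complex) \<Rightarrow> bool" where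
  "exp_growth f \<longleftrightarrow> (\<forall>R. \<exists>C. \<forall>\<^sub>F y in at_top. \<forall>x. \<bar>x\<bar> \<le> R \<longrightarrow> norm (f (Complex x y)) \<le> exp (C * y))"

lemma exp_growthI:
  assumes "\<And>R. R > 0 \<Longrightarrow> \<exists>C Y. \<forall>\<tau>. \<bar>Re \<tau>\<bar> \<le> R \<longrightarrow> Im \<tau> \<ge> Y \<longrightarrow> norm (f \<tau>) \<le> exp (C * Im \<tau>)"
  shows "exp_growth f"
  unfolding exp_growth_def
proof
  fix R :: real
  have "max R 1 > 0" by simp
  then obtain C Y where CY: "\<And>\<tau>. \<bar>Re \<tau>\<bar> \<le> max R 1 \<Longrightarrow> Im \<tau> \<ge> Y \<Longrightarrow> norm (f \<tau>) \<le> exp (C * Im \<tau>)"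
    using assms by blast
  have "\<forall>\<^sub>F y in at_top. \<forall>x. \<bar>x\<bar> \<le> R \<longrightarrow> norm (f (Complex x y)) \<le> exp (C * y)"
    using eventually_ge_at_top[of Y]
  proof eventually_elim
    case (elim y)
    then show ?case using CY[of "Complex x y" for x] by auto
  qed
  then show "\<exists>C. \<forall>\<^sub>F y in at_top. \<forall>x. \<bar>x\<bar> \<le> R \<longrightarrow> norm (f (Complex x y)) \<le> exp (C * y)" ..
qed

lemma exp_growthD:
  assumes "exp_growth f"
  obtains C Y where "C \<ge> 0" "Y > 0"
    "\<And>\<tau>. \<bar>Re \<tau>\<bar> \<le> R \<Longrightarrow> Im \<tau> \<ge> Y \<Longrightarrow> norm (f \<tau>) \<le> exp (C * Im \<tau>)"
proof -
  obtain C where "\<forall>\<^sub>F y in at_top. \<forall>x. \<bar>x\<bar> \<le> R \<longrightarrow> norm (f (Complex x y)) \<le> exp (C * y)"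
    using assms by (auto simp: exp_growth_def)
  then obtain Y where Y: "\<And>y x. y \<ge> Y \<Longrightarrow> \<bar>x\<bar> \<le> R \<Longrightarrow> norm (f (Complex x y)) \<le> exp (C * y)"
    by (auto simp: eventually_at_top_linorder)
  show thesis
  proof (rule that[of "max C 0" "max Y 1"])
    fix \<tau> :: complex assume \<tau>: "\<bar>Re \<tau>\<bar> \<le> R" "Im \<tau> \<ge> max Y 1"
    have "norm (f \<tau>) \<le> exp (C * Im \<tau>)" using Y[of "Im \<tau>" "Re \<tau>"] \<tau> by simp
    also have "\<dots> \<le> exp (max C 0 * Im \<tau>)" using \<tau> by (auto intro: mult_right_mono)
    finally show "norm (f \<tau>) \<le> exp (max C 0 * Im \<tau>)" .
  qed auto
qed

lemma exp_growth_mult: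
  assumes "exp_growth f" "exp_growth g"
  shows "exp_growth (\<lambda>\<tau>. f \<tau> * g \<tau>)"
proof (rule exp_growthI)
  fix R :: real
  obtain C Y where f: "\<And>\<tau>. \<bar>Re \<tau>\<bar> \<le> R \<Longrightarrow> Im \<tau> \<ge> Y \<Longrightarrow> norm (f \<tau>) \<le> exp (C * Im \<tau>)"
    using exp_growthD[OF assms(1), of R] by metis
  obtain D Z where g: "\<And>\<tau>. \<bar>Re \<tau>\<bar> \<le> R \<Longrightarrow> Im \<tau> \<ge> Z \<Longrightarrow> norm (g \<tau>) \<le> exp (D * Im \<tau>)"
    using exp_growthD[OF assms(2), of R] by metis
  show "\<exists>C Y. \<forall>\<tau>. \<bar>Re \<tau>\<bar> \<le> R \<longrightarrow> Im \<tau> \<ge> Y \<longrightarrow> norm (f \<tau> * g \<tau>) \<le> exp (C * Im \<tau>)"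
  proof (rule exI[of _ "C + D"], rule exI[of _ "max Y Z"], intro allI impI)
    fix \<tau> :: complex assume "\<bar>Re \<tau>\<bar> \<le> R" "Im \<tau> \<ge> max Y Z"
    then have "norm (f \<tau>) * norm (g \<tau>) \<le> exp (C * Im \<tau>) * exp (D * Im \<tau>)"
      by (intro mult_mono f g) auto
    then show "norm (f \<tau> * g \<tau>) \<le> exp ((C + D) * Im \<tau>)"
      by (simp add: norm_mult distrib_right exp_add)
  qed
qed

lemma exp_growth_add:
  assumes "exp_growth f" "exp_growth g"
  shows "exp_growth (\<lambda>\<tau>. f \<tau> + g \<tau>)"
proof (rule exp_growthI)
  fix R :: real
  obtain C Y where f: "C \<ge> 0" "Y > 0" "\<And>\<tau>. \<bar>Re \<tau>\<bar> \<le> R \<Longrightarrow> Im \<tau> \<ge> Y \<Longrightarrow> norm (f \<tau>) \<le> exp (C * Im \<tau>)"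
    using exp_growthD[OF assms(1), of R] by metis
  obtain D Z where g: "D \<ge> 0" "Z > 0" "\<And>\<tau>. \<bar>Re \<tau>\<bar> \<le> R \<Longrightarrow> Im \<tau> \<ge> Z \<Longrightarrow> norm (g \<tau>) \<le> exp (D * Im \<tau>)"
    using exp_growthD[OF assms(2), of R] by metis
  show "\<exists>C Y. \<forall>\<tau>. \<bar>Re \<tau>\<bar> \<le> R \<longrightarrow> Im \<tau> \<ge> Y \<longrightarrow> norm (f \<tau> + g \<tau>) \<le> exp (C * Im \<tau>)"
  \<comment> \<open>The additional 1 in the rate absorbs the factor 2 that arises from adding two
    exponentials.\<close>
  proof (rule exI[of _ "C + D + 1"], rule exI[of _ "max 1 (max Y Z)"], intro allI impI)
    fix \<tau> :: complex assume \<tau>: "\<bar>Re \<tau>\<bar> \<le> R" "Im \<tau> \<ge> max 1 (max Y Z)"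
    have "norm (f \<tau> + g \<tau>) \<le> norm (f \<tau>) + norm (g \<tau>)" by (rule norm_triangle_ineq)
    also have "\<dots> \<le> exp (C * Im \<tau>) + exp (D * Im \<tau>)"
      using \<tau> by (intro add_mono f g) auto
    also have "\<dots> \<le> exp ((C + D) * Im \<tau>) + exp ((C + D) * Im \<tau>)"
      using \<tau> f g by (intro add_mono) (auto intro!: mult_right_mono)
    also have "\<dots> = 2 * exp ((C + D) * Im \<tau>)" by simp
    also have "\<dots> \<le> exp (Im \<tau>) * exp ((C + D) * Im \<tau>)"
    proof (rule mult_right_mono)
      have "1 \<le> Im \<tau>" using \<tau> by simp
      then show "2 \<le> exp (Im \<tau>)" using exp_ge_add_one_self[of "Im \<tau>"] by linarith
    qed simp
    also have "\<dots> = exp ((C + D + 1) * Im \<tau>)" by (simp add: distrib_right exp_add)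
    finally show "norm (f \<tau> + g \<tau>) \<le> exp ((C + D + 1) * Im \<tau>)" .
  qed
qed

lemma exp_growth_bounded:
  assumes "\<And>R. R > 0 \<Longrightarrow> \<exists>B Y. \<forall>\<tau>. \<bar>Re \<tau>\<bar> \<le> R \<longrightarrow> Im \<tau> \<ge> Y \<longrightarrow> norm (f \<tau>) \<le> B"
  shows "exp_growth f"
proof (rule exp_growthI)
  fix R :: real assume "R > 0"
  then obtain B Y where B: "\<And>\<tau>. \<bar>Re \<tau>\<bar> \<le> R \<Longrightarrow> Im \<tau> \<ge> Y \<Longrightarrow> norm (f \<tau>) \<le> B"
    using assms by blast
  show "\<exists>C Y. \<forall>\<tau>. \<bar>Re \<tau>\<bar> \<le> R \<longrightarrow> Im \<tau> \<ge> Y \<longrightarrow> norm (f \<tau>) \<le> exp (C * Im \<tau>)"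
  proof (rule exI[of _ 1], rule exI[of _ "max Y B"], intro allI impI)
    fix \<tau> :: complex assume \<tau>: "\<bar>Re \<tau>\<bar> \<le> R" "Im \<tau> \<ge> max Y B"
    then have "norm (f \<tau>) \<le> Im \<tau>" using B[of \<tau>] by simp
    then show "norm (f \<tau>) \<le> exp (1 * Im \<tau>)"
      using exp_ge_add_one_self[of "Im \<tau>"] unfolding mult_1 by linarith
  qed
qed

lemma exp_growth_const: "exp_growth (\<lambda>_. c)"
  by (rule exp_growth_bounded) auto

lemma exp_growth_id: "exp_growth (\<lambda>\<tau>. \<tau>)"
proof (rule exp_growthI)
  fix R :: real assume "R > 0"
  show "\<exists>C Y. \<forall>\<tau>. \<bar>Re \<tau>\<bar> \<le> R \<longrightarrow> Im \<tau> \<ge> Y \<longrightarrow> norm \<tau> \<le> exp (C * Im \<tau>)"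
  proof (rule exI[of _ 2], rule exI[of _ "max 0 R"], intro allI impI)
    fix \<tau> :: complex assume \<tau>: "\<bar>Re \<tau>\<bar> \<le> R" "Im \<tau> \<ge> max 0 R"
    have "norm \<tau> \<le> 1 + 2 * Im \<tau>" using cmod_le[of \<tau>] \<tau> by linarith
    also have "\<dots> \<le> exp (2 * Im \<tau>)" by (rule exp_ge_add_one_self)
    finally show "norm \<tau> \<le> exp (2 * Im \<tau>)" .
  qed
qed

lemma exp_growth_exp: "exp_growth (\<lambda>\<tau>. exp (c * \<tau>))"
proof (rule exp_growthI)
  fix R :: real assume R: "R > 0"
  show "\<exists>C Y. \<forall>\<tau>. \<bar>Re \<tau>\<bar> \<le> R \<longrightarrow> Im \<tau> \<ge> Y \<longrightarrow> norm (exp (c * \<tau>)) \<le> exp (C * Im \<tau>)"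
  proof (rule exI[of _ "norm c * 2"], rule exI[of _ R], intro allI impI)
    fix \<tau> :: complex assume \<tau>: "\<bar>Re \<tau>\<bar> \<le> R" "Im \<tau> \<ge> R"
    have "Re (c * \<tau>) \<le> norm (c * \<tau>)" by (rule complex_Re_le_cmod)
    also have "\<dots> \<le> norm c * (2 * Im \<tau>)"
      unfolding norm_mult using cmod_le[of \<tau>] \<tau> R by (intro mult_left_mono) auto
    finally show "norm (exp (c * \<tau>)) \<le> exp (norm c * 2 * Im \<tau>)" by (simp add: mult.assoc)
  qed
qed

lemma exp_growth_diff:
  assumes "exp_growth f" "exp_growth g"
  shows "exp_growth (\<lambda>\<tau>. f \<tau> - g \<tau>)"
  using exp_growth_add[OF assms(1) exp_growth_mult[OF exp_growth_const[of "-1"] assms(2)]] by simp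

lemma exp_growth_sum: "(\<And>i. i \<in> I \<Longrightarrow> exp_growth (f i)) \<Longrightarrow> exp_growth (\<lambda>\<tau>. \<Sum>i\<in>I. f i \<tau>)"
  by (induction I rule: infinite_finite_induct) (auto intro: exp_growth_const exp_growth_add)

lemma exp_growth_prod: "(\<And>i. i \<in> I \<Longrightarrow> exp_growth (f i)) \<Longrightarrow> exp_growth (\<lambda>\<tau>. \<Prod>i\<in>I. f i \<tau>)"
  by (induction I rule: infinite_finite_induct) (auto intro: exp_growth_const exp_growth_mult)

lemma exp_growth_cong:
  assumes "\<And>\<tau>. \<tau> \<in> upper_half_plane \<Longrightarrow> f \<tau> = g \<tau>" "exp_growth g"
  shows "exp_growth f"
proof (rule exp_growthI)
  fix R :: real
  obtain C Y where "Y > 0" "\<And>\<tau>. \<bar>Re \<tau>\<bar> \<le> R \<Longrightarrow> Im \<tau> \<ge> Y \<Longrightarrow> norm (g \<tau>) \<le> exp (C * Im \<tau>)"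
    using exp_growthD[OF assms(2), of R] by metis
  then show "\<exists>C Y. \<forall>\<tau>. \<bar>Re \<tau>\<bar> \<le> R \<longrightarrow> Im \<tau> \<ge> Y \<longrightarrow> norm (f \<tau>) \<le> exp (C * Im \<tau>)"
    using assms(1) by (intro exI[of _ C] exI[of _ Y]) (auto simp: upper_half_plane_def)
qed

section \<open>Periodic functions as Laurent series in q with finite principal part\<close>

definition qexp :: "real \<Rightarrow> complex \<Rightarrow> complex" where
  "qexp h \<tau> = exp (2 * of_real pi * \<i> * \<tau> / of_real h)"

lemma norm_qexp: "norm (qexp h \<tau>) = exp (- 2 * pi * Im \<tau> / h)"
  by (simp add: qexp_def)

lemma qexp_nonzero [simp]: "qexp h \<tau> \<noteq> 0"
  by (simp add: qexp_def)

lemma qexp_periodic: "h \<noteq> 0 \<Longrightarrow> qexp h (\<tau> + of_real h) = qexp h \<tau>"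
  by (simp add: qexp_def add_divide_distrib distrib_left exp_add)

lemma qexp_ball: "h > 0 \<Longrightarrow> \<tau> \<in> upper_half_plane \<Longrightarrow> qexp h \<tau> \<in> ball 0 1"
  by (simp add: norm_qexp upper_half_plane_def)

lemma qexp_holomorphic: "qexp h holomorphic_on A"
  unfolding qexp_def by (intro holomorphic_intros) auto

text \<open>Meromorphic functions of q on the unit disc whose only possible pole is at 0. Holomorphy
  of \<phi> on the whole disc makes the expansion converge on the whole upper half plane.\<close>

definition q_merom :: "real \<Rightarrow> (complex \<Rightarrow> complex) \<Rightarrow> bool" where
  "q_merom h \<psi> \<longleftrightarrow> (\<exists>M \<phi>. \<phi> holomorphic_on ball 0 1 \<and>
     (\<forall>\<tau>\<in>upper_half_plane. \<psi> \<tau> = \<phi> (qexp h \<tau>) / qexp h \<tau> ^ M))"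

lemma q_merom_periodic:
  assumes "h > 0" "q_merom h \<psi>" "\<tau> \<in> upper_half_plane"
  shows "\<psi> (\<tau> + of_real h) = \<psi> \<tau>"
proof -
  have "\<tau> + of_real h \<in> upper_half_plane" using assms(3) by (simp add: upper_half_plane_def)
  then show ?thesis using assms by (auto simp: q_merom_def qexp_periodic)
qed

lemma q_merom_holomorphic:
  assumes "h > 0" "q_merom h \<psi>"
  shows "\<psi> holomorphic_on upper_half_plane"
proof -
  obtain M \<phi> where \<phi>: "\<phi> holomorphic_on ball 0 1"
    "\<And>\<tau>. \<tau> \<in> upper_half_plane \<Longrightarrow> \<psi> \<tau> = \<phi> (qexp h \<tau>) / qexp h \<tau> ^ M"
    using assms(2) by (auto simp: q_merom_def)
  have "(\<lambda>\<tau>. \<phi> (qexp h \<tau>)) holomorphic_on upper_half_plane"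
    using qexp_ball[OF assms(1)]
    by (intro holomorphic_on_compose_gen[OF qexp_holomorphic \<phi>(1), unfolded o_def]) auto
  then have "(\<lambda>\<tau>. \<phi> (qexp h \<tau>) / qexp h \<tau> ^ M) holomorphic_on upper_half_plane"
    by (intro holomorphic_intros qexp_holomorphic) auto
  then show ?thesis by (rule holomorphic_transform) (simp add: \<phi>(2))
qed

lemma exp_growth_q_merom:
  assumes h: "h > 0" and \<psi>: "q_merom h \<psi>"
  shows "exp_growth \<psi>"
proof -
  obtain M \<phi> where \<phi>: "\<phi> holomorphic_on ball 0 1"
    "\<And>\<tau>. \<tau> \<in> upper_half_plane \<Longrightarrow> \<psi> \<tau> = \<phi> (qexp h \<tau>) / qexp h \<tau> ^ M"
    using \<psi> by (auto simp: q_merom_def)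
  define r where "r = exp (- 2 * pi / h)"
  have r: "r < 1" using h by (simp add: r_def)
  have "compact (\<phi> ` cball 0 r)"
    using r by (intro compact_continuous_image holomorphic_on_imp_continuous_on[OF \<phi>(1), THEN continuous_on_subset]) auto
  then have "bounded (\<phi> ` cball 0 r)" by (rule compact_imp_bounded)
  then obtain B where "\<forall>w\<in>\<phi> ` cball 0 r. norm w \<le> B" unfolding bounded_iff ..
  then have B: "norm (\<phi> z) \<le> B" if "z \<in> cball 0 r" for z using that by blast
  have 1: "exp_growth (\<lambda>\<tau>. \<phi> (qexp h \<tau>))"
  proof (rule exp_growth_bounded, rule exI[of _ B], rule exI[of _ 1], intro allI impI)
    fix \<tau> :: complex assume "1 \<le> Im \<tau>"
    then have "norm (qexp h \<tau>) \<le> r" unfolding norm_qexp r_def using h by (simp add: divide_right_mono)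
    then show "norm (\<phi> (qexp h \<tau>)) \<le> B" using B by simp
  qed
  have 2: "exp_growth (\<lambda>\<tau>. exp ((- of_nat M * 2 * of_real pi * \<i> / of_real h) * \<tau>))"
    by (rule exp_growth_exp)
  show ?thesis
  proof (rule exp_growth_cong[OF _ exp_growth_mult[OF 1 2]])
    fix \<tau> assume "\<tau> \<in> upper_half_plane"
    moreover have "inverse (qexp h \<tau> ^ M) = exp ((- of_nat M * 2 * of_real pi * \<i> / of_real h) * \<tau>)"
      by (simp add: qexp_def algebra_simps flip: exp_of_nat_mult exp_minus)
    ultimately show "\<psi> \<tau> = \<phi> (qexp h \<tau>) * exp ((- of_nat M * 2 * of_real pi * \<i> / of_real h) * \<tau>)"
      using \<phi>(2)[of \<tau>] by (simp add: divide_inverse)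
  qed
qed

lemma q_merom_cmult: "q_merom h \<psi> \<Longrightarrow> q_merom h (\<lambda>\<tau>. c * \<psi> \<tau>)"
proof -
  assume "q_merom h \<psi>"
  then obtain M \<phi> where \<phi>: "\<phi> holomorphic_on ball 0 1"
    "\<And>\<tau>. \<tau> \<in> upper_half_plane \<Longrightarrow> \<psi> \<tau> = \<phi> (qexp h \<tau>) / qexp h \<tau> ^ M"
    by (auto simp: q_merom_def)
  then show ?thesis
    unfolding q_merom_def
    by (intro exI[of _ M] exI[of _ "\<lambda>z. c * \<phi> z"]) (auto intro!: holomorphic_intros)
qed

lemma q_merom_zero: "q_merom h (\<lambda>_. 0)"
  unfolding q_merom_def by (intro exI[of _ 0] exI[of _ "\<lambda>_. 0"]) auto

lemma q_merom_add:
  assumes "q_merom h \<psi>" "q_merom h \<xi>"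
  shows "q_merom h (\<lambda>\<tau>. \<psi> \<tau> + \<xi> \<tau>)"
proof -
  obtain M \<phi> where \<phi>: "\<phi> holomorphic_on ball 0 1"
    "\<And>\<tau>. \<tau> \<in> upper_half_plane \<Longrightarrow> \<psi> \<tau> = \<phi> (qexp h \<tau>) / qexp h \<tau> ^ M"
    using assms(1) by (auto simp: q_merom_def)
  obtain N \<eta> where \<eta>: "\<eta> holomorphic_on ball 0 1"
    "\<And>\<tau>. \<tau> \<in> upper_half_plane \<Longrightarrow> \<xi> \<tau> = \<eta> (qexp h \<tau>) / qexp h \<tau> ^ N"
    using assms(2) by (auto simp: q_merom_def)
  show ?thesis
    unfolding q_merom_def
    using \<phi> \<eta> by (intro exI[of _ "M + N"] exI[of _ "\<lambda>z. \<phi> z * z ^ N + \<eta> z * z ^ M"])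
      (auto intro!: holomorphic_intros simp: add_divide_distrib power_add)
qed

lemma q_merom_sum: "(\<And>i. i \<in> I \<Longrightarrow> q_merom h (f i)) \<Longrightarrow> q_merom h (\<lambda>\<tau>. \<Sum>i\<in>I. f i \<tau>)"
  by (induction I rule: infinite_finite_induct) (auto intro: q_merom_zero q_merom_add)

text \<open>A factor q^M turns exponential growth into boundedness. The product, being periodic, is
  a function of q on the punctured disc, and Riemann's theorem removes the singularity at 0.\<close>

lemma periodic_q_merom:
  assumes h: "h > 0" and hol: "\<psi> holomorphic_on upper_half_plane"
    and per: "\<And>\<tau>. \<tau> \<in> upper_half_plane \<Longrightarrow> \<psi> (\<tau> + of_real h) = \<psi> \<tau>"
    and growth: "exp_growth \<psi>"
  shows "q_merom h \<psi>"
proof -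
  obtain C Y where CY: "C \<ge> 0" "Y > 0"
    "\<And>\<tau>. \<bar>Re \<tau>\<bar> \<le> h \<Longrightarrow> Im \<tau> \<ge> Y \<Longrightarrow> norm (\<psi> \<tau>) \<le> exp (C * Im \<tau>)"
    using exp_growthD[OF growth, of h] by metis
  \<comment> \<open>\<open>M\<close> is chosen so that the decay exp(-2 pi M Im \<tau> / h) of the
    modulus of q^M beats the growth exp(C Im \<tau>).\<close>
  obtain M :: nat where M: "C * h / (2 * pi) \<le> real M" using real_arch_simple by blast
  define \<xi> where "\<xi> \<tau> = \<psi> \<tau> * qexp h \<tau> ^ M" for \<tau>
  have hol\<xi>: "\<xi> holomorphic_on upper_half_plane"
    unfolding \<xi>_def by (intro holomorphic_intros hol qexp_holomorphic)
  have per\<xi>: "\<xi> (\<tau> + of_int n * of_real h) = \<xi> \<tau>" if "\<tau> \<in> upper_half_plane" for \<tau> n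
  proof -
    have nat: "\<xi> (\<tau> + of_nat k * of_real h) = \<xi> \<tau>" if "\<tau> \<in> upper_half_plane" for \<tau> k
    proof (induction k)
      case (Suc k)
      have "\<tau> + of_nat k * of_real h \<in> upper_half_plane" using that by (simp add: upper_half_plane_def)
      then have "\<xi> ((\<tau> + of_nat k * of_real h) + of_real h) = \<xi> (\<tau> + of_nat k * of_real h)"
        using h by (simp add: \<xi>_def per qexp_periodic)
      with Suc show ?case by (simp add: algebra_simps)
    qed simp
    show ?thesis
    proof (cases "n \<ge> 0")
      case True
      then show ?thesis using nat[OF that, of "nat n"] by simp
    next
      case False
      have "\<tau> + of_int n * of_real h \<in> upper_half_plane" using that by (simp add: upper_half_plane_def)
      from nat[OF this, of "nat (- n)"] show ?thesis using False by (simp add: algebra_simps)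
    qed
  qed
  have bound: "norm (\<xi> \<tau>) \<le> 1" if \<tau>: "Im \<tau> \<ge> Y" for \<tau>
  proof -
    \<comment> \<open>Shifting by this multiple of h brings Re \<tau> between 0 and h, into the
      strip where the growth bound is available.\<close>
    define n where "n = - \<lfloor>Re \<tau> / h\<rfloor>"
    let ?t = "\<tau> + of_int n * of_real h"
    have \<tau>u: "\<tau> \<in> upper_half_plane" using \<tau> CY by (simp add: upper_half_plane_def)
    have re: "\<bar>Re ?t\<bar> \<le> h"
    proof -
      have "Re ?t = h * (Re \<tau> / h - \<lfloor>Re \<tau> / h\<rfloor>)" using h by (simp add: n_def algebra_simps)
      moreover have "0 \<le> Re \<tau> / h - \<lfloor>Re \<tau> / h\<rfloor>" "Re \<tau> / h - \<lfloor>Re \<tau> / h\<rfloor> \<le> 1" by linarith+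
      ultimately show ?thesis using h by (simp add: abs_mult mult_left_le)
    qed
    have im: "Im ?t = Im \<tau>" by simp
    have "norm (\<xi> ?t) \<le> exp (C * Im \<tau>) * exp (- 2 * pi * Im \<tau> / h) ^ M"
      unfolding \<xi>_def norm_mult norm_power norm_qexp im
      using CY(3)[of ?t] re \<tau> by (intro mult_right_mono) auto
    also have "\<dots> = exp ((C - 2 * pi * real M / h) * Im \<tau>)"
      by (simp add: algebra_simps flip: exp_of_nat_mult exp_add)
    also have "\<dots> \<le> 1"
    proof -
      have "C \<le> 2 * pi * real M / h" using M h by (simp add: field_simps)
      then show ?thesis using \<tau> CY by (simp add: mult_nonpos_nonneg)
    qed
    finally show ?thesis using per\<xi>[OF \<tau>u] by simp
  qed
  \<comment> \<open>The principal logarithm jumps along the negative axis, but composing it with the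
    periodic \<xi> gives a function that does not depend on the branch.\<close>
  define l where "l w = of_real h * Ln w / (2 * of_real pi * \<i>)" for w :: complex
  have Im_l: "Im (l w) = - h * ln (norm w) / (2 * pi)" if "w \<noteq> 0" for w
    using that h by (simp add: l_def Im_divide power2_eq_square field_simps)
  have q_l: "qexp h (l w) = w" if "w \<noteq> 0" for w
    using that h by (simp add: qexp_def l_def)
  have l_uhp: "l w \<in> upper_half_plane" if "w \<in> ball 0 1 - {0}" for w
    using that h Im_l[of w] by (auto simp: upper_half_plane_def mult_pos_neg divide_neg_pos)
  define \<Phi> where "\<Phi> w = \<xi> (l w)" for w
  have \<xi>_eq: "\<xi> \<sigma> = \<xi> \<tau>" if eq: "qexp h \<sigma> = qexp h \<tau>" and \<tau>: "\<tau> \<in> upper_half_plane" for \<sigma> \<tau>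
  proof -
    obtain n :: int where "2 * of_real pi * \<i> * \<sigma> / of_real h =
        2 * of_real pi * \<i> * \<tau> / of_real h + of_int (2 * n) * of_real pi * \<i>"
      using eq unfolding qexp_def exp_eq by auto
    then have "(2 * of_real pi * \<i>) * \<sigma> = (2 * of_real pi * \<i>) * (\<tau> + of_int n * of_real h)"
      using h by (simp add: field_simps)
    then have "\<sigma> = \<tau> + of_int n * of_real h" by simp
    then show ?thesis using per\<xi>[OF \<tau>] by simp
  qed
  have \<Phi>_q: "\<Phi> (qexp h \<tau>) = \<xi> \<tau>" if "\<tau> \<in> upper_half_plane" for \<tau>
    unfolding \<Phi>_def using that by (intro \<xi>_eq q_l) auto
  have "\<Phi> field_differentiable at w0" if w0: "w0 \<in> ball 0 1 - {0}" for w0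
  proof -
    \<comment> \<open>Near w0 the logarithm is replaced by a branch centred at w0, for which w / w0
      stays in the right half plane; periodicity shows that \<Phi> is unchanged.\<close>
    define br where "br w = l w0 + of_real h * Ln (w / w0) / (2 * of_real pi * \<i>)" for w
    define U where "U = ball w0 (norm w0) \<inter> ball 0 1"
    have U: "open U" "w0 \<in> U" using w0 by (auto simp: U_def)
    have nonpos: "w / w0 \<notin> \<real>\<^sub>\<le>\<^sub>0" and wnz: "w \<noteq> 0" if "w \<in> U" for w
    proof -
      have "norm (w / w0 - 1) < 1"
      proof -
        have "w / w0 - 1 = (w - w0) / w0" using w0 by (simp add: field_simps)
        then show ?thesis using that w0 by (simp add: U_def dist_norm norm_divide norm_minus_commute)
      qed
      then have "Re (w / w0) > 0" using abs_Re_le_cmod[of "w / w0 - 1"] by simp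
      then show "w / w0 \<notin> \<real>\<^sub>\<le>\<^sub>0" "w \<noteq> 0" by (auto simp: complex_nonpos_Reals_iff)
    qed
    have br_hol: "br holomorphic_on U"
      unfolding br_def using w0 nonpos by (intro holomorphic_intros) auto
    have q_br: "qexp h (br w) = w" if "w \<in> U" for w
    proof -
      have "qexp h (br w) = qexp h (l w0) * exp (Ln (w / w0))"
        using h by (simp add: qexp_def br_def distrib_left add_divide_distrib exp_add)
      then show ?thesis using q_l[of w0] w0 wnz[OF that] by simp
    qed
    have br_uhp: "br w \<in> upper_half_plane" if "w \<in> U" for w
    proof -
      have "exp (- 2 * pi * Im (br w) / h) < 1"
        using q_br[OF that] norm_qexp[of h "br w"] that by (simp add: U_def)
      then have "0 < 2 * pi * Im (br w) / h" by simp
      then have "0 < (2 * pi * Im (br w) / h) * (h / (2 * pi))"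
        by (rule mult_pos_pos) (use h in simp)
      then show ?thesis using h by (simp add: upper_half_plane_def)
    qed
    have "(\<lambda>w. \<xi> (br w)) holomorphic_on U"
      using br_uhp by (intro holomorphic_on_compose_gen[OF br_hol hol\<xi>, unfolded o_def]) auto
    then have "\<Phi> holomorphic_on U"
    proof (rule holomorphic_transform)
      show "\<xi> (br w) = \<Phi> w" if "w \<in> U" for w
        using \<Phi>_q[OF br_uhp[OF that]] q_br[OF that] by simp
    qed
    then show ?thesis using U by (rule holomorphic_on_imp_differentiable_at)
  qed
  then have "\<Phi> holomorphic_on ball 0 1 - {0}"
    by (simp add: holomorphic_on_def field_differentiable_at_within)
  moreover have "\<exists>B. eventually (\<lambda>w. norm (\<Phi> w) \<le> B) (at 0)"
  proof (intro exI[of _ 1])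
    \<comment> \<open>The radius is the modulus of q at height \<open>Y\<close>, so this disc
      corresponds to Im \<tau> > Y, where \<xi> is bounded by 1.\<close>
    have "eventually (\<lambda>w. w \<noteq> 0 \<and> w \<in> ball 0 (exp (- 2 * pi * Y / h))) (at (0 :: complex))"
      by (intro eventually_conj eventually_neq_at_within eventually_at_in_open') auto
    then show "eventually (\<lambda>w. norm (\<Phi> w) \<le> 1) (at 0)"
    proof eventually_elim
      case (elim w)
      then have "ln (norm w) < - 2 * pi * Y / h"
        by (subst exp_less_cancel_iff[symmetric]) simp
      then have "Y \<le> Im (l w)" using h elim by (simp add: Im_l field_simps)
      then show ?case unfolding \<Phi>_def by (rule bound)
    qed
  qed
  ultimately obtain \<phi> where \<phi>: "\<phi> holomorphic_on ball 0 1" "\<And>w. w \<in> ball 0 1 - {0} \<Longrightarrow> \<phi> w = \<Phi> w"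
    using holomorphic_on_extend_bounded[of \<Phi> "ball 0 1" 0] by auto
  have "\<psi> \<tau> = \<phi> (qexp h \<tau>) / qexp h \<tau> ^ M" if "\<tau> \<in> upper_half_plane" for \<tau>
    using \<phi>(2)[of "qexp h \<tau>"] qexp_ball[OF h that] \<Phi>_q[OF that] by (simp add: \<xi>_def)
  then show ?thesis using \<phi>(1) by (auto simp: q_merom_def)
qed

section \<open>Logarithmic expansions from Jordan blocks\<close>

text \<open>The binomial basis is adapted to the shift by h: \<tau>/h becomes \<tau>/h + 1, and by
  Pascal's rule each binomial coefficient gains just the preceding one. This is the action of a
  Jordan block, which the powers of \<tau> do not exhibit directly.\<close>

definition log_block :: "real \<Rightarrow> real \<Rightarrow> nat \<Rightarrow> (complex \<Rightarrow> complex) \<Rightarrow> bool" where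
  "log_block h \<mu> d u \<longleftrightarrow> (\<exists>\<psi>. (\<forall>j<d. q_merom h (\<psi> j)) \<and>
     (\<forall>\<tau>\<in>upper_half_plane. u \<tau> = exp (of_real \<mu> * (2 * of_real pi * \<i> * \<tau> / of_real h)) *
        (\<Sum>j<d. ((\<tau> / of_real h) gchoose j) * \<psi> j \<tau>)))"

lemma holomorphic_gchoose: "(\<lambda>\<tau>. (\<tau> / of_real h) gchoose j) holomorphic_on A"
  unfolding gbinomial_prod_rev by (intro holomorphic_intros) auto

lemma exp_growth_gchoose: "exp_growth (\<lambda>\<tau>. (\<tau> / of_real h) gchoose j)"
proof -
  have "exp_growth (\<lambda>\<tau>. inverse (fact j) * (\<Prod>i = 0..<j. inverse (of_real h) * \<tau> - of_nat i))"
    by (intro exp_growth_mult exp_growth_const exp_growth_prod exp_growth_diff exp_growth_id)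
  then show ?thesis by (simp add: gbinomial_prod_rev divide_inverse mult.commute)
qed

lemma shift_uhp: "\<tau> \<in> upper_half_plane \<Longrightarrow> \<tau> + of_real x \<in> upper_half_plane"
  by (simp add: upper_half_plane_def)

lemma exp_shift:
  assumes "h > 0"
  shows "exp (of_real \<mu> * (2 * of_real pi * \<i> * (\<tau> + of_real h) / of_real h)) =
    exp (2 * of_real pi * \<i> * of_real \<mu>) * exp (of_real \<mu> * (2 * of_real pi * \<i> * \<tau> / of_real h))"
  using assms by (simp add: field_simps flip: exp_add)

text \<open>One step of solving a triangular difference equation: subtract a particular solution
  from u, after removing the exponential factor, and what remains is periodic and of exponential
  growth, hence a function of q.\<close>

lemma log_block_Suc:
  assumes h: "h > 0" and hol: "u holomorphic_on upper_half_plane" and growth: "exp_growth u"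
    and shift: "\<And>\<tau>. \<tau> \<in> upper_half_plane \<Longrightarrow>
      u (\<tau> + of_real h) = exp (2 * of_real pi * \<i> * of_real \<mu>) * u \<tau> + v \<tau>"
    and v: "log_block h \<mu> d v"
  shows "log_block h \<mu> (Suc d) u"
proof -
  define ev where "ev = exp (2 * of_real pi * \<i> * of_real \<mu>)"
  define e where "e \<tau> = exp (of_real \<mu> * (2 * of_real pi * \<i> * \<tau> / of_real h))" for \<tau>
  have e_shift: "e (\<tau> + of_real h) = ev * e \<tau>" for \<tau>
    unfolding e_def ev_def by (rule exp_shift[OF h])
  have nz: "ev \<noteq> 0" "e \<tau> \<noteq> 0" for \<tau> by (simp_all add: ev_def e_def)
  obtain \<psi> where \<psi>: "\<And>j. j < d \<Longrightarrow> q_merom h (\<psi> j)"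
    "\<And>\<tau>. \<tau> \<in> upper_half_plane \<Longrightarrow> v \<tau> = e \<tau> * (\<Sum>j<d. ((\<tau> / of_real h) gchoose j) * \<psi> j \<tau>)"
    using v unfolding log_block_def e_def by auto
  \<comment> \<open>A discrete antiderivative of v: every binomial index is raised by one, and
    Pascal's rule makes the increment equal to the original sum, up to the factor
    \<open>inverse ev\<close>.\<close>
  define p where "p \<tau> = (\<Sum>j<d. ((\<tau> / of_real h) gchoose Suc j) * (inverse ev * \<psi> j \<tau>))" for \<tau>
  have p_shift: "p (\<tau> + of_real h) = p \<tau> + inverse ev * (\<Sum>j<d. ((\<tau> / of_real h) gchoose j) * \<psi> j \<tau>)"
    if \<tau>: "\<tau> \<in> upper_half_plane" for \<tau>
  proof -
    have "((\<tau> + of_real h) / of_real h) gchoose Suc j = ((\<tau> / of_real h) gchoose j) + ((\<tau> / of_real h) gchoose Suc j)" for j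
      using h by (simp add: add_divide_distrib gbinomial_Suc_Suc)
    then show ?thesis
      unfolding p_def using \<tau> by (simp add: q_merom_periodic[OF h \<psi>(1)] sum.distrib sum_distrib_left algebra_simps)
  qed
  define w where "w \<tau> = inverse (e \<tau>) * u \<tau> - p \<tau>" for \<tau>
  have e_inv: "inverse (e \<tau>) = exp ((- of_real \<mu> * 2 * of_real pi * \<i> / of_real h) * \<tau>)" for \<tau>
    by (simp add: e_def mult.assoc flip: exp_minus)
  have "q_merom h w"
  proof (rule periodic_q_merom[OF h])
    show "w holomorphic_on upper_half_plane"
      unfolding w_def p_def e_inv
      by (intro holomorphic_intros hol holomorphic_gchoose q_merom_holomorphic[OF h] \<psi>) auto
    show "exp_growth w"
      unfolding w_def p_def e_inv
      by (intro exp_growth_diff exp_growth_mult exp_growth_sum exp_growth_exp growth exp_growth_gchoose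
          exp_growth_const exp_growth_q_merom[OF h] \<psi>) auto
    fix \<tau> assume \<tau>: "\<tau> \<in> upper_half_plane"
    have "inverse (e (\<tau> + of_real h)) * u (\<tau> + of_real h) =
        inverse (ev * e \<tau>) * (ev * u \<tau> + e \<tau> * (\<Sum>j<d. ((\<tau> / of_real h) gchoose j) * \<psi> j \<tau>))"
      unfolding e_shift shift[OF \<tau>, folded ev_def] \<psi>(2)[OF \<tau>] by simp
    also have "\<dots> = inverse (e \<tau>) * u \<tau> + inverse ev * (\<Sum>j<d. ((\<tau> / of_real h) gchoose j) * \<psi> j \<tau>)"
    proof -
      have "inverse (b * a) * (b * x + a * y) = inverse a * x + inverse b * y"
        if "a \<noteq> 0" "b \<noteq> 0" for a b x y :: complex
        using that by (simp add: field_simps)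
      then show ?thesis using nz by blast
    qed
    finally show "w (\<tau> + of_real h) = w \<tau>"
      unfolding w_def p_shift[OF \<tau>] by simp
  qed
  define \<psi>' where "\<psi>' j = (case j of 0 \<Rightarrow> w | Suc j \<Rightarrow> (\<lambda>\<tau>. inverse ev * \<psi> j \<tau>))" for j
  have "q_merom h (\<psi>' j)" if "j < Suc d" for j
    using that \<open>q_merom h w\<close> q_merom_cmult[OF \<psi>(1)] by (cases j) (auto simp: \<psi>'_def)
  moreover have "u \<tau> = e \<tau> * (\<Sum>j<Suc d. ((\<tau> / of_real h) gchoose j) * \<psi>' j \<tau>)" for \<tau>
  proof -
    have "(\<Sum>j<Suc d. ((\<tau> / of_real h) gchoose j) * \<psi>' j \<tau>) = w \<tau> + p \<tau>"
      unfolding sum.lessThan_Suc_shift by (simp add: \<psi>'_def p_def)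
    then show ?thesis using nz by (simp add: w_def)
  qed
  ultimately show ?thesis unfolding log_block_def e_def by blast
qed

lemma log_block_mono:
  assumes "log_block h \<mu> d u" "d \<le> d'"
  shows "log_block h \<mu> d' u"
proof -
  obtain \<psi> where \<psi>: "\<And>j. j < d \<Longrightarrow> q_merom h (\<psi> j)"
    "\<And>\<tau>. \<tau> \<in> upper_half_plane \<Longrightarrow> u \<tau> = exp (of_real \<mu> * (2 * of_real pi * \<i> * \<tau> / of_real h)) *
       (\<Sum>j<d. ((\<tau> / of_real h) gchoose j) * \<psi> j \<tau>)"
    using assms(1) unfolding log_block_def by auto
  define \<psi>' where "\<psi>' j = (if j < d then \<psi> j else (\<lambda>_. 0))" for j
  have "(\<Sum>j<d'. ((\<tau> / of_real h) gchoose j) * \<psi>' j \<tau>) = (\<Sum>j<d. ((\<tau> / of_real h) gchoose j) * \<psi> j \<tau>)" for \<tau>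
    using assms(2) by (intro sum.mono_neutral_cong_right) (auto simp: \<psi>'_def)
  moreover have "q_merom h (\<psi>' j)" for j using \<psi>(1) q_merom_zero by (auto simp: \<psi>'_def)
  ultimately show ?thesis unfolding log_block_def using \<psi>(2) by (intro exI[of _ \<psi>']) auto
qed

text \<open>The last coordinate is an eigenfunction of the shift, and each earlier one has its
  successor as inhomogeneous term. Going upwards, every step costs one more binomial coefficient, so
  coordinate m - d needs d of them.\<close>

lemma log_block_jordan_block:
  assumes h: "h > 0" and hol: "\<And>l. l < m \<Longrightarrow> u l holomorphic_on upper_half_plane"
    and growth: "\<And>l. l < m \<Longrightarrow> exp_growth (u l)"
    and shift: "\<And>l \<tau>. l < m \<Longrightarrow> \<tau> \<in> upper_half_plane \<Longrightarrow>
      u l (\<tau> + of_real h) = exp (2 * of_real pi * \<i> * of_real \<mu>) * u l \<tau> + (if Suc l < m then u (Suc l) \<tau> else 0)"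
    and l: "l < m"
  shows "log_block h \<mu> m (u l)"
proof -
  have "log_block h \<mu> d (u (m - d))" if "1 \<le> d" "d \<le> m" for d
    using that
  proof (induction d rule: dec_induct)
    case base
    have "log_block h \<mu> (Suc 0) (u (m - 1))"
    proof (rule log_block_Suc[OF h])
      show "log_block h \<mu> 0 (\<lambda>_. 0)" unfolding log_block_def by simp
      show "u (m - 1) (\<tau> + of_real h) = exp (2 * of_real pi * \<i> * of_real \<mu>) * u (m - 1) \<tau> + 0"
        if "\<tau> \<in> upper_half_plane" for \<tau>
        using shift[of "m - 1" \<tau>] that l by simp
    qed (use hol growth l in auto)
    then show ?case by simp
  next
    case (step d)
    have eq: "Suc (m - Suc d) = m - d" using step by simp
    show ?case
    proof (rule log_block_Suc[OF h])
      show "log_block h \<mu> d (u (m - d))" using step by simp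
      show "u (m - Suc d) (\<tau> + of_real h) = exp (2 * of_real pi * \<i> * of_real \<mu>) * u (m - Suc d) \<tau> + u (m - d) \<tau>"
        if "\<tau> \<in> upper_half_plane" for \<tau>
        using shift[of "m - Suc d" \<tau>, unfolded eq] that step by simp
    qed (use hol growth step in auto)
  qed
  from this[of "m - l"] have "log_block h \<mu> (m - l) (u l)" using l by simp
  then show ?thesis by (rule log_block_mono) simp
qed

lemma exp_mu_exponent:
  assumes "norm ev = 1"
  shows "exp (2 * of_real pi * \<i> * of_real (\<mu>_exponent ev)) = ev"
  using Arg2pi_eq[of ev] assms by (simp add: \<mu>_exponent_def mult_ac)

text \<open>The shift equation decouples along the blocks, and each coordinate is governed by the
  one block whose rows contain it.\<close>

lemma log_block_jordan_matrix:
  assumes h: "h > 0"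
    and "\<And>ev. ev \<in> snd ` set blocks \<Longrightarrow> norm ev = 1"
    and "\<And>i. i < sum_list (map fst blocks) \<Longrightarrow> u i holomorphic_on upper_half_plane"
    and "\<And>i. i < sum_list (map fst blocks) \<Longrightarrow> exp_growth (u i)"
    and "\<And>i \<tau>. i < sum_list (map fst blocks) \<Longrightarrow> \<tau> \<in> upper_half_plane \<Longrightarrow>
      u i (\<tau> + of_real h) = (\<Sum>j<sum_list (map fst blocks). jordan_matrix blocks $$ (i, j) * u j \<tau>)"
    and "i < sum_list (map fst blocks)"
  shows "\<exists>p<length blocks. log_block h (\<mu>_exponent (snd (blocks ! p))) (fst (blocks ! p)) (u i)"
  using assms(2-)
proof (induction blocks arbitrary: u i)
  case (Cons b bs)
  obtain m ev where b: "b = (m, ev)" by force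
  let ?N = "sum_list (map fst bs)"
  note ev = Cons.prems(1) and hol = Cons.prems(2) and growth = Cons.prems(3) and shift = Cons.prems(4)
  have J: "jordan_matrix (b # bs) = four_block_mat (jordan_block m ev) (0\<^sub>m m ?N) (0\<^sub>m ?N m) (jordan_matrix bs)"
    unfolding b by (rule jordan_matrix_Cons)
  have sum_split: "(\<Sum>j<m + ?N. f j) = (\<Sum>j<m. f j) + (\<Sum>j<?N. f (m + j))" for f :: "nat \<Rightarrow> complex"
    by (simp add: sum.nat_group lessThan_atLeast0 sum.atLeastLessThan_concat[of 0 m "m + ?N", symmetric]
        sum.shift_bounds_nat_ivl[of f 0 m ?N, symmetric, simplified] add.commute)
  show ?case
  proof (cases "i < m")
    case True
    have "log_block h (\<mu>_exponent ev) m (u i)"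
    proof (rule log_block_jordan_block[OF h _ _ _ True])
      fix l \<tau> assume l: "l < m" and \<tau>: "\<tau> \<in> upper_half_plane"
      have "u l (\<tau> + of_real h) = (\<Sum>j<m + ?N. jordan_matrix (b # bs) $$ (l, j) * u j \<tau>)"
        using shift[of l \<tau>] l \<tau> by (simp add: b)
      also have "\<dots> = (\<Sum>j<m. jordan_block m ev $$ (l, j) * u j \<tau>)"
        unfolding sum_split J using l by simp
      also have "\<dots> = (\<Sum>j<m. (if j = l then ev * u l \<tau> else 0) + (if j = Suc l then u (Suc l) \<tau> else 0))"
        using l by (intro sum.cong) auto
      also have "\<dots> = ev * u l \<tau> + (if Suc l < m then u (Suc l) \<tau> else 0)"
        using l by (simp add: sum.distrib)
      finally show "u l (\<tau> + of_real h) = exp (2 * of_real pi * \<i> * of_real (\<mu>_exponent ev)) * u l \<tau> +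
          (if Suc l < m then u (Suc l) \<tau> else 0)"
        using exp_mu_exponent[of ev] ev by (simp add: b)
    qed (use hol growth in \<open>auto simp: b\<close>)
    then show ?thesis by (intro exI[of _ 0]) (simp add: b)
  next
    case False
    have "\<exists>p<length bs. log_block h (\<mu>_exponent (snd (bs ! p))) (fst (bs ! p)) (u (m + (i - m)))"
    proof (rule Cons.IH[of "\<lambda>k. u (m + k)" "i - m"])
      show "i - m < ?N" using Cons.prems(5) False by (simp add: b)
      fix k \<tau> assume k: "k < ?N" and \<tau>: "\<tau> \<in> upper_half_plane"
      have "u (m + k) (\<tau> + of_real h) = (\<Sum>j<m + ?N. jordan_matrix (b # bs) $$ (m + k, j) * u j \<tau>)"
        using shift[of "m + k" \<tau>] k \<tau> by (simp add: b)
      also have "\<dots> = (\<Sum>j<?N. jordan_matrix bs $$ (k, j) * u (m + j) \<tau>)"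
        unfolding sum_split J using k by simp
      finally show "u (m + k) (\<tau> + of_real h) = (\<Sum>j<?N. jordan_matrix bs $$ (k, j) * u (m + j) \<tau>)" .
    qed (use ev hol growth in \<open>auto simp: b\<close>)
    then obtain p where "p < length bs" "log_block h (\<mu>_exponent (snd (bs ! p))) (fst (bs ! p)) (u i)"
      using False by auto
    then show ?thesis by (intro exI[of _ "Suc p"]) simp
  qed
qed simp

text \<open>The required expansion is in powers of log q. The recursion (j+1) (y choose j+1) = (y -
  j) (y choose j) shows that a binomial coefficient of index j is a polynomial of degree at most
  j.\<close>

lemma gchoose_powers:
  "\<exists>c. \<forall>x :: complex. (c' * x) gchoose j = (\<Sum>i\<le>j. c i * x ^ i)"
proof (induction j)
  case 0
  show ?case by (intro exI[of _ "\<lambda>_. 1"]) simp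
next
  case (Suc j)
  then obtain c where c: "\<And>x :: complex. (c' * x) gchoose j = (\<Sum>i\<le>j. c i * x ^ i)" by blast
  define d where "d i = ((if i = 0 then 0 else c' * c (i - 1)) - (if i \<le> j then of_nat j * c i else 0)) / of_nat (Suc j)" for i
  have "(c' * x) gchoose Suc j = (\<Sum>i\<le>Suc j. d i * x ^ i)" for x :: complex
  proof -
    have "(c' * x - of_nat j) * ((c' * x) gchoose j) = of_nat (Suc j) * ((c' * x) gchoose Suc j)"
      using gbinomial_mult_1[of "c' * x" j] by (simp add: left_diff_distrib del: of_nat_Suc)
    then have "(c' * x) gchoose Suc j = (c' * x - of_nat j) * ((c' * x) gchoose j) / of_nat (Suc j)"
      by (simp del: of_nat_Suc)
    also have "\<dots> = ((\<Sum>i\<le>j. c' * c i * x ^ Suc i) - (\<Sum>i\<le>j. of_nat j * c i * x ^ i)) / of_nat (Suc j)"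
      unfolding c sum_distrib_left sum_subtractf[symmetric]
      by (intro arg_cong[where f = "\<lambda>t. t / of_nat (Suc j)"] sum.cong refl) (simp add: algebra_simps)
    also have "(\<Sum>i\<le>j. c' * c i * x ^ Suc i) = (\<Sum>i\<le>Suc j. (if i = 0 then 0 else c' * c (i - 1)) * x ^ i)"
      unfolding sum.atMost_Suc_shift by simp
    also have "(\<Sum>i\<le>j. of_nat j * c i * x ^ i) = (\<Sum>i\<le>Suc j. (if i \<le> j then of_nat j * c i else 0) * x ^ i)"
      by (simp add: sum.atMost_Suc)
    also have "((\<Sum>i\<le>Suc j. (if i = 0 then 0 else c' * c (i - 1)) * x ^ i) -
        (\<Sum>i\<le>Suc j. (if i \<le> j then of_nat j * c i else 0) * x ^ i)) / of_nat (Suc j) = (\<Sum>i\<le>Suc j. d i * x ^ i)"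
      unfolding sum_subtractf[symmetric] sum_divide_distrib d_def
      by (intro sum.cong) (simp_all add: left_diff_distrib diff_divide_distrib)
    finally show ?thesis .
  qed
  then show ?case by blast
qed

lemma log_block_powers:
  assumes "h > 0" "log_block h \<mu> d u"
  shows "\<exists>\<psi>. (\<forall>j. q_merom h (\<psi> j)) \<and>
    (\<forall>\<tau>\<in>upper_half_plane. u \<tau> = (\<Sum>j<d. (2 * of_real pi * \<i> * \<tau> / of_real h) ^ j *
       exp (of_real \<mu> * (2 * of_real pi * \<i> * \<tau> / of_real h)) * \<psi> j \<tau>))"
proof -
  define L where "L \<tau> = 2 * of_real pi * \<i> * \<tau> / of_real h" for \<tau>
  obtain \<psi> where \<psi>: "\<And>j. j < d \<Longrightarrow> q_merom h (\<psi> j)"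
    "\<And>\<tau>. \<tau> \<in> upper_half_plane \<Longrightarrow> u \<tau> = exp (of_real \<mu> * L \<tau>) * (\<Sum>j<d. ((\<tau> / of_real h) gchoose j) * \<psi> j \<tau>)"
    using assms(2) unfolding log_block_def L_def by auto
  obtain c where c: "\<And>j x. (inverse (2 * of_real pi * \<i>) * x :: complex) gchoose j = (\<Sum>i\<le>j. c j i * x ^ i)"
    using gchoose_powers[of "inverse (2 * of_real pi * \<i>)"] by metis
  have c': "(\<tau> / of_real h) gchoose j = (\<Sum>i\<le>j. c j i * L \<tau> ^ i)" for \<tau> j
  proof -
    have "inverse a * (a * \<tau> / of_real h) = \<tau> / of_real h" if "a \<noteq> 0" for a using that by simp
    moreover have "2 * of_real pi * \<i> \<noteq> (0 :: complex)" by simp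
    ultimately have "inverse (2 * of_real pi * \<i>) * L \<tau> = \<tau> / of_real h" unfolding L_def by blast
    then show ?thesis using c[of "L \<tau>" j] by simp
  qed
  show ?thesis
  \<comment> \<open>The coefficient of the i-th power collects contributions from all binomial
    coefficients of index at least i.\<close>
  proof (intro exI[of _ "\<lambda>i \<tau>. \<Sum>j\<in>{j. i \<le> j \<and> j < d}. c j i * \<psi> j \<tau>"] conjI allI ballI)
    show "q_merom h (\<lambda>\<tau>. \<Sum>j\<in>{j. i \<le> j \<and> j < d}. c j i * \<psi> j \<tau>)" for i
      by (intro q_merom_sum q_merom_cmult \<psi>) auto
    fix \<tau> assume \<tau>: "\<tau> \<in> upper_half_plane"
    have "(\<Sum>j<d. ((\<tau> / of_real h) gchoose j) * \<psi> j \<tau>) = (\<Sum>j<d. \<Sum>i\<le>j. L \<tau> ^ i * (c j i * \<psi> j \<tau>))"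
      unfolding c' sum_distrib_right by (intro sum.cong refl) (simp add: mult_ac)
    also have "\<dots> = (\<Sum>j<d. \<Sum>i\<in>{i. i < d \<and> i \<le> j}. L \<tau> ^ i * (c j i * \<psi> j \<tau>))"
      by (intro sum.cong refl) auto
    also have "\<dots> = (\<Sum>i<d. \<Sum>j\<in>{j. i \<le> j \<and> j < d}. L \<tau> ^ i * (c j i * \<psi> j \<tau>))"
      using sum.swap_restrict[of "{..<d}" "{..<d}" "\<lambda>j i. L \<tau> ^ i * (c j i * \<psi> j \<tau>)" "\<lambda>j i. i \<le> j"]
      by (simp add: conj_commute)
    finally show "u \<tau> = (\<Sum>j<d. (2 * of_real pi * \<i> * \<tau> / of_real h) ^ j *
        exp (of_real \<mu> * (2 * of_real pi * \<i> * \<tau> / of_real h)) * (\<Sum>k\<in>{k. j \<le> k \<and> k < d}. c k j * \<psi> k \<tau>))"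
      unfolding \<psi>(2)[OF \<tau>] by (simp add: L_def sum_distrib_left mult_ac)
  qed
qed

text \<open>The statement for all large \<open>M\<close> allows one order of truncation to be used
  later for all components and blocks: the coefficients vanish below -M0, so enlarging the index set
  changes nothing.\<close>

lemma q_merom_series:
  assumes h: "h > 0" and \<psi>: "q_merom h \<psi>"
  shows "\<exists>M0 a. \<forall>M\<ge>M0. \<forall>\<tau>\<in>upper_half_plane. ((\<lambda>n. a n * qexp h \<tau> powi n) has_sum \<psi> \<tau>) {- int M..}"
proof -
  obtain M0 \<phi> where \<phi>: "\<phi> holomorphic_on ball 0 1"
    "\<And>\<tau>. \<tau> \<in> upper_half_plane \<Longrightarrow> \<psi> \<tau> = \<phi> (qexp h \<tau>) / qexp h \<tau> ^ M0"
    using \<psi> by (auto simp: q_merom_def)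
  define b where "b n = (deriv ^^ n) \<phi> 0 / fact n" for n
  define a where "a n = (if n < - int M0 then 0 else b (nat (n + int M0)))" for n
  have series: "((\<lambda>n. b n * z ^ n) has_sum \<phi> z) UNIV" if z: "z \<in> ball 0 1" for z
  proof -
    have sums: "(\<lambda>n. b n * w ^ n) sums \<phi> w" if "w \<in> ball 0 1" for w
      using holomorphic_power_series[OF \<phi>(1) that] by (simp add: b_def)
    \<comment> \<open>Convergence at a radius strictly beyond the modulus of z gives the absolute
      convergence that \<open>has_sum\<close> requires.\<close>
    obtain r where r: "norm z < r" "r < 1" using z dense[of "norm z" 1] by auto
    have "r > 0" using r(1) norm_ge_zero[of z] by linarith
    then have "norm (complex_of_real r) = r" by simp
    then have "summable (\<lambda>n. b n * of_real r ^ n)"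
      using sums[of "of_real r"] r by (auto simp: sums_iff)
    then have "summable (\<lambda>n. norm (b n * z ^ n))"
      using r norm_ge_zero[of z] by (intro powser_insidea[of b "of_real r"]) auto
    then show ?thesis using sums[OF z] by (rule norm_summable_imp_has_sum)
  qed
  have main: "((\<lambda>n. a n * qexp h \<tau> powi n) has_sum \<psi> \<tau>) {- int M0..}" if \<tau>: "\<tau> \<in> upper_half_plane" for \<tau>
  proof -
    let ?q = "qexp h \<tau>"
    have "((\<lambda>n. inverse (?q ^ M0) * (b n * ?q ^ n)) has_sum (inverse (?q ^ M0) * \<phi> ?q)) UNIV"
      by (intro has_sum_cmult_right series qexp_ball h \<tau>)
    moreover have "inverse (?q ^ M0) * (b n * ?q ^ n) = a (int n - int M0) * ?q powi (int n - int M0)" for n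
      by (simp add: a_def power_int_diff divide_inverse mult_ac)
    moreover have "bij_betw (\<lambda>n. int n - int M0) UNIV {- int M0..}"
      by (rule bij_betwI[where g = "\<lambda>k. nat (k + int M0)"]) auto
    ultimately have "((\<lambda>n. a n * ?q powi n) has_sum (inverse (?q ^ M0) * \<phi> ?q)) {- int M0..}"
      using has_sum_reindex_bij_betw[of "\<lambda>n. int n - int M0" UNIV "{- int M0..}" "\<lambda>n. a n * ?q powi n"] by simp
    then show ?thesis using \<phi>(2)[OF \<tau>] by (simp add: divide_inverse mult.commute)
  qed
  have "((\<lambda>n. a n * qexp h \<tau> powi n) has_sum \<psi> \<tau>) {- int M..}"
    if "M \<ge> M0" "\<tau> \<in> upper_half_plane" for M \<tau>
  proof -
    have "((\<lambda>n. a n * qexp h \<tau> powi n) has_sum \<psi> \<tau>) {- int M0..} \<longleftrightarrow>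
        ((\<lambda>n. a n * qexp h \<tau> powi n) has_sum \<psi> \<tau>) {- int M..}"
      by (rule has_sum_cong_neutral) (use that in \<open>auto simp: a_def\<close>)
    then show ?thesis using main[OF that(2)] by blast
  qed
  then show ?thesis by blast
qed

lemma mult_mat_vec_entry:
  assumes "A \<in> carrier_mat n m" "i < n"
  shows "(A *\<^sub>v Matrix.vec m f) $v i = (\<Sum>j<m. A $$ (i, j) * f j)"
  using assms by (auto simp: scalar_prod_def lessThan_atLeast0 intro!: sum.cong)

text \<open>In a Jordan basis, u = Q g satisfies the decoupled shift equation, so every coordinate
  of u expands with the data of a single block. Going back by g = S u mixes the blocks, and the
  terms are then collected block by block.\<close>

lemma log_expansion_components:
  fixes g :: "nat \<Rightarrow> complex \<Rightarrow> complex"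
  assumes h: "h > 0" and P: "P \<in> carrier_mat m m"
    and ev: "\<And>ev. eigenvalue P ev \<Longrightarrow> norm ev = 1"
    and hol: "\<And>i. i < m \<Longrightarrow> g i holomorphic_on upper_half_plane"
    and growth: "\<And>i. i < m \<Longrightarrow> exp_growth (g i)"
    and shift: "\<And>i \<tau>. i < m \<Longrightarrow> \<tau> \<in> upper_half_plane \<Longrightarrow>
      g i (\<tau> + of_real h) = (\<Sum>j<m. P $$ (i, j) * g j \<tau>)"
  shows "\<exists>blocks (M :: int) (x :: nat \<Rightarrow> nat \<Rightarrow> int \<Rightarrow> complex Matrix.vec).
    jordan_nf P blocks \<and> (\<forall>p j n. x p j n \<in> carrier_vec m) \<and>
    (\<forall>\<tau>\<in>upper_half_plane. \<forall>i<m.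
      (\<forall>p<length blocks. \<forall>j<fst (blocks ! p). (\<lambda>n. (x p j n $v i) * qexp h \<tau> powi n) summable_on {- M..}) \<and>
      g i \<tau> = (\<Sum>p<length blocks. \<Sum>j<fst (blocks ! p).
        (2 * of_real pi * \<i> * \<tau> / of_real h) ^ j *
        exp (of_real (\<mu>_exponent (snd (blocks ! p))) * (2 * of_real pi * \<i> * \<tau> / of_real h)) *
        (\<Sum>\<^sub>\<infinity>n\<in>{- M..}. (x p j n $v i) * qexp h \<tau> powi n)))"
proof -
  obtain as where "char_poly P = (\<Prod>a\<leftarrow>as. [:- a, 1:])"
    using char_poly_factorized[OF P] by blast
  then obtain blocks where jnf: "jordan_nf P blocks" using jordan_nf_exists[OF P] by blast
  let ?J = "jordan_matrix blocks"
  obtain S Q where wit: "similar_mat_wit P ?J S Q"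
    using jnf by (auto simp: jordan_nf_def similar_mat_def)
  have carr: "?J \<in> carrier_mat m m" "S \<in> carrier_mat m m" "Q \<in> carrier_mat m m"
    and SQ: "S * Q = 1\<^sub>m m" "Q * S = 1\<^sub>m m" and PJ: "P = S * ?J * Q"
    using wit P by (auto simp: similar_mat_wit_def Let_def)
  have N: "sum_list (map fst blocks) = m" using carr(1) by (metis carrier_matD(1) jordan_matrix_dim(1))
  have ev1: "norm ev = 1" if ev_block: "ev \<in> snd ` set blocks" for ev
  proof -
    obtain k where k: "(k, ev) \<in> set blocks" using ev_block by force
    \<comment> \<open>Only for a block of positive size is its number a root of the characteristic
      polynomial.\<close>
    have "k \<noteq> 0" using jnf k by (force simp: jordan_nf_def)
    then have "poly ((\<Prod>(n, a)\<leftarrow>blocks. [:- a, 1:] ^ n)) ev = 0"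
      using k by (force simp: poly_prod_list prod_list_zero_iff poly_power)
    then show ?thesis
      using ev eigenvalue_root_char_poly[OF P] jordan_nf_char_poly[OF jnf] by auto
  qed
  define gv where "gv \<tau> = Matrix.vec m (\<lambda>i. g i \<tau>)" for \<tau>
  have gv: "gv \<tau> \<in> carrier_vec m" for \<tau> by (simp add: gv_def)
  define u where "u l \<tau> = (\<Sum>j<m. Q $$ (l, j) * g j \<tau>)" for l \<tau>
  have u_vec: "Q *\<^sub>v gv \<tau> = Matrix.vec m (\<lambda>l. u l \<tau>)" for \<tau>
    using carr by (intro eq_vecI) (auto simp: mult_mat_vec_entry[of Q m m] gv_def u_def simp del: index_mult_mat_vec)
  have gv_shift: "gv (\<tau> + of_real h) = P *\<^sub>v gv \<tau>" if "\<tau> \<in> upper_half_plane" for \<tau>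
    using P shift[OF _ that] by (intro eq_vecI) (auto simp: mult_mat_vec_entry[of P m m] gv_def simp del: index_mult_mat_vec)
  have "\<exists>p<length blocks. log_block h (\<mu>_exponent (snd (blocks ! p))) (fst (blocks ! p)) (u l)"
    if l: "l < m" for l
  proof (rule log_block_jordan_matrix[OF h ev1])
    fix i \<tau> assume i: "i < sum_list (map fst blocks)" and \<tau>: "\<tau> \<in> upper_half_plane"
    have "Q *\<^sub>v gv (\<tau> + of_real h) = ?J *\<^sub>v (Q *\<^sub>v gv \<tau>)"
    proof -
      have "Q *\<^sub>v gv (\<tau> + of_real h) = (Q * P) *\<^sub>v gv \<tau>"
        using carr P gv by (simp add: gv_shift[OF \<tau>])
      also have "Q * P = (Q * S) * ?J * Q"
        unfolding PJ using carr by (simp add: assoc_mult_mat[of _ m m _ m _ m])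
      also have "\<dots> = ?J * Q" unfolding SQ(2) left_mult_one_mat[OF carr(1)] ..
      finally show ?thesis using carr gv by simp
    qed
    then have "(Q *\<^sub>v gv (\<tau> + of_real h)) $v i = (?J *\<^sub>v Matrix.vec m (\<lambda>l. u l \<tau>)) $v i"
      by (simp only: u_vec)
    then show "u i (\<tau> + of_real h) = (\<Sum>j<sum_list (map fst blocks). ?J $$ (i, j) * u j \<tau>)"
      using i carr by (simp add: u_vec mult_mat_vec_entry[of ?J m m] N del: index_mult_mat_vec)
  next
    show "u i holomorphic_on upper_half_plane" for i
      unfolding u_def by (intro holomorphic_intros hol) auto
    show "exp_growth (u i)" for i
      unfolding u_def by (intro exp_growth_sum exp_growth_mult exp_growth_const growth) auto
  qed (use l N in auto)
  then obtain pp where pp: "\<And>l. l < m \<Longrightarrow> pp l < length blocks"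
    "\<And>l. l < m \<Longrightarrow> log_block h (\<mu>_exponent (snd (blocks ! pp l))) (fst (blocks ! pp l)) (u l)"
    by metis
  define L where "L \<tau> = 2 * of_real pi * \<i> * \<tau> / of_real h" for \<tau>
  define e where "e p \<tau> = exp (of_real (\<mu>_exponent (snd (blocks ! p))) * L \<tau>)" for p \<tau>
  have "\<exists>\<psi>. (\<forall>j. q_merom h (\<psi> j)) \<and> (\<forall>\<tau>\<in>upper_half_plane. u l \<tau> =
      (\<Sum>j<fst (blocks ! pp l). L \<tau> ^ j * e (pp l) \<tau> * \<psi> j \<tau>))" if "l < m" for l
    using log_block_powers[OF h pp(2)[OF that]] unfolding L_def e_def .
  then obtain \<psi> where \<psi>: "\<And>l j. l < m \<Longrightarrow> q_merom h (\<psi> l j)"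
    "\<And>l \<tau>. l < m \<Longrightarrow> \<tau> \<in> upper_half_plane \<Longrightarrow>
      u l \<tau> = (\<Sum>j<fst (blocks ! pp l). L \<tau> ^ j * e (pp l) \<tau> * \<psi> l j \<tau>)"
    by metis
  \<comment> \<open>The total coefficient, in component i, of the j-th power of log q that comes
    from block p; it is 0 if no coordinate was assigned to p.\<close>
  define \<Phi> where "\<Phi> i p j \<tau> = (\<Sum>l\<in>{l. l < m \<and> pp l = p}. S $$ (i, l) * \<psi> l j \<tau>)" for i p j \<tau>
  have "q_merom h (\<Phi> i p j)" for i p j
    unfolding \<Phi>_def by (intro q_merom_sum q_merom_cmult \<psi>) auto
  then have "\<exists>M0 a. \<forall>M\<ge>M0. \<forall>\<tau>\<in>upper_half_plane.
      ((\<lambda>n. a n * qexp h \<tau> powi n) has_sum \<Phi> i p j \<tau>) {- int M..}" for i p j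
    by (rule q_merom_series[OF h])
  then obtain M0 a where a: "\<And>i p j M \<tau>. M \<ge> M0 i p j \<Longrightarrow> \<tau> \<in> upper_half_plane \<Longrightarrow>
      ((\<lambda>n. a i p j n * qexp h \<tau> powi n) has_sum \<Phi> i p j \<tau>) {- int M..}"
    by metis
  \<comment> \<open>The sum is a convenient upper bound for the finitely many pole orders.\<close>
  define M where "M = (\<Sum>i<m. \<Sum>p<length blocks. \<Sum>j<fst (blocks ! p). M0 i p j)"
  have M: "M0 i p j \<le> M" if "i < m" "p < length blocks" "j < fst (blocks ! p)" for i p j
  proof -
    have "M0 i p j \<le> (\<Sum>j<fst (blocks ! p). M0 i p j)" using that by (intro member_le_sum) auto
    also have "\<dots> \<le> (\<Sum>p<length blocks. \<Sum>j<fst (blocks ! p). M0 i p j)"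
      using that by (intro member_le_sum[of p _ "\<lambda>p. \<Sum>j<fst (blocks ! p). M0 i p j"]) auto
    also have "\<dots> \<le> M"
      unfolding M_def using that
      by (intro member_le_sum[of i _ "\<lambda>i. \<Sum>p<length blocks. \<Sum>j<fst (blocks ! p). M0 i p j"]) auto
    finally show ?thesis .
  qed
  define x where "x p j n = Matrix.vec m (\<lambda>i. a i p j n)" for p j n
  have x: "((\<lambda>n. (x p j n $v i) * qexp h \<tau> powi n) has_sum \<Phi> i p j \<tau>) {- int M..}"
    if "i < m" "p < length blocks" "j < fst (blocks ! p)" "\<tau> \<in> upper_half_plane" for i p j \<tau>
    using a[OF M that(4), of i p j] that by (simp add: x_def)
  have g_eq: "g i \<tau> = (\<Sum>p<length blocks. \<Sum>j<fst (blocks ! p). L \<tau> ^ j * e p \<tau> * \<Phi> i p j \<tau>)"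
    if i: "i < m" and \<tau>: "\<tau> \<in> upper_half_plane" for i \<tau>
  proof -
    have "S *\<^sub>v (Q *\<^sub>v gv \<tau>) = gv \<tau>"
      using carr gv SQ by (simp flip: assoc_mult_mat_vec[of S m m Q m])
    then have "gv \<tau> $v i = (S *\<^sub>v Matrix.vec m (\<lambda>l. u l \<tau>)) $v i"
      by (simp only: u_vec)
    then have "g i \<tau> = (S *\<^sub>v Matrix.vec m (\<lambda>l. u l \<tau>)) $v i"
      using i by (simp only: gv_def index_vec)
    also have "\<dots> = (\<Sum>l<m. S $$ (i, l) * u l \<tau>)"
      by (rule mult_mat_vec_entry[OF carr(2) i])
    also have "\<dots> = (\<Sum>l<m. \<Sum>j<fst (blocks ! pp l). L \<tau> ^ j * e (pp l) \<tau> * (S $$ (i, l) * \<psi> l j \<tau>))"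
      using \<tau> by (intro sum.cong refl) (simp add: \<psi>(2) sum_distrib_left mult_ac)
    also have "\<dots> = (\<Sum>p<length blocks. \<Sum>l\<in>{l. l \<in> {..<m} \<and> pp l = p}.
        \<Sum>j<fst (blocks ! pp l). L \<tau> ^ j * e (pp l) \<tau> * (S $$ (i, l) * \<psi> l j \<tau>))"
      using pp(1) by (intro sum.group[symmetric]) auto
    also have "\<dots> = (\<Sum>p<length blocks. \<Sum>l\<in>{l. l < m \<and> pp l = p}.
        \<Sum>j<fst (blocks ! p). L \<tau> ^ j * e p \<tau> * (S $$ (i, l) * \<psi> l j \<tau>))"
      by (intro sum.cong refl) auto
    also have "\<dots> = (\<Sum>p<length blocks. \<Sum>j<fst (blocks ! p). \<Sum>l\<in>{l. l < m \<and> pp l = p}.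
        L \<tau> ^ j * e p \<tau> * (S $$ (i, l) * \<psi> l j \<tau>))"
      by (intro sum.cong refl sum.swap)
    finally show ?thesis by (simp add: \<Phi>_def sum_distrib_left)
  qed
  show ?thesis
  proof (intro exI[of _ blocks] exI[of _ "int M"] exI[of _ x] conjI ballI allI impI jnf)
    show "x p j n \<in> carrier_vec m" for p j n by (simp add: x_def)
    fix \<tau> i assume \<tau>: "\<tau> \<in> upper_half_plane" and i: "i < m"
    show "(\<lambda>n. (x p j n $v i) * qexp h \<tau> powi n) summable_on {- int M..}"
      if "p < length blocks" "j < fst (blocks ! p)" for p j
      using x[OF i that \<tau>] by (rule has_sum_imp_summable)
    show "g i \<tau> = (\<Sum>p<length blocks. \<Sum>j<fst (blocks ! p).
        (2 * of_real pi * \<i> * \<tau> / of_real h) ^ j *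
        exp (of_real (\<mu>_exponent (snd (blocks ! p))) * (2 * of_real pi * \<i> * \<tau> / of_real h)) *
        (\<Sum>\<^sub>\<infinity>n\<in>{- int M..}. (x p j n $v i) * qexp h \<tau> powi n))"
      unfolding g_eq[OF i \<tau>] L_def[symmetric] e_def[symmetric]
      using infsumI[OF x[OF i _ _ \<tau>]] by (intro sum.cong refl) auto
  qed
qed

section \<open>Cusps and their widths\<close>

abbreviation transl :: "real \<Rightarrow> mat2" where "transl x \<equiv> mk2 1 x 0 1"

lemma transl_carrier [simp]: "transl x \<in> carrier SL2R"
  by (simp add: SL2R_carrier)

lemma transl_mult: "transl x ** transl y = transl (x + y)"
  by (simp add: mat2_eq_iff mat2_mult_entry)

lemma transl_0 [simp]: "transl 0 = I2"
  by (simp add: mat2_eq_iff)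

lemma inv2_transl: "inv2 (transl x) = transl (- x)"
  by (simp add: mat2_eq_iff)

text \<open>Conjugated translations grow only linearly. This yields discreteness of the translations
  at a cusp and, later, the bound on eigenvalues.\<close>

lemma mnorm_conj_transl:
  "mnorm (B ** transl x ** inv2 B) \<le> mnorm B * (2 + \<bar>x\<bar>) * mnorm B"
proof -
  have "mnorm (B ** transl x ** inv2 B) \<le> mnorm (B ** transl x) * mnorm (inv2 B)" by (rule mnorm_mult)
  also have "\<dots> \<le> (mnorm B * mnorm (transl x)) * mnorm B"
    unfolding mnorm_inv2 by (intro mult_right_mono mnorm_mult) simp
  finally show ?thesis by (simp add: mnorm_def[of "transl x"])
qed

text \<open>For a finite cusp the matrix \<open>B\<close> is \<open>-A\<^sub>c\<close> rather than \<open>A\<^sub>c\<close>: with this sign the factor \<open>\<epsilon>\<^sub>c\<close>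
  becomes a power of the automorphy factor of \<open>B\<close>.\<close>

definition cusp_frame :: "boundary_point \<Rightarrow> mat2 \<Rightarrow> bool" where
  "cusp_frame c B \<longleftrightarrow> B \<in> carrier SL2R \<and>
     (\<forall>h. cusp_translation c h = B ** transl h ** inv2 B) \<and>
     (\<forall>\<tau>. moebius (matrix_inv (cusp_mat c)) \<tau> = moebius (inv2 B) \<tau>) \<and>
     (\<forall>k. \<forall>\<tau>\<in>upper_half_plane. cusp_factor k c (moebius B \<tau>) = (1 / autom B \<tau>) powr (- of_real k)) \<and>
     (\<forall>A\<in>carrier SL2R. moebius_bd A c = c \<longleftrightarrow> (inv2 B ** A ** B) $ 2 $ 1 = 0)"

lemma cusp_frameD:
  assumes "cusp_frame c B"
  shows "B \<in> carrier SL2R"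
    "\<And>h. cusp_translation c h = B ** transl h ** inv2 B"
    "\<And>\<tau>. moebius (matrix_inv (cusp_mat c)) \<tau> = moebius (inv2 B) \<tau>"
    "\<And>k \<tau>. \<tau> \<in> upper_half_plane \<Longrightarrow> cusp_factor k c (moebius B \<tau>) = (1 / autom B \<tau>) powr (- of_real k)"
    "\<And>A. A \<in> carrier SL2R \<Longrightarrow> moebius_bd A c = c \<longleftrightarrow> (inv2 B ** A ** B) $ 2 $ 1 = 0"
  using assms unfolding cusp_frame_def by blast+

lemma cusp_frame_exists: "\<exists>B. cusp_frame c B"
proof (cases c)
  case (Fin x)
  define B where "B = mk2 (- x) 1 (- 1) 0"
  have C: "cusp_mat c = - B" by (simp add: Fin B_def mat2_eq_iff)
  have B: "B \<in> carrier SL2R" by (simp add: B_def SL2R_carrier)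
  have inv: "matrix_inv (cusp_mat c) = - inv2 B"
    unfolding C using B by (subst matrix_inv_SL2R) (auto simp: mat2_eq_iff)
  show ?thesis
    unfolding cusp_frame_def
  proof (intro exI[of _ B] conjI allI ballI B)
    show "cusp_translation c h = B ** transl h ** inv2 B" for h
      unfolding cusp_translation_def inv unfolding C by (simp add: mat2_mult_minus)
    show "moebius (matrix_inv (cusp_mat c)) \<tau> = moebius (inv2 B) \<tau>" for \<tau>
      unfolding inv by simp
    show "cusp_factor k c (moebius B \<tau>) = (1 / autom B \<tau>) powr (- of_real k)"
      if "\<tau> \<in> upper_half_plane" for k \<tau>
    proof -
      have "\<tau> \<noteq> 0" using that by (auto simp: upper_half_plane_def)
      \<comment> \<open>Here the sign of B matters: B\<tau> = x - 1/\<tau>, while the automorphy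
        factor of B at \<tau> is -\<tau>.\<close>
      then have "moebius B \<tau> - of_real x = 1 / autom B \<tau>"
        by (simp add: moebius_def B_def field_simps)
      then show ?thesis by (simp add: Fin)
    qed
    show "moebius_bd A c = c \<longleftrightarrow> (inv2 B ** A ** B) $ 2 $ 1 = 0" if A: "A \<in> carrier SL2R" for A
    proof -
      let ?p = "A $ 1 $ 1 * x + A $ 1 $ 2" and ?q = "A $ 2 $ 1 * x + A $ 2 $ 2"
      have e: "(inv2 B ** A ** B) $ 2 $ 1 = x * ?q - ?p"
        by (simp add: mat2_mult_entry B_def algebra_simps)
      have "?p \<noteq> 0" if "?q = 0"
      proof
        assume "?p = 0"
        have "A $ 1 $ 1 * ?q - A $ 2 $ 1 * ?p = A $ 1 $ 1 * A $ 2 $ 2 - A $ 1 $ 2 * A $ 2 $ 1"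
          by (simp add: algebra_simps)
        with \<open>?p = 0\<close> \<open>?q = 0\<close> A show False by (simp add: SL2R_carrier)
      qed
      then show ?thesis unfolding e by (cases "?q = 0") (auto simp: Fin divide_eq_eq)
    qed
  qed
next
  case Infty
  have inv: "matrix_inv I2 = I2" by (subst matrix_inv_SL2R) (auto simp: mat2_eq_iff)
  have inv': "inv2 I2 = I2" by (simp add: mat2_eq_iff)
  show ?thesis
    unfolding cusp_frame_def
    by (intro exI[of _ I2]) (auto simp: Infty cusp_translation_def inv inv' moebius_def)
qed

lemma finite_mnorm_le:
  assumes "subgroup G SL2R" "isolated_identity G"
  shows "finite {A \<in> G. mnorm A \<le> R}"
proof -
  obtain n :: nat where n: "max 1 R \<le> real n" using real_arch_simple by blast
  then have "finite {A \<in> G. mnorm A \<le> real n}" using mnorm_count[OF assms] by auto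
  then show ?thesis by (rule rev_finite_subset) (use n in auto)
qed

section \<open>The stabilizer of a cusp as a cyclic subgroup of PSL(2,R)\<close>

lemma group_PSL2R: "Group.group PSL2R"
proof -
  interpret SL: Group.group SL2R by (rule group_SL2R)
  have "subgroup {I2, - I2} SL2R"
  proof (rule SL.subgroupI)
    have "inv2 I2 = I2" "inv2 (- I2) = - I2" by (simp_all add: mat2_eq_iff)
    then show "inv\<^bsub>SL2R\<^esub> a \<in> {I2, - I2}" if "a \<in> {I2, - I2}" for a
      using that inv_SL2R[of a] by auto
  qed (auto simp: mat2_mult_minus)
  then have "{I2, - I2} \<lhd> SL2R"
    by (rule SL.normal_invI) (auto simp: mat2_mult_minus inv_SL2R inv2_mult)
  then show ?thesis unfolding PSL2R_def by (rule normal.factorgroup_is_group)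
qed

lemma to_PSL_mult: "to_PSL A \<otimes>\<^bsub>PSL2R\<^esub> to_PSL B = to_PSL (A ** B)"
  by (auto simp: PSL2R_def FactGroup_def set_mult_def to_PSL_eq mat2_mult_minus)

lemma to_PSL_one: "\<one>\<^bsub>PSL2R\<^esub> = to_PSL I2"
  by (simp add: PSL2R_def FactGroup_def to_PSL_eq)

lemma to_PSL_carrier: "A \<in> carrier SL2R \<Longrightarrow> to_PSL A \<in> carrier PSL2R"
  by (auto simp: PSL2R_def FactGroup_def RCOSETS_def to_PSL_def)

text \<open>Formulated for any one-parameter group \<open>T\<close>, so that it applies directly to
  the conjugated translations at a cusp.\<close>

lemma generate_translations:
  assumes T: "\<And>x y. T x ** T y = T (x + y :: real)" "T 0 = I2" "\<And>x. T x \<in> carrier SL2R"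
  shows "generate PSL2R {to_PSL (T h)} = range (\<lambda>n :: int. to_PSL (T (of_int n * h)))"
proof
  interpret Group.group PSL2R by (rule group_PSL2R)
  have inv: "inv\<^bsub>PSL2R\<^esub> to_PSL (T h) = to_PSL (T (- h))"
    by (rule inv_equality) (auto simp: to_PSL_mult to_PSL_one T to_PSL_carrier)
  show "generate PSL2R {to_PSL (T h)} \<subseteq> range (\<lambda>n :: int. to_PSL (T (of_int n * h)))"
  proof
    fix X assume "X \<in> generate PSL2R {to_PSL (T h)}"
    then show "X \<in> range (\<lambda>n :: int. to_PSL (T (of_int n * h)))"
    proof induction
      case one
      show ?case by (rule range_eqI[of _ _ 0]) (simp add: to_PSL_one T)
    next
      case (incl X)
      then show ?case by (intro range_eqI[of _ _ 1]) simp
    next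
      case (inv X)
      then show ?case using \<open>inv\<^bsub>PSL2R\<^esub> to_PSL (T h) = _\<close> by (intro range_eqI[of _ _ "-1"]) simp
    next
      case (eng X Y)
      then obtain n m :: int where "X = to_PSL (T (of_int n * h))" "Y = to_PSL (T (of_int m * h))" by auto
      then show ?case by (intro range_eqI[of _ _ "n + m"]) (simp add: to_PSL_mult T distrib_right)
    qed
  qed
  have nat: "to_PSL (T (of_nat n * h)) \<in> generate PSL2R {to_PSL (T h)} \<and>
      to_PSL (T (- (of_nat n * h))) \<in> generate PSL2R {to_PSL (T h)}" for n
  proof (induction n)
    case 0
    show ?case using generate.one[of PSL2R "{to_PSL (T h)}"] by (simp add: to_PSL_one T)
  next
    case (Suc n)
    have "to_PSL (T h) \<in> generate PSL2R {to_PSL (T h)}" "to_PSL (T (- h)) \<in> generate PSL2R {to_PSL (T h)}"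
      using generate.incl[of "to_PSL (T h)" "{to_PSL (T h)}" PSL2R]
        generate.inv[of "to_PSL (T h)" "{to_PSL (T h)}" PSL2R] inv by auto
    with Suc generate.eng[of _ PSL2R "{to_PSL (T h)}"]
    have "to_PSL (T h) \<otimes>\<^bsub>PSL2R\<^esub> to_PSL (T (of_nat n * h)) \<in> generate PSL2R {to_PSL (T h)}"
      "to_PSL (T (- h)) \<otimes>\<^bsub>PSL2R\<^esub> to_PSL (T (- (of_nat n * h))) \<in> generate PSL2R {to_PSL (T h)}"
      by blast+
    then show ?case by (simp add: to_PSL_mult T algebra_simps)
  qed
  show "range (\<lambda>n :: int. to_PSL (T (of_int n * h))) \<subseteq> generate PSL2R {to_PSL (T h)}"
  proof
    fix X assume "X \<in> range (\<lambda>n :: int. to_PSL (T (of_int n * h)))"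
    then obtain n :: int where X: "X = to_PSL (T (of_int n * h))" by auto
    show "X \<in> generate PSL2R {to_PSL (T h)}"
      using nat[of "nat \<bar>n\<bar>"] unfolding X by (cases "n \<ge> 0") auto
  qed
qed

text \<open>The generator is the least positive element, which exists because bounded parts are
  finite; division with remainder leaves no element between consecutive multiples.\<close>

lemma discrete_subgroup_real:
  fixes U :: "real set"
  assumes add: "\<And>x y. x \<in> U \<Longrightarrow> y \<in> U \<Longrightarrow> x + y \<in> U" and minus: "\<And>x. x \<in> U \<Longrightarrow> - x \<in> U"
    and fin: "\<And>R. finite {x \<in> U. \<bar>x\<bar> \<le> R}" and x0: "x0 \<in> U" "x0 \<noteq> 0"
  obtains h where "h > 0" "U = range (\<lambda>n :: int. of_int n * h)"
proof -
  define V where "V = {x \<in> U. 0 < x \<and> x \<le> \<bar>x0\<bar>}"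
  have finV: "finite V" by (rule rev_finite_subset[OF fin[of "\<bar>x0\<bar>"]]) (auto simp: V_def)
  have "\<bar>x0\<bar> \<in> V" using x0 minus[of x0] by (auto simp: V_def abs_if)
  then have ne: "V \<noteq> {}" by auto
  define h where "h = Min V"
  have hV: "h \<in> V" unfolding h_def by (rule Min_in[OF finV ne])
  have zero: "0 \<in> U" using add[OF x0(1) minus[OF x0(1)]] by simp
  have nat: "of_nat n * h \<in> U" for n
    by (induction n) (use zero hV add in \<open>auto simp: V_def distrib_right add.commute\<close>)
  have int: "of_int n * h \<in> U" for n :: int
    using nat[of "nat \<bar>n\<bar>"] minus[OF nat[of "nat \<bar>n\<bar>"]] by (cases "n \<ge> 0") auto
  have "x \<in> range (\<lambda>n :: int. of_int n * h)" if x: "x \<in> U" for x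
  proof -
    define n where "n = \<lfloor>x / h\<rfloor>"
    have h: "h > 0" using hV by (simp add: V_def)
    have "of_int n \<le> x / h" "x / h < of_int n + 1" unfolding n_def by linarith+
    then have b: "0 \<le> x - of_int n * h" "x - of_int n * h < h" using h by (simp_all add: field_simps)
    have U: "x - of_int n * h \<in> U" using add[OF x minus[OF int[of n]]] by simp
    have "x - of_int n * h = 0"
    proof (rule ccontr)
      assume "x - of_int n * h \<noteq> 0"
      then have "x - of_int n * h \<in> V" using b U hV by (auto simp: V_def)
      then have "h \<le> x - of_int n * h" unfolding h_def by (rule Min_le[OF finV])
      with b show False by simp
    qed
    then show ?thesis by (intro range_eqI[of _ _ n]) simp
  qed
  with int have "U = range (\<lambda>n :: int. of_int n * h)" by auto
  with hV show thesis by (intro that[of h]) (auto simp: V_def)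
qed

text \<open>Conjugation by B makes the stabilizer upper triangular. An element with diagonal entry a
  scales the group U of translation lengths by a^2. As U is discrete and nontrivial, neither a^2 nor
  its inverse can be a contraction, so a is 1 or -1 and the stabilizer consists of translations up
  to sign. Its positive generator is unique, so the definite description in
  \<open>cusp_width\<close> denotes it.\<close>

lemma cusp_width_props:
  assumes G: "subgroup G SL2R" and iso: "isolated_identity G" and mG: "- I2 \<in> G" and cusp: "is_cusp G c"
  shows "cusp_width G c > 0" "\<And>n :: int. cusp_translation c (of_int n * cusp_width G c) \<in> G"
    "\<And>A. A \<in> G \<Longrightarrow> moebius_bd A c = c \<Longrightarrow>
      \<exists>n :: int. A = cusp_translation c (of_int n * cusp_width G c) \<or>
        A = - cusp_translation c (of_int n * cusp_width G c)"
proof -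
  obtain B where "cusp_frame c B" using cusp_frame_exists by blast
  note B = cusp_frameD(1,2,5)[OF this]
  note [simp] = inv2_cancel[OF B(1)] inv2_mult[OF B(1)]
  have GS: "A \<in> carrier SL2R" if "A \<in> G" for A using subgroup_SL2R_subset[OF G] that by auto
  have minusG: "- A \<in> G \<longleftrightarrow> A \<in> G" for A
  proof -
    have "- A \<in> G" if "A \<in> G" for A
      using subgroup_SL2R_mult[OF G mG that] by (simp add: mat2_mult_minus)
    from this[of A] this[of "- A"] show ?thesis by auto
  qed
  let ?T = "cusp_translation c"
  have T_carrier: "?T x \<in> carrier SL2R" for x by (simp add: B)
  have T_add: "?T x ** ?T y = ?T (x + y)" for x y
  proof -
    have "?T x ** ?T y = B ** transl x ** (inv2 B ** (B ** (transl y ** inv2 B)))"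
      by (simp add: B(2) matrix_mul_assoc)
    then show ?thesis by (simp add: B(2) matrix_mul_assoc flip: transl_mult)
  qed
  have T_0: "?T 0 = I2" by (simp add: B)
  have T_inj: "x = y" if "?T x = ?T y \<or> ?T x = - ?T y" for x y
  proof -
    have conj: "inv2 B ** ?T x ** B = transl x" for x
      unfolding B(2) by (simp flip: matrix_mul_assoc)
    have "transl x = transl y \<or> transl x = - transl y"
      using that conj[of x] conj[of y] by (auto simp: mat2_mult_minus)
    then show ?thesis by (auto simp: mat2_eq_iff)
  qed
  define U where "U = {x. ?T x \<in> G}"
  have U_add: "x + y \<in> U" if "x \<in> U" "y \<in> U" for x y
    using subgroup_SL2R_mult[OF G, of "?T x" "?T y"] that by (simp add: U_def T_add)
  have U_minus: "- x \<in> U" if "x \<in> U" for x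
  proof -
    have "inv2 (?T x) = ?T (- x)" by (simp add: B(2) inv2_mult_distrib inv2_transl matrix_mul_assoc)
    then show ?thesis using subgroup_SL2R_inv2[OF G, of "?T x"] that by (simp add: U_def)
  qed
  have U_fin: "finite {x \<in> U. \<bar>x\<bar> \<le> R}" for R
  proof (rule inj_on_finite[of ?T _ "{A \<in> G. mnorm A \<le> mnorm B * (2 + R) * mnorm B}"])
    show "inj_on ?T {x \<in> U. \<bar>x\<bar> \<le> R}" using T_inj by (intro inj_onI) blast
    show "?T ` {x \<in> U. \<bar>x\<bar> \<le> R} \<subseteq> {A \<in> G. mnorm A \<le> mnorm B * (2 + R) * mnorm B}"
    proof clarify
      fix x assume x: "x \<in> U" "\<bar>x\<bar> \<le> R"
      have "mnorm (?T x) \<le> mnorm B * (2 + \<bar>x\<bar>) * mnorm B" unfolding B(2) by (rule mnorm_conj_transl)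
      also have "\<dots> \<le> (mnorm B * (2 + R)) * mnorm B"
        using x by (intro mult_right_mono mult_left_mono) auto
      finally show "?T x \<in> G \<and> mnorm (?T x) \<le> mnorm B * (2 + R) * mnorm B" using x by (simp add: U_def)
    qed
    show "finite {A \<in> G. mnorm A \<le> mnorm B * (2 + R) * mnorm B}" by (rule finite_mnorm_le[OF G iso])
  qed
  \<comment> \<open>The numbers r^n x would be infinitely many distinct elements of a bounded part
    of U.\<close>
  have no_contraction: False if r: "0 < r" "r < 1" "\<And>x. x \<in> U \<Longrightarrow> r * x \<in> U" and x: "x \<in> U" "x \<noteq> 0" for r x
  proof -
    have "r ^ n * x \<in> {y \<in> U. \<bar>y\<bar> \<le> \<bar>x\<bar>}" for n
    proof -
      have "r ^ n * x \<in> U" by (induction n) (use r x in \<open>auto simp: mult.assoc\<close>)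
      moreover have "\<bar>r ^ n * x\<bar> \<le> \<bar>x\<bar>"
        using r power_le_one[of r n] by (simp add: abs_mult mult_left_le_one_le)
      ultimately show ?thesis by simp
    qed
    then have "range (\<lambda>n. r ^ n * x) \<subseteq> {y \<in> U. \<bar>y\<bar> \<le> \<bar>x\<bar>}" by auto
    then have "finite (range (\<lambda>n. r ^ n * x))" using U_fin finite_subset by blast
    moreover have "inj (\<lambda>n. r ^ n * x)"
    proof (rule linorder_injI)
      fix m n :: nat assume "m < n"
      then have "r ^ n < r ^ m" using r by (intro power_strict_decreasing) auto
      then show "r ^ m * x \<noteq> r ^ n * x" using x by simp
    qed
    ultimately show False using finite_imageD infinite_UNIV_nat by blast
  qed
  define M where "M A = inv2 B ** A ** B" for A
  have A_M: "A = B ** M A ** inv2 B" for A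
    unfolding M_def by (simp add: matrix_mul_assoc)
  have M_fix: "M A $ 2 $ 1 = 0" "M A $ 1 $ 1 * M A $ 2 $ 2 = 1" if "A \<in> G" "moebius_bd A c = c" for A
  proof -
    show "M A $ 2 $ 1 = 0" using B(3)[OF GS[OF that(1)]] that(2) by (simp add: M_def)
    moreover have "M A \<in> carrier SL2R" using GS[OF that(1)] B(1) by (simp add: M_def)
    ultimately show "M A $ 1 $ 1 * M A $ 2 $ 2 = 1" by (simp add: SL2R_carrier)
  qed
  have M_transl: "\<exists>x. A = ?T x \<or> A = - ?T x"
    if A: "A \<in> G" "moebius_bd A c = c" and a: "M A $ 1 $ 1 = 1 \<or> M A $ 1 $ 1 = - 1" for A
    using a
  proof
    assume "M A $ 1 $ 1 = 1"
    then have "M A = transl (M A $ 1 $ 2)" using M_fix[OF A] by (simp add: mat2_eq_iff)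
    then have "A = ?T (M A $ 1 $ 2)" using A_M[of A] B(2) by metis
    then show ?thesis by blast
  next
    assume "M A $ 1 $ 1 = - 1"
    then have "M A = - transl (- M A $ 1 $ 2)" using M_fix[OF A] by (simp add: mat2_eq_iff)
    then have "A = - ?T (- M A $ 1 $ 2)"
      using A_M[of A] B(2)[of "- M A $ 1 $ 2"] by (metis mat2_mult_minus)
    then show ?thesis by blast
  qed
  obtain x0 where x0: "x0 \<in> U" "x0 \<noteq> 0"
  proof -
    obtain A where A: "A \<in> G" "parabolic A" "A \<noteq> I2" "A \<noteq> - I2" "moebius_bd A c = c"
      using cusp by (auto simp: is_cusp_def)
    let ?a = "M A $ 1 $ 1" and ?d = "M A $ 2 $ 2"
    have "?a + ?d = A $ 1 $ 1 + A $ 2 $ 2"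
    proof -
      have "?a + ?d = (A $ 1 $ 1 + A $ 2 $ 2) * (B $ 1 $ 1 * B $ 2 $ 2 - B $ 1 $ 2 * B $ 2 $ 1)"
        by (simp add: M_def mat2_mult_entry algebra_simps)
      then show ?thesis using B(1) by (simp add: SL2R_carrier)
    qed
    \<comment> \<open>Trace 2 or -2 and product one make the square of the difference of the
      diagonal entries 2^2 - 4 = 0, so both equal 1 or both equal -1.\<close>
    then have tr: "?a + ?d = 2 \<or> ?a + ?d = - 2" using A(2) by (simp add: parabolic_def)
    have ad: "?a * ?d = 1" using M_fix[OF A(1,5)] by simp
    have "(?a - ?d)\<^sup>2 = (?a + ?d)\<^sup>2 - 4 * (?a * ?d)" by (simp add: power2_eq_square algebra_simps)
    then have "?a = ?d" using tr ad by auto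
    then have "?a = 1 \<or> ?a = - 1" using tr by linarith
    then obtain x where x: "A = ?T x \<or> A = - ?T x" using M_transl[OF A(1,5)] by blast
    then have "x \<in> U" using A(1) minusG[of "?T x"] by (auto simp: U_def)
    moreover have "x \<noteq> 0" using x A(3,4) T_0 by auto
    ultimately show thesis by (rule that)
  qed
  \<comment> \<open>Conjugating a translation by a triangular matrix of determinant one multiplies
    its length by the square of the upper left entry.\<close>
  have U_scale: "(M A $ 1 $ 1)\<^sup>2 * x \<in> U" if A: "A \<in> G" "moebius_bd A c = c" and x: "x \<in> U" for A x
  proof -
    have "M A ** transl x ** inv2 (M A) = transl ((M A $ 1 $ 1)\<^sup>2 * x)"
      using M_fix[OF A] by (simp add: mat2_eq_iff mat2_mult_entry power2_eq_square algebra_simps)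
    then have "?T ((M A $ 1 $ 1)\<^sup>2 * x) = B ** (M A ** transl x ** inv2 (M A)) ** inv2 B" by (simp add: B(2))
    also have "\<dots> = (B ** M A ** inv2 B) ** (B ** transl x ** inv2 B) ** (B ** inv2 (M A) ** inv2 B)"
      by (simp flip: matrix_mul_assoc)
    also have "\<dots> = A ** ?T x ** inv2 A"
      unfolding A_M[of A, symmetric] B(2)[symmetric]
      by (subst (3) A_M[of A]) (simp add: inv2_mult_distrib matrix_mul_assoc)
    also have "\<dots> \<in> G"
      using A x by (intro subgroup_SL2R_mult[OF G] subgroup_SL2R_inv2[OF G]) (auto simp: U_def)
    finally show ?thesis by (simp add: U_def)
  qed
  have inv_fix: "moebius_bd (inv2 A) c = c \<and> M (inv2 A) $ 1 $ 1 * M A $ 1 $ 1 = 1"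
    if A: "A \<in> G" "moebius_bd A c = c" for A
  proof -
    have "M (inv2 A) = inv2 (M A)" by (simp add: M_def inv2_mult_distrib matrix_mul_assoc)
    then show ?thesis
      using B(3)[of "inv2 A"] GS[OF A(1)] M_fix[OF A] by (simp add: M_def[symmetric] mult.commute)
  qed
  have stab: "\<exists>x\<in>U. A = ?T x \<or> A = - ?T x" if A: "A \<in> G" "moebius_bd A c = c" for A
  proof -
    define a where "a = M A $ 1 $ 1"
    define a' where "a' = M (inv2 A) $ 1 $ 1"
    have aa': "a' * a = 1" using inv_fix[OF A] by (simp add: a_def a'_def)
    have scale: "a\<^sup>2 * x \<in> U" "a'\<^sup>2 * x \<in> U" if "x \<in> U" for x
      using U_scale[OF A that] U_scale[of "inv2 A" x] inv_fix[OF A] subgroup_SL2R_inv2[OF G A(1)] that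
      by (auto simp: a_def a'_def)
    have nz: "a \<noteq> 0" "a' \<noteq> 0" using aa' by auto
    have 1: "\<not> a\<^sup>2 < 1" using no_contraction[of "a\<^sup>2" x0] x0 nz scale by auto
    have 2: "\<not> a'\<^sup>2 < 1" using no_contraction[of "a'\<^sup>2" x0] x0 nz scale by auto
    have 3: "a'\<^sup>2 * a\<^sup>2 = 1" using aa' by (metis power_mult_distrib power_one)
    have "1 * a\<^sup>2 \<le> a'\<^sup>2 * a\<^sup>2" using 2 by (intro mult_right_mono) auto
    with 1 3 have "a\<^sup>2 = 1" by simp
    then have "a = 1 \<or> a = - 1" by (simp add: power2_eq_1_iff)
    then obtain x where x: "A = ?T x \<or> A = - ?T x" using M_transl[OF A] by (auto simp: a_def)
    then have "x \<in> U" using A(1) minusG[of "?T x"] by (auto simp: U_def)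
    with x show ?thesis by blast
  qed
  obtain h where h: "h > 0" "U = range (\<lambda>n :: int. of_int n * h)"
    using discrete_subgroup_real[of U x0] U_add U_minus U_fin x0 by metis
  have gen: "generate PSL2R {to_PSL (?T k)} = range (\<lambda>n :: int. to_PSL (?T (of_int n * k)))" for k
    by (rule generate_translations[OF T_add T_0 T_carrier])
  have "moebius_bd (?T x) c = c" for x
    using B(3)[OF T_carrier] unfolding B(2) by (simp add: matrix_mul_assoc)
  then have "to_PSL ` {A \<in> G. moebius_bd A c = c} = to_PSL ` ?T ` U"
    using stab by (auto simp: U_def image_iff to_PSL_eq_iff) 
  also have "\<dots> = generate PSL2R {to_PSL (?T h)}"
    unfolding gen h(2) by (simp add: image_image)
  finally have stab_gen: "generate PSL2R {to_PSL (?T h)} = to_PSL ` {A \<in> G. moebius_bd A c = c}" ..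
  have "cusp_width G c = h"
    unfolding cusp_width_def
  proof (rule the_equality)
    show "0 < h \<and> generate PSL2R {to_PSL (?T h)} = to_PSL ` {A \<in> G. moebius_bd A c = c}"
      using h stab_gen by simp
    fix k assume k: "0 < k \<and> generate PSL2R {to_PSL (?T k)} = to_PSL ` {A \<in> G. moebius_bd A c = c}"
    \<comment> \<open>Applied in both directions, this makes two positive generators integral
      multiples of each other and therefore equal.\<close>
    have mult: "\<exists>n :: int. x = of_int n * y"
      if eq: "generate PSL2R {to_PSL (?T x)} = generate PSL2R {to_PSL (?T y)}" for x y
    proof -
      have "to_PSL (?T x) \<in> generate PSL2R {to_PSL (?T y)}"
        unfolding eq[symmetric] by (rule generate.incl) simp
      then obtain n :: int where "to_PSL (?T x) = to_PSL (?T (of_int n * y))"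
        unfolding gen by auto
      then show ?thesis using T_inj unfolding to_PSL_eq_iff by blast
    qed
    have same: "generate PSL2R {to_PSL (?T k)} = generate PSL2R {to_PSL (?T h)}"
      using k stab_gen by simp
    obtain n m :: int where nm: "h = of_int n * k" "k = of_int m * h"
      using mult[OF same] mult[OF same[symmetric]] by blast
    have "0 < n" "0 < m" using nm h(1) k by (smt (verit) mult_nonpos_nonneg of_int_0_less_iff)+
    then have "1 * k \<le> of_int n * k" "1 * h \<le> of_int m * h"
      using h k by (intro mult_right_mono; simp)+
    then have "k \<le> h" "h \<le> k" unfolding mult_1 nm(1)[symmetric] nm(2)[symmetric] by auto
    then show "k = h" by simp
  qed
  then show "cusp_width G c > 0" "\<And>n :: int. ?T (of_int n * cusp_width G c) \<in> G"
    "\<And>A. A \<in> G \<Longrightarrow> moebius_bd A c = c \<Longrightarrow>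
      \<exists>n :: int. A = ?T (of_int n * cusp_width G c) \<or> A = - ?T (of_int n * cusp_width G c)"
    using h stab by (auto simp: U_def set_eq_iff)
qed

lemma cusp_generator_props:
  assumes G: "subgroup G SL2R" and iso: "isolated_identity G" and mG: "- I2 \<in> G" and cusp: "is_cusp G c"
  shows "cusp_generator G c \<in> G" "parabolic (cusp_generator G c)"
proof -
  obtain B where "cusp_frame c B" using cusp_frame_exists by blast
  note B = cusp_frameD(1,2)[OF this]
  show gen: "cusp_generator G c \<in> G"
    using cusp_width_props(2)[OF assms, of 1] by (simp add: cusp_generator_def)
  have "cusp_generator G c $ 1 $ 1 + cusp_generator G c $ 2 $ 2 =
      2 * (B $ 1 $ 1 * B $ 2 $ 2 - B $ 1 $ 2 * B $ 2 $ 1)"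
    by (simp add: cusp_generator_def B(2) mat2_mult_entry algebra_simps)
  then show "parabolic (cusp_generator G c)"
    using B(1) gen subgroup_SL2R_subset[OF G] by (auto simp: parabolic_def SL2R_carrier)
qed

section \<open>Growth of the weight one form at the cusps\<close>

lemma qexp_surj:
  assumes "h > 0" "z \<in> ball 0 1" "z \<noteq> 0"
  obtains \<tau> where "\<tau> \<in> upper_half_plane" "qexp h \<tau> = z"
proof -
  define \<tau> where "\<tau> = of_real h * Ln z / (2 * of_real pi * \<i>)"
  have q: "qexp h \<tau> = z" using assms by (simp add: qexp_def \<tau>_def)
  have "exp (- 2 * pi * Im \<tau> / h) < exp 0" using norm_qexp[of h \<tau>] assms(2) q by simp
  then have "0 < 2 * pi * Im \<tau> / h" by simp
  then have "0 < (2 * pi * Im \<tau> / h) * (h / (2 * pi))" by (rule mult_pos_pos) (use assms in simp)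
  then have "\<tau> \<in> upper_half_plane" using assms by (simp add: upper_half_plane_def)
  then show thesis using q by (rule that)
qed

text \<open>Near 0, \<Phi> is z^N times a function without zeros, whose logarithmic modulus is
  bounded on a smaller closed disc. The two-sided bound controls \<Phi> and its inverse at
  once.\<close>

lemma holomorphic_log_bound:
  assumes \<Phi>: "\<Phi> holomorphic_on ball 0 1" and nz: "\<And>z. z \<in> ball 0 1 \<Longrightarrow> z \<noteq> 0 \<Longrightarrow> \<Phi> z \<noteq> 0"
  obtains N :: nat and r K :: real where "r > 0"
    "\<And>z. norm z < r \<Longrightarrow> z \<noteq> 0 \<Longrightarrow> \<bar>ln (norm (\<Phi> z)) - real N * ln (norm z)\<bar> \<le> K"
proof -
  have "\<exists>g r (n::nat). 0 < r \<and> r \<le> 1 \<and> g holomorphic_on ball 0 r \<and>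
      (\<forall>w\<in>ball 0 r. \<Phi> w = w ^ n * g w \<and> g w \<noteq> 0)"
  proof (cases "\<Phi> 0 = 0")
    case True
    have nc: "\<not> \<Phi> constant_on ball 0 1"
    proof
      assume "\<Phi> constant_on ball 0 1"
      then obtain y where y: "\<And>z. z \<in> ball 0 1 \<Longrightarrow> \<Phi> z = y" by (auto simp: constant_on_def)
      from y[of 0] y[of "1/2"] nz[of "1/2"] True show False by simp
    qed
    obtain g r n where g: "0 < n" "0 < r" "ball 0 r \<subseteq> ball (0::complex) 1" "g holomorphic_on ball 0 r"
      "\<And>w. w \<in> ball 0 r \<Longrightarrow> \<Phi> w = (w - 0) ^ n * g w" "\<And>w. w \<in> ball 0 r \<Longrightarrow> g w \<noteq> 0"
      by (rule holomorphic_factor_zero_nonconstant[OF \<Phi> open_ball connected_ball _ True nc])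
        (simp, rule that)
    then have "r \<le> 1" by (simp add: ball_subset_ball_iff)
    with g show ?thesis by (intro exI[of _ g] exI[of _ r] exI[of _ n]) auto
  next
    case False
    then have "\<Phi> w \<noteq> 0" if "w \<in> ball 0 1" for w using nz that by (cases "w = 0") auto
    then show ?thesis using \<Phi> by - (rule exI[of _ \<Phi>], rule exI[of _ 1], rule exI[of _ 0], auto)
  qed
  then obtain g r n where g: "0 < r" "r \<le> 1" "g holomorphic_on ball 0 r"
    "\<And>w. w \<in> ball 0 r \<Longrightarrow> \<Phi> w = w ^ n * g w" "\<And>w. w \<in> ball 0 r \<Longrightarrow> g w \<noteq> 0"
    by auto
  have sub: "cball (0::complex) (r / 2) \<subseteq> ball 0 r" using g(1) by auto
  have "continuous_on (cball 0 (r / 2)) (\<lambda>z. ln (norm (g z)))"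
    using g(5) sub
    by (intro continuous_intros holomorphic_on_imp_continuous_on holomorphic_on_subset[OF g(3)]) auto
  then have "bounded ((\<lambda>z. ln (norm (g z))) ` cball 0 (r / 2))"
    by (intro compact_imp_bounded compact_continuous_image) auto
  then obtain K where K: "\<forall>w\<in>(\<lambda>z. ln (norm (g z))) ` cball 0 (r / 2). norm w \<le> K"
    unfolding bounded_iff ..
  show thesis
  proof (rule that[of "r / 2" n K])
    fix z :: complex assume z: "norm z < r / 2" "z \<noteq> 0"
    then have zb: "z \<in> ball 0 r" "z \<in> cball 0 (r / 2)" using g(1) by auto
    have "ln (norm (\<Phi> z)) = real n * ln (norm z) + ln (norm (g z))"
      using z g(5)[OF zb(1)] by (simp add: g(4)[OF zb(1)] norm_mult norm_power ln_mult ln_realpow)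
    then show "\<bar>ln (norm (\<Phi> z)) - real n * ln (norm z)\<bar> \<le> K" using K zb(2) by auto
  qed (use g in simp)
qed

text \<open>Only absolute values occur, so the branches of the real power and of L drop out. The
  modulus of d is the w-th root of \<open>X\<close>, which is periodic, and |ln X| is at most linear
  in Im \<tau>. This holds for either sign of w and bounds both d and its inverse.\<close>

lemma Delta_root_growth:
  assumes h: "cusp_width G c > 0" and w: "w \<noteq> 0"
    and frame: "cusp_frame c B"
    and exp: "scalar_expansion G w c \<Delta> \<mu> a"
    and L: "\<And>\<tau>. \<tau> \<in> upper_half_plane \<Longrightarrow> exp (L \<tau>) = \<Delta> \<tau>"
  defines "d \<equiv> \<lambda>\<tau>. exp (L (moebius B \<tau>) / of_real w) / autom B \<tau>"
  shows "\<And>\<tau>. \<tau> \<in> upper_half_plane \<Longrightarrow> norm (d (\<tau> + of_real (cusp_width G c))) = norm (d \<tau>)"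
    and "exp_growth d" "exp_growth (\<lambda>\<tau>. inverse (d \<tau>))"
proof -
  note B = cusp_frameD(1,3,4)[OF frame]
  define h where "h = cusp_width G c"
  have hpos: "h > 0" using h by (simp add: h_def)
  define \<Phi> where "\<Phi> z = (\<Sum>\<^sub>\<infinity>n. a n * z ^ n)" for z
  \<comment> \<open>The modulus of the expansion of \<Delta> without its cusp factor. That factor
    contributes the modulus of the automorphy factor to the power w, whose w-th root is cancelled by
    the denominator of d.\<close>
  define X where "X \<tau> = exp (- 2 * pi * \<mu> * Im \<tau> / h) * norm (\<Phi> (qexp h \<tau>))" for \<tau>
  have logq: "log_q G c (moebius B \<tau>) = 2 * of_real pi * \<i> * \<tau> / of_real h" if "\<tau> \<in> upper_half_plane" for \<tau>
    using that B(1) by (simp add: log_q_def B(2) moebius_inv2 h_def)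
  have q: "q_cusp G c (moebius B \<tau>) = qexp h \<tau>" if "\<tau> \<in> upper_half_plane" for \<tau>
    using that by (simp add: q_cusp_def logq qexp_def)
  have ex: "(\<lambda>n. a n * qexp h \<tau> ^ n) summable_on UNIV"
    "\<Delta> (moebius B \<tau>) = (1 / autom B \<tau>) powr (- of_real w) *
      exp (of_real \<mu> * (2 * of_real pi * \<i> * \<tau> / of_real h)) * \<Phi> (qexp h \<tau>)"
    if \<tau>: "\<tau> \<in> upper_half_plane" for \<tau>
    using exp moebius_upper_half_plane[OF B(1) \<tau>]
    by (auto simp: scalar_expansion_def q[OF \<tau>] logq[OF \<tau>] B(3)[OF \<tau>] \<Phi>_def)
  have nz: "\<Phi> (qexp h \<tau>) \<noteq> 0" if \<tau>: "\<tau> \<in> upper_half_plane" for \<tau>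
    using ex(2)[OF \<tau>] L[OF moebius_upper_half_plane[OF B(1) \<tau>]] by (metis exp_not_eq_zero mult_zero_right)
  have \<Phi>_nz: "\<Phi> z \<noteq> 0" if z: "z \<in> ball 0 1" "z \<noteq> 0" for z
  proof -
    obtain \<tau> where "\<tau> \<in> upper_half_plane" "qexp h \<tau> = z" using qexp_surj[OF hpos z] .
    then show ?thesis using nz by blast
  qed
  have \<Phi>_hol: "\<Phi> holomorphic_on ball 0 1"
  proof (rule power_series_holomorphic)
    fix z :: complex assume z: "z \<in> ball 0 1"
    have "(\<lambda>n. a n * z ^ n) summable_on UNIV"
    proof (cases "z = 0")
      case True
      have "(\<lambda>n. a n * z ^ n) summable_on {0} \<longleftrightarrow> (\<lambda>n. a n * z ^ n) summable_on UNIV"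
        by (rule summable_on_cong_neutral) (auto simp: True)
      then show ?thesis by simp
    next
      case False
      obtain \<tau> where "\<tau> \<in> upper_half_plane" "qexp h \<tau> = z" using qexp_surj[OF hpos z False] .
      then show ?thesis using ex(1) by blast
    qed
    then have "((\<lambda>n. a n * z ^ n) has_sum \<Phi> z) UNIV" unfolding \<Phi>_def by (rule has_sum_infsum)
    then show "(\<lambda>n. a n * (z - 0) ^ n) sums \<Phi> z" using has_sum_imp_sums by fastforce
  qed
  have Xpos: "X \<tau> > 0" if "\<tau> \<in> upper_half_plane" for \<tau>
    using nz[OF that] by (simp add: X_def)
  have d: "norm (d \<tau>) = exp (ln (X \<tau>) / w)" if \<tau>: "\<tau> \<in> upper_half_plane" for \<tau>
  proof -
    let ?J = "norm (autom B \<tau>)"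
    have J: "?J > 0" using autom_nonzero[OF B(1) \<tau>] by simp
    have "exp (Re (L (moebius B \<tau>))) = norm (\<Delta> (moebius B \<tau>))"
      using L[OF moebius_upper_half_plane[OF B(1) \<tau>]] by (metis norm_exp_eq_Re)
    also have "\<dots> = norm ((1 / autom B \<tau>) powr (of_real (- w))) *
        norm (exp (of_real \<mu> * (2 * of_real pi * \<i> * \<tau> / of_real h))) * norm (\<Phi> (qexp h \<tau>))"
      unfolding ex(2)[OF \<tau>] norm_mult by simp
    also have "norm ((1 / autom B \<tau>) powr (of_real (- w))) = ?J powr w"
      using J by (subst norm_powr_real_powr') (auto simp: norm_divide powr_minus powr_divide)
    also have "norm (exp (of_real \<mu> * (2 * of_real pi * \<i> * \<tau> / of_real h))) = exp (- 2 * pi * \<mu> * Im \<tau> / h)"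
      by (simp add: mult.commute mult.left_commute)
    finally have "exp (Re (L (moebius B \<tau>))) = ?J powr w * X \<tau>" by (simp add: X_def)
    then have "ln (exp (Re (L (moebius B \<tau>)))) = ln (?J powr w * X \<tau>)" by (simp only:)
    then have Re_L: "Re (L (moebius B \<tau>)) = w * ln ?J + ln (X \<tau>)"
      using J Xpos[OF \<tau>] by (simp add: ln_mult ln_powr)
    have "norm (d \<tau>) = exp (Re (L (moebius B \<tau>)) / w) / ?J"
      by (simp add: d_def norm_divide)
    also have "\<dots> = exp (ln ?J + ln (X \<tau>) / w) / ?J"
      using w by (simp add: Re_L add_divide_distrib)
    also have "\<dots> = exp (ln (X \<tau>) / w)" using J by (simp add: exp_add)
    finally show ?thesis .
  qed
  show "norm (d (\<tau> + of_real (cusp_width G c))) = norm (d \<tau>)" if \<tau>: "\<tau> \<in> upper_half_plane" for \<tau>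
    using hpos by (simp add: d shift_uhp \<tau> X_def qexp_periodic flip: h_def)
  obtain N :: nat and r K :: real where NrK: "r > 0"
    "\<And>z. norm z < r \<Longrightarrow> z \<noteq> 0 \<Longrightarrow> \<bar>ln (norm (\<Phi> z)) - real N * ln (norm z)\<bar> \<le> K"
    using holomorphic_log_bound[OF \<Phi>_hol \<Phi>_nz] by metis
  define C where "C = \<bar>2 * pi * \<mu> / h + 2 * pi * real N / h\<bar> + \<bar>K\<bar>"
  \<comment> \<open>Above this height |q| < r, so the bound on \<Phi> applies, and Im \<tau> \<ge>
    1, so the constant \<open>K\<close> is absorbed into a multiple of Im \<tau>.\<close>
  define Y where "Y = max 1 (- h * ln r / (2 * pi) + 1)"
  have lnX: "\<bar>ln (X \<tau>)\<bar> \<le> C * Im \<tau>" if \<tau>: "Im \<tau> \<ge> Y" for \<tau>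
  proof -
    have y1: "Im \<tau> \<ge> 1" "- h * ln r / (2 * pi) < Im \<tau>" using \<tau> by (auto simp: Y_def)
    then have \<tau>u: "\<tau> \<in> upper_half_plane" by (simp add: upper_half_plane_def)
    have ln_q: "ln (norm (qexp h \<tau>)) = - 2 * pi * Im \<tau> / h" by (simp add: norm_qexp)
    have two_pi: "0 < 2 * pi" by simp
    have "- h * ln r < Im \<tau> * (2 * pi)" using y1(2) unfolding pos_divide_less_eq[OF two_pi] .
    then have "- 2 * pi * Im \<tau> / h < ln r" using hpos by (simp add: field_simps)
    then have "norm (qexp h \<tau>) < r"
      unfolding norm_qexp using NrK(1) by (metis exp_less_mono exp_ln)
    then have "\<bar>ln (norm (\<Phi> (qexp h \<tau>))) - real N * ln (norm (qexp h \<tau>))\<bar> \<le> K"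
      using NrK(2) by simp
    then have 1: "\<bar>ln (norm (\<Phi> (qexp h \<tau>))) + (2 * pi * real N / h) * Im \<tau>\<bar> \<le> \<bar>K\<bar>"
      unfolding ln_q by (simp add: mult_ac)
    have lnX: "ln (X \<tau>) = - ((2 * pi * \<mu> / h) * Im \<tau>) + ln (norm (\<Phi> (qexp h \<tau>)))"
      using nz[OF \<tau>u] by (simp add: X_def ln_mult)
    have "\<bar>ln (X \<tau>)\<bar> \<le> \<bar>(2 * pi * \<mu> / h + 2 * pi * real N / h) * Im \<tau>\<bar> + \<bar>K\<bar>"
    proof -
      have "\<bar>- p + l\<bar> \<le> \<bar>p + q\<bar> + k" if "\<bar>l + q\<bar> \<le> k" for p q l k :: real
        using that by linarith
      then show ?thesis using 1 unfolding lnX distrib_right by blast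
    qed
    also have "\<dots> \<le> \<bar>2 * pi * \<mu> / h + 2 * pi * real N / h\<bar> * Im \<tau> + \<bar>K\<bar> * Im \<tau>"
      unfolding abs_mult using y1(1) mult_left_mono[OF y1(1), of "\<bar>K\<bar>"] by (intro add_mono) auto
    finally show ?thesis by (simp add: C_def distrib_right)
  qed
  have bound: "\<bar>ln (X \<tau>) / w\<bar> \<le> (C / \<bar>w\<bar>) * Im \<tau>" if "Im \<tau> \<ge> Y" for \<tau>
  proof -
    have "\<bar>ln (X \<tau>)\<bar> / \<bar>w\<bar> \<le> C * Im \<tau> / \<bar>w\<bar>"
      by (intro divide_right_mono lnX[OF that]) simp
    then show ?thesis by (simp only: abs_divide times_divide_eq_left)
  qed
  have uhp: "\<tau> \<in> upper_half_plane" if "Im \<tau> \<ge> Y" for \<tau>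
    using that by (simp add: upper_half_plane_def Y_def)
  show "exp_growth d"
  proof (rule exp_growthI, rule exI[of _ "C / \<bar>w\<bar>"], rule exI[of _ Y], intro allI impI)
    fix \<tau> assume \<tau>: "Y \<le> Im \<tau>"
    show "norm (d \<tau>) \<le> exp (C / \<bar>w\<bar> * Im \<tau>)"
      unfolding d[OF uhp[OF \<tau>]] exp_le_cancel_iff by (rule abs_le_D1[OF bound[OF \<tau>]])
  qed
  show "exp_growth (\<lambda>\<tau>. inverse (d \<tau>))"
  proof (rule exp_growthI, rule exI[of _ "C / \<bar>w\<bar>"], rule exI[of _ Y], intro allI impI)
    fix \<tau> assume \<tau>: "Y \<le> Im \<tau>"
    show "norm (inverse (d \<tau>)) \<le> exp (C / \<bar>w\<bar> * Im \<tau>)"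
      unfolding norm_inverse d[OF uhp[OF \<tau>]] exp_minus[symmetric] exp_le_cancel_iff
      by (rule abs_le_D2[OF bound[OF \<tau>]])
  qed
qed

lemma exp_growth_power_int:
  assumes "exp_growth d" "exp_growth (\<lambda>\<tau>. inverse (d \<tau>))"
  shows "exp_growth (\<lambda>\<tau>. d \<tau> powi k)"
proof -
  have pow: "exp_growth (\<lambda>\<tau>. f \<tau> ^ n)" if "exp_growth f" for f n
    by (induction n) (auto intro: exp_growth_const exp_growth_mult that)
  show ?thesis
  proof (cases "k \<ge> 0")
    case True
    then show ?thesis using pow[OF assms(1), of "nat k"] by (simp add: power_int_def)
  next
    case False
    then show ?thesis using pow[OF assms(2), of "nat (- k)"] by (simp add: power_int_def)
  qed
qed

text \<open>Dividing by r^n, with r > 1, would make 1 at most a null sequence. In the application r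
  is the modulus of an eigenvalue.\<close>

lemma bounded_growth_le_one:
  fixes r C :: real
  assumes "r \<ge> 0" and bound: "\<And>n. r ^ n \<le> C * (1 + real n)"
  shows "r \<le> 1"
proof (rule ccontr)
  assume "\<not> r \<le> 1"
  then have r: "r > 1" by simp
  then have x: "norm (inverse r) < 1" by (simp add: inverse_less_1_iff)
  have "(\<lambda>n. C * (inverse r ^ n + real n * inverse r ^ n)) \<longlonglongrightarrow> C * (0 + 0)"
    by (rule tendsto_mult[OF tendsto_const tendsto_add[OF LIMSEQ_power_zero[OF x] powser_times_n_limit_0[OF x]]])
  moreover have "1 \<le> C * (inverse r ^ n + real n * inverse r ^ n)" for n
  proof -
    have "r ^ n * inverse r ^ n = 1" using r by (simp flip: power_mult_distrib)
    moreover have "r ^ n * inverse r ^ n \<le> C * (1 + real n) * inverse r ^ n"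
      using bound r by (intro mult_right_mono) auto
    ultimately show ?thesis by (simp add: algebra_simps)
  qed
  ultimately have "1 \<le> C * (0 + 0)" by (intro LIMSEQ_le_const) auto
  then show False by simp
qed

section \<open>The induced automorphic form\<close>

text \<open>The coordinates of A (\<tau>, 1), a form of weight -1 under the slash action.\<close>

definition lin :: "mat2 \<Rightarrow> nat \<Rightarrow> complex \<Rightarrow> complex" where
  "lin A \<beta> \<tau> = (if \<beta> = 0 then numer A \<tau> else autom A \<tau>)"

lemma lin_mult:
  assumes "B \<in> carrier SL2R" "\<tau> \<in> upper_half_plane"
  shows "lin (A ** B) \<beta> \<tau> = lin A \<beta> (moebius B \<tau>) * autom B \<tau>"
  unfolding lin_def numer_mult[OF assms] autom_mult[OF assms] by simp

lemma lin_std_rep: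
  assumes "\<alpha> < 2"
  shows "lin (A ** B) \<alpha> \<tau> = std_rep A $$ (\<alpha>, 0) * lin B 0 \<tau> + std_rep A $$ (\<alpha>, 1) * lin B 1 \<tau>"
proof -
  consider "\<alpha> = 0" | "\<alpha> = 1" using assms by linarith
  then show ?thesis
    by cases (simp_all add: lin_def std_rep_def mat_of_rows_list_def mat2_mult_entry algebra_simps)
qed

lemma std_rep_le_mnorm:
  assumes "\<alpha> < 2" "\<beta> < 2"
  shows "norm (std_rep A $$ (\<alpha>, \<beta>)) \<le> mnorm A"
proof -
  consider "\<alpha> = 0" "\<beta> = 0" | "\<alpha> = 0" "\<beta> = 1" | "\<alpha> = 1" "\<beta> = 0" | "\<alpha> = 1" "\<beta> = 1"
    using assms by linarith
  then show ?thesis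
    by cases (simp_all add: std_rep_def mat_of_rows_list_def mnorm_entry)
qed

lemma mnorm_std_rep:
  "mnorm A = norm (std_rep A $$ (0, 0)) + norm (std_rep A $$ (0, 1)) +
    norm (std_rep A $$ (1, 0)) + norm (std_rep A $$ (1, 1))"
  by (simp add: std_rep_def mat_of_rows_list_def mnorm_def)

lemma sum_pairs: "(\<Sum>b<n * 2. f b) = (\<Sum>j<n. f (2 * j) + f (2 * j + 1 :: nat))"
  for f :: "nat \<Rightarrow> 'a :: comm_monoid_add"
  by (induction n) (simp_all add: add_ac mult.commute)

text \<open>\<open>D\<close> stands for the weight one form \<Delta>^(1/w) and \<open>k0\<close> for
  the exponent of the twist. At a cusp the form is described by the periodicity of its modulus and
  by growth of it and of its inverse, since \<open>k0\<close> may have either sign. The cusp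
  \<open>c0\<close> supplies the translations for linear independence and the element that is not
  diagonalizable.\<close>

locale induced_form = transversal G H rs
  for G H :: "mat2 set" and rs :: "mat2 list" +
  fixes D :: "complex \<Rightarrow> complex" and \<nu> :: "mat2 \<Rightarrow> complex" and k0 :: int
    and \<rho> :: "mat2 \<Rightarrow> complex Matrix.mat" and s :: nat and z0 :: complex and c0 :: boundary_point
  assumes minus_G: "- I2 \<in> G"
    and D_hol: "D holomorphic_on upper_half_plane"
    and D_nz: "\<And>\<tau>. \<tau> \<in> upper_half_plane \<Longrightarrow> D \<tau> \<noteq> 0"
    and D_slash: "\<And>\<gamma> \<tau>. \<gamma> \<in> G \<Longrightarrow> \<tau> \<in> upper_half_plane \<Longrightarrow> D (moebius \<gamma> \<tau>) = \<nu> \<gamma> * autom \<gamma> \<tau> * D \<tau>"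
    and iso: "isolated_identity G"
    and z0: "z0 \<in> upper_half_plane"
    and s: "even s" "s \<ge> 10"
    and dom: "(\<Sum>\<^sub>\<infinity>A\<in>G - {I2, - I2}. norm (inverse (pker z0 A z0) ^ s)) < 2 * inverse (2 * Im z0) ^ s"
    and \<rho>: "\<And>\<gamma>. \<gamma> \<in> G \<Longrightarrow> \<rho> \<gamma> = (\<nu> \<gamma> powi k0) \<cdot>\<^sub>m induced_rep 2 rs H std_rep \<gamma>"
    and c0: "is_cusp G c0"
    and cusp_growth: "\<And>c. is_cusp G c \<Longrightarrow> \<exists>B. cusp_frame c B \<and>
      (\<forall>\<tau>\<in>upper_half_plane. norm (D (moebius B (\<tau> + of_real (cusp_width G c))) / autom B (\<tau> + of_real (cusp_width G c))) =
        norm (D (moebius B \<tau>) / autom B \<tau>)) \<and>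
      exp_growth (\<lambda>\<tau>. D (moebius B \<tau>) / autom B \<tau>) \<and>
      exp_growth (\<lambda>\<tau>. inverse (D (moebius B \<tau>) / autom B \<tau>))"
begin

text \<open>The power of \<open>D\<close> has weight \<open>k0\<close>, the linear factor -1 and the
  Poincare series \<open>s\<close>.\<close>

definition wt :: int where "wt = k0 - 1 + int s"

text \<open>Blocks of length two, indexed as in \<open>induced_rep\<close>: the quotient by 2 gives
  the coset and the remainder the coordinate.\<close>

definition X :: "nat \<Rightarrow> complex \<Rightarrow> complex" where
  "X a \<tau> = D \<tau> powi k0 * psum z0 s (coset (a div 2)) \<tau> * lin (inv2 (rs ! (a div 2))) (a mod 2) \<tau>"

abbreviation "m \<equiv> length rs * 2"

lemma X_pair:
  "X (2 * i) \<tau> = D \<tau> powi k0 * psum z0 s (coset i) \<tau> * lin (inv2 (rs ! i)) 0 \<tau>"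
  "X (2 * i + 1) \<tau> = D \<tau> powi k0 * psum z0 s (coset i) \<tau> * lin (inv2 (rs ! i)) 1 \<tau>"
proof -
  have "(2 * i + 1) div 2 = i" "(2 * i + 1) mod 2 = 1" by presburger+
  then show "X (2 * i) \<tau> = D \<tau> powi k0 * psum z0 s (coset i) \<tau> * lin (inv2 (rs ! i)) 0 \<tau>"
    "X (2 * i + 1) \<tau> = D \<tau> powi k0 * psum z0 s (coset i) \<tau> * lin (inv2 (rs ! i)) 1 \<tau>"
    unfolding X_def by simp_all
qed

lemma z0_pos: "Im z0 > 0"
  using z0 by (simp add: upper_half_plane_def)

lemma coset_SL2R: "i < length rs \<Longrightarrow> coset i \<subseteq> carrier SL2R"
  using coset_subset[of i] G_SL2R by auto

lemma coset_summable: "i < length rs \<Longrightarrow> (\<lambda>A. inverse (mnorm A) ^ s) summable_on coset i"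
  using mnorm_summable[OF G iso s(2)] coset_subset[of i] by (rule summable_on_subset_banach)

lemma block_index: "a < m \<Longrightarrow> a div 2 < length rs"
  by auto

lemma X_holomorphic:
  assumes "a < m"
  shows "X a holomorphic_on upper_half_plane"
proof -
  let ?i = "a div 2"
  have "(\<lambda>\<tau>. lin (inv2 (rs ! ?i)) (a mod 2) \<tau>) holomorphic_on upper_half_plane"
    unfolding lin_def by (cases "a mod 2 = 0") (auto intro!: holomorphic_intros)
  moreover have "(\<lambda>\<tau>. D \<tau> powi k0) holomorphic_on upper_half_plane"
    using D_nz by (intro holomorphic_intros D_hol) auto
  moreover have "psum z0 s (coset ?i) holomorphic_on upper_half_plane"
    using block_index[OF assms] by (intro psum_holomorphic z0_pos coset_SL2R coset_summable)
  ultimately show ?thesis unfolding X_def by (intro holomorphic_on_mult)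
qed

lemma \<rho>_entry:
  assumes "\<gamma> \<in> G" "a < m" "b < m"
  shows "\<rho> \<gamma> $$ (a, b) = \<nu> \<gamma> powi k0 *
    (let h = inv2 (rs ! (a div 2)) ** \<gamma> ** rs ! (b div 2)
     in if h \<in> H then std_rep h $$ (a mod 2, b mod 2) else 0)"
  using assms matrix_inv_SL2R[OF rs_SL2R[OF block_index]] by (simp add: \<rho> induced_rep_def Let_def)

lemma \<rho>_carrier: "\<gamma> \<in> G \<Longrightarrow> \<rho> \<gamma> \<in> carrier_mat m m"
  unfolding \<rho> induced_rep_def by (intro smult_carrier_mat mat_carrier)

text \<open>In block row i only one j survives. With h = r_i^-1 \<gamma> r_j, the matrix h maps the
  linear factors of r_j^-1 to those of r_i^-1 \<gamma>, and the slash action maps the series of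
  coset i to that of coset j; the powers of \<nu> and of the automorphy factor then agree.\<close>

lemma X_slash:
  assumes \<gamma>: "\<gamma> \<in> G" and a: "a < m" and \<tau>: "\<tau> \<in> upper_half_plane"
  shows "autom \<gamma> \<tau> powi (- wt) * X a (moebius \<gamma> \<tau>) = (\<Sum>b<m. \<rho> \<gamma> $$ (a, b) * X b \<tau>)"
proof -
  define i where "i = a div 2"
  define \<alpha> where "\<alpha> = a mod 2"
  have i: "i < length rs" and \<alpha>: "\<alpha> < 2" using a by (auto simp: i_def \<alpha>_def)
  obtain j where j: "j < length rs" "inv2 (rs ! i) ** \<gamma> ** rs ! j \<in> H"
    and uniq: "\<And>j'. j' < length rs \<Longrightarrow> inv2 (rs ! i) ** \<gamma> ** rs ! j' \<in> H \<Longrightarrow> j' = j"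
    using block_unique[OF \<gamma> i] by auto
  define h where "h = inv2 (rs ! i) ** \<gamma> ** rs ! j"
  have \<gamma>S: "\<gamma> \<in> carrier SL2R" by (rule G_SL2R[OF \<gamma>])
  have J: "autom \<gamma> \<tau> \<noteq> 0" by (rule autom_nonzero[OF \<gamma>S \<tau>])
  have "(\<Sum>b<m. \<rho> \<gamma> $$ (a, b) * X b \<tau>) =
      (\<Sum>j'<length rs. \<rho> \<gamma> $$ (a, 2 * j') * X (2 * j') \<tau> + \<rho> \<gamma> $$ (a, 2 * j' + 1) * X (2 * j' + 1) \<tau>)"
    by (rule sum_pairs)
  also have "\<dots> = (\<Sum>j'<length rs. if j' = j then \<nu> \<gamma> powi k0 *
      (std_rep h $$ (\<alpha>, 0) * X (2 * j) \<tau> + std_rep h $$ (\<alpha>, 1) * X (2 * j + 1) \<tau>) else 0)"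
  proof (intro sum.cong refl)
    fix j' assume "j' \<in> {..<length rs}"
    then have j': "j' < length rs" by simp
    show "\<rho> \<gamma> $$ (a, 2 * j') * X (2 * j') \<tau> + \<rho> \<gamma> $$ (a, 2 * j' + 1) * X (2 * j' + 1) \<tau> =
      (if j' = j then \<nu> \<gamma> powi k0 *
      (std_rep h $$ (\<alpha>, 0) * X (2 * j) \<tau> + std_rep h $$ (\<alpha>, 1) * X (2 * j + 1) \<tau>) else 0)"
    proof (cases "j' = j")
      case True
      then show ?thesis
        using j \<gamma> a j' by (simp add: \<rho>_entry Let_def h_def i_def \<alpha>_def distrib_left)
    next
      case False
      then have "inv2 (rs ! i) ** \<gamma> ** rs ! j' \<notin> H" using uniq[OF j'] by blast
      then show ?thesis
        using False \<gamma> a j' by (simp add: \<rho>_entry Let_def i_def)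
    qed
  qed
  also have "\<dots> = \<nu> \<gamma> powi k0 *
      (std_rep h $$ (\<alpha>, 0) * X (2 * j) \<tau> + std_rep h $$ (\<alpha>, 1) * X (2 * j + 1) \<tau>)"
    using j by simp
  also have "\<dots> = \<nu> \<gamma> powi k0 * (D \<tau> powi k0 * psum z0 s (coset j) \<tau> * lin (h ** inv2 (rs ! j)) \<alpha> \<tau>)"
    unfolding lin_std_rep[OF \<alpha>] X_pair by (simp add: algebra_simps)
  also have "h ** inv2 (rs ! j) = inv2 (rs ! i) ** \<gamma>"
    unfolding h_def by (rule inv2_cancel(3)[OF rs_SL2R[OF j(1)]])
  also have "lin (inv2 (rs ! i) ** \<gamma>) \<alpha> \<tau> = lin (inv2 (rs ! i)) \<alpha> (moebius \<gamma> \<tau>) * autom \<gamma> \<tau>"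
    by (rule lin_mult[OF \<gamma>S \<tau>])
  also have "psum z0 s (coset j) \<tau> = inverse (autom \<gamma> \<tau>) ^ s * psum z0 s (coset i) (moebius \<gamma> \<tau>)"
    by (rule psum_coset_slash[OF \<gamma> i j \<tau>, symmetric])
  finally have rhs: "(\<Sum>b<m. \<rho> \<gamma> $$ (a, b) * X b \<tau>) = \<nu> \<gamma> powi k0 * (D \<tau> powi k0 *
      (inverse (autom \<gamma> \<tau>) ^ s * psum z0 s (coset i) (moebius \<gamma> \<tau>)) *
      (lin (inv2 (rs ! i)) \<alpha> (moebius \<gamma> \<tau>) * autom \<gamma> \<tau>))" .
  let ?J = "autom \<gamma> \<tau>" and ?p = "psum z0 s (coset i) (moebius \<gamma> \<tau>)"
    and ?l = "lin (inv2 (rs ! i)) \<alpha> (moebius \<gamma> \<tau>)"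
  have pow: "?J powi (- wt) * ?J powi k0 = inverse ?J ^ s * ?J"
  proof -
    have "autom \<gamma> \<tau> powi (- wt) * autom \<gamma> \<tau> powi k0 = autom \<gamma> \<tau> powi (1 - int s)"
      using J by (simp add: wt_def flip: power_int_add)
    also have "\<dots> = inverse (autom \<gamma> \<tau>) ^ s * autom \<gamma> \<tau>"
      using J by (simp add: power_int_diff field_simps)
    finally show ?thesis .
  qed
  have "?J powi (- wt) * X a (moebius \<gamma> \<tau>) =
      ?J powi (- wt) * ((\<nu> \<gamma> powi k0 * ?J powi k0 * D \<tau> powi k0) * ?p * ?l)"
    unfolding X_def i_def[symmetric] \<alpha>_def[symmetric] D_slash[OF \<gamma> \<tau>] power_int_mult_distrib ..
  also have "\<dots> = \<nu> \<gamma> powi k0 * D \<tau> powi k0 * ?p * ?l * (?J powi (- wt) * ?J powi k0)"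
    by (simp only: mult_ac)
  also have "\<dots> = (\<Sum>b<m. \<rho> \<gamma> $$ (a, b) * X b \<tau>)"
    unfolding pow rhs by (simp only: mult_ac)
  finally show ?thesis .
qed

lemma cusp_data:
  assumes "is_cusp G c"
  obtains B where "cusp_frame c B"
    "\<And>\<tau>. \<tau> \<in> upper_half_plane \<Longrightarrow>
      norm (D (moebius B (\<tau> + of_real (cusp_width G c))) / autom B (\<tau> + of_real (cusp_width G c))) =
        norm (D (moebius B \<tau>) / autom B \<tau>)"
    "exp_growth (\<lambda>\<tau>. D (moebius B \<tau>) / autom B \<tau>)"
    "exp_growth (\<lambda>\<tau>. inverse (D (moebius B \<tau>) / autom B \<tau>))"
  using cusp_growth[OF assms] by blast

lemma moebius_transl: "moebius (transl x) \<tau> = \<tau> + of_real x"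
  by (simp add: moebius_def)

lemma conj_transl_moebius:
  assumes B: "B \<in> carrier SL2R" and \<tau>: "\<tau> \<in> upper_half_plane"
  shows "moebius (B ** transl x ** inv2 B) (moebius B \<tau>) = moebius B (\<tau> + of_real x)"
    and "autom (B ** transl x ** inv2 B) (moebius B \<tau>) * autom B \<tau> = autom B (\<tau> + of_real x)"
proof -
  have eq: "B ** transl x ** inv2 B ** B = B ** transl x" by (rule inv2_cancel(4)[OF B])
  show "moebius (B ** transl x ** inv2 B) (moebius B \<tau>) = moebius B (\<tau> + of_real x)"
    unfolding moebius_mult[OF B \<tau>, symmetric] eq moebius_mult[OF transl_carrier \<tau>] moebius_transl ..
  show "autom (B ** transl x ** inv2 B) (moebius B \<tau>) * autom B \<tau> = autom B (\<tau> + of_real x)"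
    unfolding autom_mult[OF B \<tau>, symmetric] eq autom_mult[OF transl_carrier \<tau>] moebius_transl by simp
qed

text \<open>Two translations \<open>T\<^sub>1 \<noteq> T\<^sub>2\<close> at a cusp that act alike on the cosets allow the linear factors
  to be separated from the Poincare series.\<close>

lemma X_independent:
  assumes rel: "\<And>\<tau>. \<tau> \<in> upper_half_plane \<Longrightarrow> (\<Sum>a<m. c a * X a \<tau>) = 0" and a: "a < m"
  shows "c a = 0"
proof -
  let ?n = "length rs"
  let ?P = "\<lambda>i. inv2 (rs ! i)"
  \<comment> \<open>The two coordinates of block i combine to the linear function A i * \<tau> + C
    i, so the relation says that these functions times the series of the cosets sum to zero.\<close>
  define A where "A i = c (2 * i) * of_real (?P i $ 1 $ 1) + c (2 * i + 1) * of_real (?P i $ 2 $ 1)" for i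
  define C where "C i = c (2 * i) * of_real (?P i $ 1 $ 2) + c (2 * i + 1) * of_real (?P i $ 2 $ 2)" for i
  have rel': "(\<Sum>i<?n. psum z0 s (coset i) \<tau> * (A i * \<tau> + C i)) = 0" if \<tau>: "\<tau> \<in> upper_half_plane" for \<tau>
  proof -
    have "0 = (\<Sum>a<m. c a * X a \<tau>)" using rel[OF \<tau>] by simp
    also have "\<dots> = (\<Sum>i<?n. D \<tau> powi k0 * (psum z0 s (coset i) \<tau> * (A i * \<tau> + C i)))"
      unfolding sum_pairs X_pair
      by (intro sum.cong refl) (simp add: lin_def A_def C_def algebra_simps)
    also have "\<dots> = D \<tau> powi k0 * (\<Sum>i<?n. psum z0 s (coset i) \<tau> * (A i * \<tau> + C i))"
      by (simp add: sum_distrib_left)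
    finally show ?thesis using D_nz[OF \<tau>] by simp
  qed
  define w where "w = cusp_width G c0"
  obtain B where "cusp_frame c0 B" using cusp_frame_exists by blast
  note B = cusp_frameD[OF this]
  note cw = cusp_width_props[OF G iso minus_G c0, folded w_def]
  define T where "T k = cusp_translation c0 (of_int (int k) * w)" for k
  have T_G: "T k \<in> G" for k unfolding T_def by (rule cw(2))
  have T_S: "T k \<in> carrier SL2R" for k by (rule G_SL2R[OF T_G])
  \<comment> \<open>The map on coset indices induced by the k-th translation. The restriction to
    indices below \<open>?n\<close> places it in a finite set of functions, so two translations
    induce the same map.\<close>
  define idx where "idx k = (\<lambda>i\<in>{..<?n}. THE j. j < ?n \<and> ?P i ** T k ** rs ! j \<in> H)" for k
  have idx: "idx k i < ?n \<and> ?P i ** T k ** rs ! idx k i \<in> H" if "i < ?n" for k i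
    using theI'[OF block_unique[OF T_G that]] that by (simp add: idx_def)
  have "idx k \<in> {..<?n} \<rightarrow>\<^sub>E {..<?n}" for k
  proof (rule PiE_I)
    show "idx k i \<in> {..<?n}" if "i \<in> {..<?n}" for i using idx[of i k] that by simp
    show "idx k i = undefined" if "i \<notin> {..<?n}" for i using that by (simp add: idx_def)
  qed
  then have "range idx \<subseteq> {..<?n} \<rightarrow>\<^sub>E {..<?n}" by blast
  then have "finite (range idx)" by (rule finite_subset) (intro finite_PiE; simp)
  then have "\<not> inj idx" using finite_imageD infinite_UNIV_nat by blast
  then obtain k l where kl: "k \<noteq> l" "idx k = idx l" by (auto simp: inj_on_def)
  have slash: "psum z0 s (coset i) (moebius (T k) \<tau>) = autom (T k) \<tau> ^ s * psum z0 s (coset (idx k i)) \<tau>"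
    if "i < ?n" "\<tau> \<in> upper_half_plane" for i k \<tau>
    using psum_coset_slash[OF T_G that(1) _ _ that(2), of "idx k i" k s z0] idx[OF that(1), of k]
      autom_nonzero[OF T_S[of k] that(2)]
    by (simp add: field_simps flip: power_mult_distrib)
  have lin_rel: "(\<Sum>i<?n. psum z0 s (coset (idx k i)) \<tau> * (A i * moebius (T k) \<tau> + C i)) = 0"
    if \<tau>: "\<tau> \<in> upper_half_plane" for k \<tau>
  proof -
    have "0 = (\<Sum>i<?n. psum z0 s (coset i) (moebius (T k) \<tau>) * (A i * moebius (T k) \<tau> + C i))"
      using rel'[OF moebius_upper_half_plane[OF T_S \<tau>]] by simp
    also have "\<dots> = autom (T k) \<tau> ^ s *
        (\<Sum>i<?n. psum z0 s (coset (idx k i)) \<tau> * (A i * moebius (T k) \<tau> + C i))"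
      using \<tau> by (simp add: slash sum_distrib_left mult.assoc)
    finally show ?thesis using autom_nonzero[OF T_S[of k] \<tau>] by simp
  qed
  have T_neq: "moebius (T k) \<tau> \<noteq> moebius (T l) \<tau>" if \<tau>: "\<tau> \<in> upper_half_plane" for \<tau>
  proof
    define \<sigma> where "\<sigma> = moebius (inv2 B) \<tau>"
    have \<sigma>: "\<sigma> \<in> upper_half_plane" "\<tau> = moebius B \<sigma>"
      using moebius_upper_half_plane[OF inv2_carrier[OF B(1)] \<tau>] moebius_inv2[OF B(1) \<tau>] by (simp_all add: \<sigma>_def)
    assume "moebius (T k) \<tau> = moebius (T l) \<tau>"
    then have "moebius B (\<sigma> + of_real (of_int (int k) * w)) = moebius B (\<sigma> + of_real (of_int (int l) * w))"
      unfolding T_def B(2) \<sigma>(2) conj_transl_moebius(1)[OF B(1) \<sigma>(1)] .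
    then have "\<sigma> + of_real (of_int (int k) * w) = \<sigma> + of_real (of_int (int l) * w)"
      by (metis moebius_inv2(1) B(1) shift_uhp \<sigma>(1))
    then show False using kl(1) cw(1) by simp
  qed
  \<comment> \<open>The relations moved by two translations contain the same series but different
    linear arguments, so their difference isolates the slopes \<open>A i\<close>.\<close>
  have A_sum: "(\<Sum>i<?n. A i * psum z0 s (coset (idx k i)) \<tau>) = 0" if \<tau>: "\<tau> \<in> upper_half_plane" for \<tau>
  proof -
    let ?u = "moebius (T k) \<tau>" and ?v = "moebius (T l) \<tau>"
    have "(?u - ?v) * (\<Sum>i<?n. A i * psum z0 s (coset (idx k i)) \<tau>) =
        (\<Sum>i<?n. psum z0 s (coset (idx k i)) \<tau> * (A i * ?u + C i) -
          psum z0 s (coset (idx k i)) \<tau> * (A i * ?v + C i))"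
      unfolding sum_distrib_left by (intro sum.cong refl) (simp add: algebra_simps)
    also have "\<dots> = 0"
      unfolding sum_subtractf using lin_rel[OF \<tau>, of k] lin_rel[OF \<tau>, of l, folded kl(2)] by simp
    finally show ?thesis using T_neq[OF \<tau>] by simp
  qed
  \<comment> \<open>A relation between the permuted series is carried back by the inverse
    translation to one between the original series, where independence is known.\<close>
  have push: "\<And>i. i < ?n \<Longrightarrow> b i = 0"
    if b: "\<And>\<tau>. \<tau> \<in> upper_half_plane \<Longrightarrow> (\<Sum>i<?n. b i * psum z0 s (coset (idx k i)) \<tau>) = 0" for b
  proof (rule psum_independent[OF iso z0 s dom])
    fix \<tau> assume \<tau>: "\<tau> \<in> upper_half_plane"
    define \<sigma> where "\<sigma> = moebius (inv2 (T k)) \<tau>"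
    have \<sigma>: "\<sigma> \<in> upper_half_plane" "\<tau> = moebius (T k) \<sigma>"
      using moebius_upper_half_plane[OF inv2_carrier[OF T_S] \<tau>] moebius_inv2[OF T_S \<tau>] by (simp_all add: \<sigma>_def)
    have "(\<Sum>i<?n. b i * psum z0 s (coset i) \<tau>) =
        autom (T k) \<sigma> ^ s * (\<Sum>i<?n. b i * psum z0 s (coset (idx k i)) \<sigma>)"
      unfolding \<sigma>(2) sum_distrib_left by (intro sum.cong refl) (simp add: slash \<sigma>(1) mult_ac)
    then show "(\<Sum>i<?n. b i * psum z0 s (coset i) \<tau>) = 0" using b[OF \<sigma>(1)] by simp
  qed
  have A0: "A i = 0" if "i < ?n" for i using push[OF A_sum that] .
  have C0: "C i = 0" if "i < ?n" for i
  proof (rule push[OF _ that])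
    fix \<tau> assume "\<tau> \<in> upper_half_plane"
    from lin_rel[OF this, of k] show "(\<Sum>i<?n. C i * psum z0 s (coset (idx k i)) \<tau>) = 0"
      by (simp add: A0 mult.commute)
  qed
  have "c (2 * i) = 0 \<and> c (2 * i + 1) = 0" if i: "i < ?n" for i
  proof -
    \<comment> \<open>Slope and constant term arise from the two coefficients of a block by an
      invertible matrix, which recovers the coefficients.\<close>
    have det: "of_real (?P i $ 1 $ 1) * of_real (?P i $ 2 $ 2) - of_real (?P i $ 1 $ 2) * of_real (?P i $ 2 $ 1) = (1 :: complex)"
    proof -
      have "?P i $ 1 $ 1 * ?P i $ 2 $ 2 - ?P i $ 1 $ 2 * ?P i $ 2 $ 1 = 1"
        using inv2_carrier[OF rs_SL2R[OF i]] unfolding SL2R_carrier .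
      then have "complex_of_real (?P i $ 1 $ 1 * ?P i $ 2 $ 2 - ?P i $ 1 $ 2 * ?P i $ 2 $ 1) = of_real 1"
        by (rule arg_cong)
      then show ?thesis by (simp only: of_real_diff of_real_mult of_real_1)
    qed
    have "c (2 * i) = c (2 * i) * (of_real (?P i $ 1 $ 1) * of_real (?P i $ 2 $ 2) - of_real (?P i $ 1 $ 2) * of_real (?P i $ 2 $ 1))"
      unfolding det by simp
    also have "\<dots> = A i * of_real (?P i $ 2 $ 2) - C i * of_real (?P i $ 2 $ 1)"
      by (simp add: A_def C_def algebra_simps)
    finally have 1: "c (2 * i) = 0" using A0[OF i] C0[OF i] by simp
    have "c (2 * i + 1) = c (2 * i + 1) * (of_real (?P i $ 1 $ 1) * of_real (?P i $ 2 $ 2) - of_real (?P i $ 1 $ 2) * of_real (?P i $ 2 $ 1))"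
      unfolding det by simp
    also have "\<dots> = C i * of_real (?P i $ 1 $ 1) - A i * of_real (?P i $ 1 $ 2)"
      by (simp add: A_def C_def algebra_simps)
    finally show ?thesis using 1 A0[OF i] C0[OF i] by simp
  qed
  from this[of "a div 2"] a show ?thesis
    by (cases "even a") (auto elim!: evenE oddE)
qed

end

lemma mat_mult_entry:
  assumes "A \<in> carrier_mat n n" "B \<in> carrier_mat n n" "i < n" "j < n"
  shows "(A * B) $$ (i, j) = (\<Sum>k<n. A $$ (i, k) * B $$ (k, j))"
  using assms by (auto simp: scalar_prod_def lessThan_atLeast0 intro!: sum.cong)

section \<open>The induced matrices as a logarithmic representation, and the expansions at the
  cusps\<close>

context induced_form
begin

text \<open>Independent components let a matrix be recovered from its action on the form.
  Multiplicativity of \<rho> and its value at -I thus follow from the cocycle property of the slash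
  action, without computing with blocks.\<close>

lemma mat_eqI_X:
  assumes M: "M \<in> carrier_mat m m" and N: "N \<in> carrier_mat m m"
    and eq: "\<And>a \<tau>. a < m \<Longrightarrow> \<tau> \<in> upper_half_plane \<Longrightarrow>
      (\<Sum>b<m. M $$ (a, b) * X b \<tau>) = (\<Sum>b<m. N $$ (a, b) * X b \<tau>)"
  shows "M = N"
proof (rule eq_matI)
  fix a b assume "a < dim_row N" "b < dim_col N"
  then have a: "a < m" and b: "b < m" using N by auto
  have "M $$ (a, b) - N $$ (a, b) = 0"
  proof (rule X_independent[OF _ b])
    fix \<tau> assume "\<tau> \<in> upper_half_plane"
    then show "(\<Sum>b<m. (M $$ (a, b) - N $$ (a, b)) * X b \<tau>) = 0"
      using eq[OF a] by (simp add: left_diff_distrib sum_subtractf)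
  qed
  then show "M $$ (a, b) = N $$ (a, b)" by simp
qed (use M N in auto)

lemma \<rho>_mult:
  assumes \<gamma>: "\<gamma> \<in> G" and \<delta>: "\<delta> \<in> G"
  shows "\<rho> (\<gamma> ** \<delta>) = \<rho> \<gamma> * \<rho> \<delta>"
proof (rule mat_eqI_X)
  have \<gamma>\<delta>: "\<gamma> ** \<delta> \<in> G" by (rule subgroup_SL2R_mult[OF G \<gamma> \<delta>])
  then show "\<rho> (\<gamma> ** \<delta>) \<in> carrier_mat m m" by (rule \<rho>_carrier)
  show "\<rho> \<gamma> * \<rho> \<delta> \<in> carrier_mat m m" using \<rho>_carrier[OF \<gamma>] \<rho>_carrier[OF \<delta>] by simp
  fix a \<tau> assume a: "a < m" and \<tau>: "\<tau> \<in> upper_half_plane"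
  have \<delta>\<tau>: "moebius \<delta> \<tau> \<in> upper_half_plane" by (rule moebius_upper_half_plane[OF G_SL2R[OF \<delta>] \<tau>])
  have "(\<Sum>b<m. \<rho> (\<gamma> ** \<delta>) $$ (a, b) * X b \<tau>) = autom (\<gamma> ** \<delta>) \<tau> powi (- wt) * X a (moebius (\<gamma> ** \<delta>) \<tau>)"
    by (rule X_slash[OF \<gamma>\<delta> a \<tau>, symmetric])
  also have "\<dots> = autom \<delta> \<tau> powi (- wt) * (autom \<gamma> (moebius \<delta> \<tau>) powi (- wt) * X a (moebius \<gamma> (moebius \<delta> \<tau>)))"
    unfolding autom_mult[OF G_SL2R[OF \<delta>] \<tau>] moebius_mult[OF G_SL2R[OF \<delta>] \<tau>] power_int_mult_distrib
    by (simp only: mult_ac)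
  also have "\<dots> = (\<Sum>b<m. \<rho> \<gamma> $$ (a, b) * (autom \<delta> \<tau> powi (- wt) * X b (moebius \<delta> \<tau>)))"
    unfolding X_slash[OF \<gamma> a \<delta>\<tau>] sum_distrib_left by (simp only: mult_ac)
  also have "\<dots> = (\<Sum>b<m. \<Sum>c<m. \<rho> \<gamma> $$ (a, b) * \<rho> \<delta> $$ (b, c) * X c \<tau>)"
    by (intro sum.cong refl) (simp add: X_slash[OF \<delta> _ \<tau>] sum_distrib_left mult.assoc)
  also have "\<dots> = (\<Sum>c<m. (\<Sum>b<m. \<rho> \<gamma> $$ (a, b) * \<rho> \<delta> $$ (b, c)) * X c \<tau>)"
    unfolding sum_distrib_right by (rule sum.swap)
  also have "\<dots> = (\<Sum>c<m. (\<rho> \<gamma> * \<rho> \<delta>) $$ (a, c) * X c \<tau>)"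
    using mat_mult_entry[OF \<rho>_carrier[OF \<gamma>] \<rho>_carrier[OF \<delta>] a] by (intro sum.cong refl) simp
  finally show "(\<Sum>b<m. \<rho> (\<gamma> ** \<delta>) $$ (a, b) * X b \<tau>) = (\<Sum>b<m. (\<rho> \<gamma> * \<rho> \<delta>) $$ (a, b) * X b \<tau>)" .
qed

lemma sum_scalar_mat: "a < m \<Longrightarrow> (\<Sum>b<m. (c \<cdot>\<^sub>m 1\<^sub>m m) $$ (a, b) * X b \<tau>) = c * X a \<tau>"
proof -
  assume a: "a < m"
  have "(\<Sum>b<m. (c \<cdot>\<^sub>m 1\<^sub>m m) $$ (a, b) * X b \<tau>) = (\<Sum>b<m. if b = a then c * X a \<tau> else 0)"
    using a by (intro sum.cong refl) auto
  then show ?thesis using a by simp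
qed

lemma \<rho>_one: "\<rho> I2 = 1\<^sub>m m"
proof -
  have I: "I2 \<in> G" by (rule subgroup_SL2R_one[OF G])
  have "\<rho> I2 = 1 \<cdot>\<^sub>m 1\<^sub>m m"
  proof (rule mat_eqI_X[OF \<rho>_carrier[OF I]])
    fix a \<tau> assume a: "a < m" and \<tau>: "\<tau> \<in> upper_half_plane"
    show "(\<Sum>b<m. \<rho> I2 $$ (a, b) * X b \<tau>) = (\<Sum>b<m. (1 \<cdot>\<^sub>m 1\<^sub>m m) $$ (a, b) * X b \<tau>)"
      unfolding X_slash[OF I a \<tau>, symmetric] sum_scalar_mat[OF a] by simp
  qed simp
  also have "\<dots> = 1\<^sub>m m" by (rule eq_matI) auto
  finally show ?thesis .
qed

lemma \<rho>_minus_one: "\<rho> (- I2) = ((- 1) powi (- wt)) \<cdot>\<^sub>m 1\<^sub>m m"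
proof (rule mat_eqI_X[OF \<rho>_carrier[OF minus_G]])
  fix a \<tau> assume a: "a < m" and \<tau>: "\<tau> \<in> upper_half_plane"
  show "(\<Sum>b<m. \<rho> (- I2) $$ (a, b) * X b \<tau>) = (\<Sum>b<m. ((- 1) powi (- wt) \<cdot>\<^sub>m 1\<^sub>m m) $$ (a, b) * X b \<tau>)"
    unfolding X_slash[OF minus_G a \<tau>, symmetric] sum_scalar_mat[OF a] by simp
qed simp

lemma \<rho>_parity: "\<rho> I2 = exp (\<i> * of_real pi * of_int wt) \<cdot>\<^sub>m \<rho> (- I2)"
proof -
  have "exp (\<i> * of_real pi * of_int wt) = exp (of_int wt * (\<i> * of_real pi))" by (simp only: mult_ac)
  also have "\<dots> = (- 1) powi wt" unfolding exp_power_int[symmetric] by simp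
  finally have "exp (\<i> * of_real pi * of_int wt) * (- 1) powi (- wt) = 1"
    by (simp flip: power_int_add)
  then show ?thesis unfolding \<rho>_one \<rho>_minus_one by (auto intro!: eq_matI)
qed

lemma \<rho>_representation: "representation G m \<rho>"
proof -
  have "\<rho> \<gamma> \<in> carrier (GL m)" if \<gamma>: "\<gamma> \<in> G" for \<gamma>
  proof -
    have inv: "inv2 \<gamma> \<in> G" by (rule subgroup_SL2R_inv2[OF G \<gamma>])
    have "\<rho> (inv2 \<gamma>) * \<rho> \<gamma> = 1\<^sub>m m" "\<rho> \<gamma> * \<rho> (inv2 \<gamma>) = 1\<^sub>m m"
      using inv2_mult[OF G_SL2R[OF \<gamma>]] by (simp_all add: \<gamma> inv \<rho>_one flip: \<rho>_mult)
    then show ?thesis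
      using \<rho>_carrier[OF \<gamma>] \<rho>_carrier[OF inv]
      by (auto simp: GL_def units_of_def Units_def ring_mat_def intro!: bexI[of _ "\<rho> (inv2 \<gamma>)"])
  qed
  then show ?thesis
    by (auto simp: representation_def hom_def \<rho>_mult) (simp add: GL_def units_of_def ring_mat_def)
qed

text \<open>Seen from the cusp, translation by the width multiplies \<open>D\<close> by a value of
  \<nu> but preserves its modulus, and \<open>D\<close> has no zeros. The point \<i> serves as a
  sample.\<close>

lemma \<nu>_cusp:
  assumes c: "is_cusp G c"
  shows "norm (\<nu> (cusp_translation c (of_int n * cusp_width G c))) = 1"
proof -
  define h where "h = cusp_width G c"
  obtain B where frame: "cusp_frame c B"
    and per: "\<And>\<tau>. \<tau> \<in> upper_half_plane \<Longrightarrow>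
      norm (D (moebius B (\<tau> + of_real h)) / autom B (\<tau> + of_real h)) = norm (D (moebius B \<tau>) / autom B \<tau>)"
    by (rule cusp_data[OF c, folded h_def]) (rule that)
  note B = cusp_frameD[OF frame]
  define d where "d \<tau> = D (moebius B \<tau>) / autom B \<tau>" for \<tau>
  have nat: "norm (d (\<tau> + of_real (of_nat k * h))) = norm (d \<tau>)" if "\<tau> \<in> upper_half_plane" for \<tau> k
  proof (induction k)
    case (Suc k)
    have "norm (d (\<tau> + of_real (of_nat k * h) + of_real h)) = norm (d (\<tau> + of_real (of_nat k * h)))"
      unfolding d_def by (intro per shift_uhp that)
    then show ?case using Suc by (simp add: algebra_simps)
  qed simp
  have int: "norm (d (\<i> + of_real (of_int n * h))) = norm (d \<i>)"
  proof (cases "n \<ge> 0")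
    case True
    then show ?thesis using nat[of \<i> "nat n"] by (simp add: upper_half_plane_def)
  next
    case False
    have "\<i> + of_real (of_int n * h) \<in> upper_half_plane" by (simp add: upper_half_plane_def)
    from nat[OF this, of "nat (- n)"] show ?thesis using False by simp
  qed
  define E where "E = cusp_translation c (of_int n * h)"
  have E: "E \<in> G" unfolding E_def h_def by (rule cusp_width_props[OF G iso minus_G c])
  have i: "\<i> \<in> upper_half_plane" by (simp add: upper_half_plane_def)
  have Bi: "moebius B \<i> \<in> upper_half_plane" by (rule moebius_upper_half_plane[OF B(1) i])
  have J: "autom B \<i> \<noteq> 0" by (rule autom_nonzero[OF B(1) i])
  have J': "autom B (\<i> + of_real (of_int n * h)) \<noteq> 0" by (rule autom_nonzero[OF B(1) shift_uhp[OF i]])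
  have "D (moebius B (\<i> + of_real (of_int n * h))) = \<nu> E * (autom B (\<i> + of_real (of_int n * h)) / autom B \<i>) * D (moebius B \<i>)"
    using D_slash[OF E Bi]
    unfolding E_def B(2) conj_transl_moebius(1)[OF B(1) i]
      eq_divide_imp[OF J conj_transl_moebius(2)[OF B(1) i]] .
  then have "d (\<i> + of_real (of_int n * h)) = \<nu> E * d \<i>"
    using J J' by (simp add: d_def)
  moreover have "d \<i> \<noteq> 0" using D_nz[OF Bi] J by (simp add: d_def)
  ultimately show ?thesis using int by (simp add: norm_mult E_def h_def)
qed

text \<open>A parabolic element other than I and -I fixes a cusp and is, up to sign, a power of the
  translation there. The trace condition also admits I and -I, which form the case of length
  0.\<close>

lemma parabolic_form:
  assumes \<gamma>: "\<gamma> \<in> G" "parabolic \<gamma>"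
  obtains B x where "B \<in> carrier SL2R"
    "\<gamma> = B ** transl x ** inv2 B \<or> \<gamma> = - (B ** transl x ** inv2 B)"
    "\<And>j :: int. B ** transl (of_int j * x) ** inv2 B \<in> G"
    "\<And>j :: int. norm (\<nu> (B ** transl (of_int j * x) ** inv2 B)) = 1"
proof (cases "\<gamma> = I2 \<or> \<gamma> = - I2")
  case True
  have I: "I2 \<in> G" by (rule subgroup_SL2R_one[OF G])
  have inv: "inv2 I2 = I2" by (simp add: mat2_eq_iff)
  have "\<nu> I2 = 1"
    using D_slash[OF I z0] D_nz[OF z0] by simp
  then show thesis using True I by (intro that[of I2 0]) (auto simp: inv)
next
  case False
  \<comment> \<open>For a nonzero lower left entry this is the double root of the fixed point
    equation, whose discriminant is the squared trace minus 4, that is 0.\<close>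
  define c where "c = (if \<gamma> $ 2 $ 1 = 0 then Infty else Fin ((\<gamma> $ 1 $ 1 - \<gamma> $ 2 $ 2) / (2 * \<gamma> $ 2 $ 1)))"
  have "moebius_bd \<gamma> c = c"
  proof (cases "\<gamma> $ 2 $ 1 = 0")
    case nz: False
    define x where "x = (\<gamma> $ 1 $ 1 - \<gamma> $ 2 $ 2) / (2 * \<gamma> $ 2 $ 1)"
    have tr: "\<gamma> $ 1 $ 1 + \<gamma> $ 2 $ 2 = 2 \<or> \<gamma> $ 1 $ 1 + \<gamma> $ 2 $ 2 = - 2"
      and det: "\<gamma> $ 1 $ 1 * \<gamma> $ 2 $ 2 - \<gamma> $ 1 $ 2 * \<gamma> $ 2 $ 1 = 1"
      using \<gamma> by (auto simp: parabolic_def SL2R_carrier)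
    have x2: "2 * \<gamma> $ 2 $ 1 * x = \<gamma> $ 1 $ 1 - \<gamma> $ 2 $ 2" using nz by (simp add: x_def)
    then have q: "2 * (\<gamma> $ 2 $ 1 * x + \<gamma> $ 2 $ 2) = \<gamma> $ 1 $ 1 + \<gamma> $ 2 $ 2" by simp
    then have qnz: "\<gamma> $ 2 $ 1 * x + \<gamma> $ 2 $ 2 \<noteq> 0" using tr by auto
    have "4 * \<gamma> $ 2 $ 1 * (\<gamma> $ 1 $ 1 * x + \<gamma> $ 1 $ 2 - x * (\<gamma> $ 2 $ 1 * x + \<gamma> $ 2 $ 2)) =
        2 * (\<gamma> $ 1 $ 1 - \<gamma> $ 2 $ 2) * (2 * \<gamma> $ 2 $ 1 * x) - (2 * \<gamma> $ 2 $ 1 * x)\<^sup>2 + 4 * (\<gamma> $ 1 $ 2 * \<gamma> $ 2 $ 1)"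
      by (simp add: power2_eq_square algebra_simps)
    also have "\<dots> = (\<gamma> $ 1 $ 1 + \<gamma> $ 2 $ 2)\<^sup>2 - 4 * (\<gamma> $ 1 $ 1 * \<gamma> $ 2 $ 2 - \<gamma> $ 1 $ 2 * \<gamma> $ 2 $ 1)"
      unfolding x2 by (simp add: power2_eq_square algebra_simps)
    also have "\<dots> = 0" unfolding det using tr by auto
    finally have "\<gamma> $ 1 $ 1 * x + \<gamma> $ 1 $ 2 = x * (\<gamma> $ 2 $ 1 * x + \<gamma> $ 2 $ 2)" using nz by simp
    then show ?thesis using nz qnz by (simp add: c_def flip: x_def)
  qed (simp add: c_def)
  then have c: "is_cusp G c" using \<gamma> False by (auto simp: is_cusp_def)
  obtain B where "cusp_frame c B" using cusp_frame_exists by blast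
  note B = cusp_frameD[OF this]
  note cw = cusp_width_props[OF G iso minus_G c]
  obtain n :: int where n: "\<gamma> = cusp_translation c (of_int n * cusp_width G c) \<or>
      \<gamma> = - cusp_translation c (of_int n * cusp_width G c)"
    using cw(3)[OF \<gamma>(1) \<open>moebius_bd \<gamma> c = c\<close>] by blast
  show thesis
  proof (rule that[OF B(1), of "of_int n * cusp_width G c"])
    show "\<gamma> = B ** transl (of_int n * cusp_width G c) ** inv2 B \<or>
        \<gamma> = - (B ** transl (of_int n * cusp_width G c) ** inv2 B)"
      using n unfolding B(2) .
    fix j :: int
    have eq: "B ** transl (of_int j * (of_int n * cusp_width G c)) ** inv2 B =
        cusp_translation c (of_int (j * n) * cusp_width G c)"
      by (simp add: B(2) mult.assoc)
    show "B ** transl (of_int j * (of_int n * cusp_width G c)) ** inv2 B \<in> G"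
      unfolding eq by (rule cw(2))
    show "norm (\<nu> (B ** transl (of_int j * (of_int n * cusp_width G c)) ** inv2 B)) = 1"
      unfolding eq by (rule \<nu>_cusp[OF c])
  qed
qed

definition R :: real where "R = (\<Sum>i<length rs. mnorm (rs ! i))"

lemma mnorm_le_R: "i < length rs \<Longrightarrow> mnorm (rs ! i) \<le> R"
  unfolding R_def by (rule member_le_sum) auto

lemma R_nonneg: "R \<ge> 0"
  unfolding R_def by (intro sum_nonneg) simp

text \<open>Passing to the block element costs one factor \<open>R\<close> for each of the two
  representatives, and the twist has modulus one.\<close>

lemma \<rho>_entry_le:
  assumes \<gamma>: "\<gamma> \<in> G" and \<nu>: "norm (\<nu> \<gamma>) = 1" and a: "a < m" "b < m"
  shows "norm (\<rho> \<gamma> $$ (a, b)) \<le> R * mnorm \<gamma> * R"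
proof -
  let ?i = "a div 2" and ?j = "b div 2"
  let ?h = "inv2 (rs ! ?i) ** \<gamma> ** rs ! ?j"
  have ij: "?i < length rs" "?j < length rs" using a by auto
  have "mnorm ?h \<le> mnorm (inv2 (rs ! ?i) ** \<gamma>) * mnorm (rs ! ?j)" by (rule mnorm_mult)
  also have "\<dots> \<le> (mnorm (rs ! ?i) * mnorm \<gamma>) * mnorm (rs ! ?j)"
    using mnorm_mult[of "inv2 (rs ! ?i)" \<gamma>] by (intro mult_right_mono) auto
  also have "\<dots> \<le> (R * mnorm \<gamma>) * R"
    using R_nonneg by (intro mult_mono mult_right_mono mnorm_le_R ij) auto
  finally have h: "mnorm ?h \<le> R * mnorm \<gamma> * R" .
  have "norm (\<rho> \<gamma> $$ (a, b)) = (if ?h \<in> H then norm (std_rep ?h $$ (a mod 2, b mod 2)) else 0)"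
    unfolding \<rho>_entry[OF \<gamma> a] by (simp add: Let_def norm_mult norm_power_int \<nu>)
  also have "\<dots> \<le> R * mnorm \<gamma> * R"
    using order_trans[OF std_rep_le_mnorm h, of "a mod 2" "b mod 2"] R_nonneg by auto
  finally show ?thesis .
qed

text \<open>An entry of \<rho> (F j) v at which v does not vanish has modulus proportional to |e|^j,
  yet it grows at most linearly with j. The sequence F is left abstract so that it can run through
  powers of a translation or of its inverse.\<close>

lemma eigenvalue_powers_le:
  assumes F: "\<And>j :: nat. F j \<in> G" "\<And>j. norm (\<nu> (F j)) = 1" "\<And>j. mnorm (F j) \<le> K * (1 + real j)"
    and one: "F 0 = I2" and Suc: "\<And>j. F (Suc j) = F 1 ** F j"
    and v: "v \<in> carrier_vec m" "v \<noteq> 0\<^sub>v m" and ev: "\<rho> (F 1) *\<^sub>v v = e \<cdot>\<^sub>v v"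
  shows "norm e \<le> 1"
proof -
  have pow: "\<rho> (F j) *\<^sub>v v = e ^ j \<cdot>\<^sub>v v" for j
  proof (induction j)
    case 0
    show ?case using v by (simp add: one \<rho>_one)
  next
    case (Suc j)
    have "\<rho> (F (Suc j)) *\<^sub>v v = \<rho> (F 1) *\<^sub>v (\<rho> (F j) *\<^sub>v v)"
      unfolding \<open>F (Suc j) = F 1 ** F j\<close> \<rho>_mult[OF F(1) F(1)]
      by (rule assoc_mult_mat_vec[OF \<rho>_carrier[OF F(1)] \<rho>_carrier[OF F(1)] v(1)])
    also have "\<dots> = e ^ j \<cdot>\<^sub>v (e \<cdot>\<^sub>v v)"
      unfolding Suc mult_mat_vec[OF \<rho>_carrier[OF F(1)] v(1)] ev ..
    finally show ?case by (simp add: smult_smult_assoc mult.commute)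
  qed
  obtain a where a: "a < m" "v $v a \<noteq> 0"
    using v by (metis carrier_vecD eq_vecI index_zero_vec)
  define V where "V = (\<Sum>b<m. norm (v $v b))"
  have "norm e ^ j \<le> (R * K * R * V / norm (v $v a)) * (1 + real j)" for j
  proof -
    have "norm e ^ j * norm (v $v a) = norm ((\<rho> (F j) *\<^sub>v v) $v a)"
      unfolding pow using a v by (simp add: norm_mult norm_power)
    also have "(\<rho> (F j) *\<^sub>v v) $v a = (\<Sum>b<m. \<rho> (F j) $$ (a, b) * v $v b)"
    proof -
      have "v = Matrix.vec m (\<lambda>b. v $v b)" using v by (intro eq_vecI) auto
      then show ?thesis using mult_mat_vec_entry[OF \<rho>_carrier[OF F(1)[of j]] a(1), of "\<lambda>b. v $v b"] by simp
    qed
    also have "norm \<dots> \<le> (\<Sum>b<m. (R * (K * (1 + real j)) * R) * norm (v $v b))"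
    proof (rule order_trans[OF norm_sum sum_mono])
      fix b assume b: "b \<in> {..<m}"
      have "norm (\<rho> (F j) $$ (a, b)) \<le> R * mnorm (F j) * R"
        using \<rho>_entry_le[OF F(1,2) a(1)] b by simp
      also have "\<dots> \<le> R * (K * (1 + real j)) * R"
        using R_nonneg F(3)[of j] by (intro mult_right_mono mult_left_mono) auto
      finally show "norm (\<rho> (F j) $$ (a, b) * v $v b) \<le> (R * (K * (1 + real j)) * R) * norm (v $v b)"
        unfolding norm_mult by (rule mult_right_mono) simp
    qed
    also have "\<dots> = R * K * R * V * (1 + real j)"
      unfolding V_def by (simp add: mult_ac flip: sum_distrib_left)
    finally show ?thesis using a by (simp add: field_simps)
  qed
  then show ?thesis by (rule bounded_growth_le_one[rotated]) simp
qed

lemma conj_transl_add: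
  assumes "B \<in> carrier SL2R"
  shows "(B ** transl x ** inv2 B) ** (B ** transl y ** inv2 B) = B ** transl (x + y) ** inv2 B"
proof -
  have "(B ** transl x ** inv2 B) ** (B ** transl y ** inv2 B) = B ** transl x ** (inv2 B ** B) ** transl y ** inv2 B"
    by (simp add: matrix_mul_assoc)
  then show ?thesis by (simp add: inv2_mult[OF assms] flip: transl_mult matrix_mul_assoc)
qed

text \<open>The linear bound along positive powers gives |e| \<le> 1, and along negative powers,
  where the eigenvalue is the inverse of e, the opposite inequality.\<close>

lemma eigenvalue_norm_one:
  assumes B: "B \<in> carrier SL2R"
    and E: "\<And>j :: int. B ** transl (of_int j * x) ** inv2 B \<in> G"
      "\<And>j :: int. norm (\<nu> (B ** transl (of_int j * x) ** inv2 B)) = 1"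
    and v: "v \<in> carrier_vec m" "v \<noteq> 0\<^sub>v m" and ev: "\<rho> (B ** transl x ** inv2 B) *\<^sub>v v = e \<cdot>\<^sub>v v"
  shows "norm e = 1"
proof -
  define F where "F j = B ** transl (of_int j * x) ** inv2 B" for j :: int
  have F0: "F 0 = I2" by (simp add: F_def inv2_mult[OF B])
  have F_add: "F i ** F j = F (i + j)" for i j
    unfolding F_def conj_transl_add[OF B] by (simp add: distrib_right)
  have F_G: "F j \<in> G" and F_\<nu>: "norm (\<nu> (F j)) = 1" for j using E by (simp_all add: F_def)
  define K where "K = mnorm B * (2 + \<bar>x\<bar>) * mnorm B"
  have F_le: "mnorm (F j) \<le> K * (1 + \<bar>of_int j\<bar>)" for j
  proof -
    have "mnorm (F j) \<le> mnorm B * (2 + \<bar>of_int j * x\<bar>) * mnorm B"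
      unfolding F_def by (rule mnorm_conj_transl)
    also have "\<dots> \<le> mnorm B * ((2 + \<bar>x\<bar>) * (1 + \<bar>of_int j\<bar>)) * mnorm B"
      by (intro mult_right_mono mult_left_mono) (auto simp: abs_mult algebra_simps)
    finally show ?thesis by (simp add: K_def mult_ac)
  qed
  have ev1: "\<rho> (F 1) *\<^sub>v v = e \<cdot>\<^sub>v v" using ev by (simp add: F_def)
  have 1: "norm e \<le> 1"
  proof (rule eigenvalue_powers_le[of "\<lambda>j. F (int j)"])
    show "mnorm (F (int j)) \<le> K * (1 + real j)" for j using F_le[of "int j"] by simp
    show "F (int (Suc j)) = F (int 1) ** F (int j)" for j by (simp add: F_add)
  qed (use F_G F_\<nu> F0 v ev1 in auto)
  define W where "W = \<rho> (F (- 1)) *\<^sub>v v"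
  have W: "W \<in> carrier_vec m" unfolding W_def using \<rho>_carrier[OF F_G[of "- 1"]] v(1) by simp
  have v_eq: "v = e \<cdot>\<^sub>v W"
  proof -
    have "v = \<rho> (F (- 1) ** F 1) *\<^sub>v v" using v by (simp add: F_add F0 \<rho>_one)
    also have "\<dots> = \<rho> (F (- 1)) *\<^sub>v (\<rho> (F 1) *\<^sub>v v)"
      unfolding \<rho>_mult[OF F_G F_G] by (rule assoc_mult_mat_vec[OF \<rho>_carrier[OF F_G] \<rho>_carrier[OF F_G] v(1)])
    also have "\<dots> = e \<cdot>\<^sub>v W"
      unfolding ev1 W_def by (rule mult_mat_vec[OF \<rho>_carrier[OF F_G] v(1)])
    finally show ?thesis .
  qed
  have e: "e \<noteq> 0"
  proof
    assume "e = 0"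
    then have "v = 0\<^sub>v m" unfolding v_eq using W by (intro eq_vecI) auto
    with v show False by simp
  qed
  have "W = inverse e \<cdot>\<^sub>v (e \<cdot>\<^sub>v W)" using e W by (intro eq_vecI) auto
  then have ev2: "\<rho> (F (- 1)) *\<^sub>v v = inverse e \<cdot>\<^sub>v v"
    unfolding v_eq[symmetric] by (simp only: W_def)
  have 2: "norm (inverse e) \<le> 1"
  proof (rule eigenvalue_powers_le[of "\<lambda>j. F (- int j)"])
    show "mnorm (F (- int j)) \<le> K * (1 + real j)" for j using F_le[of "- int j"] by simp
    show "F (- int (Suc j)) = F (- int 1) ** F (- int j)" for j by (simp add: F_add)
  qed (use F_G F_\<nu> F0 v ev2 in auto)
  have "inverse (norm e) \<le> 1" using 2 by (simp only: norm_inverse)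
  then have "1 \<le> norm e" using e by (simp add: inverse_le_1_iff)
  with 1 show ?thesis by simp
qed

text \<open>Changing the sign of \<gamma> multiplies \<rho> \<gamma> by the scalar \<rho> (-I) of
  modulus one, which reduces the claim to conjugated translations.\<close>

lemma \<rho>_eigenvalue:
  assumes \<gamma>: "\<gamma> \<in> G" "parabolic \<gamma>" and ev: "eigenvalue (\<rho> \<gamma>) ev"
  shows "norm ev = 1"
proof -
  obtain v where v: "v \<in> carrier_vec m" "v \<noteq> 0\<^sub>v m" "\<rho> \<gamma> *\<^sub>v v = ev \<cdot>\<^sub>v v"
    using ev \<rho>_carrier[OF \<gamma>(1)] by (auto simp: eigenvalue_def eigenvector_def)
  obtain B x where B: "B \<in> carrier SL2R"
    "\<gamma> = B ** transl x ** inv2 B \<or> \<gamma> = - (B ** transl x ** inv2 B)"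
    "\<And>j :: int. B ** transl (of_int j * x) ** inv2 B \<in> G"
    "\<And>j :: int. norm (\<nu> (B ** transl (of_int j * x) ** inv2 B)) = 1"
    using parabolic_form[OF \<gamma>] by metis
  note one = eigenvalue_norm_one[OF B(1,3,4) v(1,2)]
  from B(2) show ?thesis
  proof
    assume "\<gamma> = B ** transl x ** inv2 B"
    then show ?thesis using one v(3) by simp
  next
    assume \<gamma>_eq: "\<gamma> = - (B ** transl x ** inv2 B)"
    then have "B ** transl x ** inv2 B = - I2 ** \<gamma>" by (simp add: mat2_mult_minus)
    then have "\<rho> (B ** transl x ** inv2 B) *\<^sub>v v = \<rho> (- I2) *\<^sub>v (\<rho> \<gamma> *\<^sub>v v)"
      using assoc_mult_mat_vec[OF \<rho>_carrier[OF minus_G] \<rho>_carrier[OF \<gamma>(1)] v(1)]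
      by (simp add: \<rho>_mult[OF minus_G \<gamma>(1)])
    also have "\<dots> = ((- 1) powi (- wt) * ev) \<cdot>\<^sub>v v"
      unfolding v(3) \<rho>_minus_one using v(1) by (intro eq_vecI) (auto simp: mult.assoc)
    finally have "norm ((- 1) powi (- wt) * ev) = 1" by (rule one)
    then show ?thesis by (simp add: norm_mult norm_power_int)
  qed
qed

text \<open>A diagonalizable matrix with eigenvalues of modulus one has bounded powers. But the
  block of \<rho> (E j) in the first block row determines E j up to finitely many representatives,
  so the translations by j h would have bounded entries.\<close>

lemma \<rho>_not_diagonalizable:
  assumes c: "is_cusp G c"
  shows "\<not> diagonalizable (\<rho> (cusp_generator G c))"
proof
  define h where "h = cusp_width G c"
  note cw = cusp_width_props[OF G iso minus_G c, folded h_def]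
  obtain B where "cusp_frame c B" using cusp_frame_exists by blast
  note B = cusp_frameD[OF this]
  define E where "E j = cusp_translation c (of_int (int j) * h)" for j
  have E_G: "E j \<in> G" for j unfolding E_def by (rule cw(2))
  have E_\<nu>: "norm (\<nu> (E j)) = 1" for j unfolding E_def h_def by (rule \<nu>_cusp[OF c])
  have E_Suc: "E (Suc j) = E j ** E 1" for j
    unfolding E_def B(2) conj_transl_add[OF B(1)] by (simp add: distrib_right add.commute)
  have E_1: "E 1 = cusp_generator G c" by (simp add: E_def cusp_generator_def h_def)
  have par: "parabolic (E 1)"
    unfolding E_1 by (rule cusp_generator_props(2)[OF G iso minus_G c])
  assume "diagonalizable (\<rho> (cusp_generator G c))"
  then obtain Dg where Dg: "diagonal_mat Dg" "similar_mat (\<rho> (E 1)) Dg"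
    unfolding diagonalizable_def E_1 by blast
  then obtain S Q where wit: "similar_mat_wit (\<rho> (E 1)) Dg S Q" by (auto simp: similar_mat_def)
  have carr: "Dg \<in> carrier_mat m m" "S \<in> carrier_mat m m" "Q \<in> carrier_mat m m"
    and SQ: "S * Q = 1\<^sub>m m" "Q * S = 1\<^sub>m m" and \<rho>E: "\<rho> (E 1) = S * Dg * Q"
    by (rule similar_mat_witD2[OF \<rho>_carrier[OF E_G[of 1]] wit])+
  have diag: "norm (Dg $$ (l, l)) = 1" if l: "l < m" for l
  proof -
    have "char_poly Dg = (\<Prod>a\<leftarrow>diag_mat Dg. [:- a, 1:])"
      using Dg(1) carr(1) by (intro char_poly_upper_triangular) (auto simp: diagonal_mat_def)
    moreover have "Dg $$ (l, l) \<in> set (diag_mat Dg)" using carr(1) l by (auto simp: diag_mat_def)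
    ultimately have "poly (char_poly Dg) (Dg $$ (l, l)) = 0"
      by (force simp: poly_prod_list prod_list_zero_iff)
    then have "eigenvalue (\<rho> (E 1)) (Dg $$ (l, l))"
      using eigenvalue_root_char_poly[OF \<rho>_carrier[OF E_G]] char_poly_similar[OF Dg(2)] by auto
    then show ?thesis by (rule \<rho>_eigenvalue[OF E_G par])
  qed
  have SD: "\<rho> (E 1) * S = S * Dg"
  proof -
    have "\<rho> (E 1) * S = S * Dg * (Q * S)"
      unfolding \<rho>E using carr by (simp add: assoc_mult_mat[of _ m m _ m _ m])
    then show ?thesis using SQ carr by simp
  qed
  have pow: "(\<rho> (E j) * S) $$ (a, l) = S $$ (a, l) * Dg $$ (l, l) ^ j" if "a < m" "l < m" for j a l
    using that
  proof (induction j)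
    case 0
    have "E 0 = I2" by (simp add: E_def B(2) inv2_mult[OF B(1)])
    then show ?case using carr 0 by (simp add: \<rho>_one)
  next
    case (Suc j)
    have "\<rho> (E (Suc j)) * S = \<rho> (E j) * (\<rho> (E 1) * S)"
      unfolding E_Suc \<rho>_mult[OF E_G E_G]
      by (rule assoc_mult_mat[OF \<rho>_carrier[OF E_G] \<rho>_carrier[OF E_G] carr(2)])
    also have "\<dots> = (\<rho> (E j) * S) * Dg"
      unfolding SD by (rule assoc_mult_mat[OF \<rho>_carrier[OF E_G] carr(2,1), symmetric])
    finally have "(\<rho> (E (Suc j)) * S) $$ (a, l) = (\<Sum>b<m. (\<rho> (E j) * S) $$ (a, b) * Dg $$ (b, l))"
      using mat_mult_entry[OF mult_carrier_mat[OF \<rho>_carrier[OF E_G] carr(2)] carr(1) Suc.prems] by simp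
    also have "\<dots> = (\<Sum>b<m. if b = l then (\<rho> (E j) * S) $$ (a, l) * Dg $$ (l, l) else 0)"
      using Dg(1) carr(1) Suc.prems by (intro sum.cong refl) (auto simp: diagonal_mat_def)
    also have "\<dots> = (\<rho> (E j) * S) $$ (a, l) * Dg $$ (l, l)" using Suc.prems by simp
    finally show ?case using Suc by simp
  qed
  define K where "K = (\<Sum>a<m. \<Sum>b<m. \<Sum>l<m. norm (S $$ (a, l)) * norm (Q $$ (l, b)))"
  have bound: "norm (\<rho> (E j) $$ (a, b)) \<le> K" if a: "a < m" and b: "b < m" for j a b
  proof -
    have "\<rho> (E j) = (\<rho> (E j) * S) * Q"
      using assoc_mult_mat[OF \<rho>_carrier[OF E_G] carr(2,3), of j] SQ \<rho>_carrier[OF E_G, of j] by simp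
    then have "\<rho> (E j) $$ (a, b) = ((\<rho> (E j) * S) * Q) $$ (a, b)" by simp
    also have "\<dots> = (\<Sum>l<m. (\<rho> (E j) * S) $$ (a, l) * Q $$ (l, b))"
      by (rule mat_mult_entry[OF mult_carrier_mat[OF \<rho>_carrier[OF E_G] carr(2)] carr(3) a b])
    also have "norm \<dots> \<le> (\<Sum>l<m. norm (S $$ (a, l)) * norm (Q $$ (l, b)))"
      using a by (intro order_trans[OF norm_sum sum_mono]) (simp add: pow norm_mult norm_power diag)
    also have "\<dots> \<le> (\<Sum>b<m. \<Sum>l<m. norm (S $$ (a, l)) * norm (Q $$ (l, b)))"
      using b by (intro member_le_sum[of b _ "\<lambda>b. \<Sum>l<m. norm (S $$ (a, l)) * norm (Q $$ (l, b))"])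
        (auto intro!: sum_nonneg)
    also have "\<dots> \<le> K"
      unfolding K_def using a
      by (intro member_le_sum[of a _ "\<lambda>a. \<Sum>b<m. \<Sum>l<m. norm (S $$ (a, l)) * norm (Q $$ (l, b))"])
        (auto intro!: sum_nonneg)
    finally show ?thesis .
  qed
  have n0: "0 < length rs" using transversal_unique[OF E_G[of 0]] by auto
  have E_bound: "mnorm (E j) \<le> R * (4 * K) * R" for j
  proof -
    \<comment> \<open>The column l of the nonzero block depends on j, but all representatives obey
      the common bound \<open>R\<close>.\<close>
    obtain l where l: "l < length rs" "inv2 (rs ! 0) ** E j ** rs ! l \<in> H"
      using block_unique[OF E_G n0] by blast
    define k where "k = inv2 (rs ! 0) ** E j ** rs ! l"
    have entry: "norm (std_rep k $$ (\<alpha>, \<beta>)) \<le> K" if "\<alpha> < 2" "\<beta> < 2" for \<alpha> \<beta>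
    proof -
      have ab: "\<alpha> < m" "l * 2 + \<beta> < m" using that l n0 by auto
      have "\<alpha> div 2 = 0" "\<alpha> mod 2 = \<alpha>" "(l * 2 + \<beta>) div 2 = l" "(l * 2 + \<beta>) mod 2 = \<beta>"
        using that by auto
      then have "norm (\<rho> (E j) $$ (\<alpha>, l * 2 + \<beta>)) = norm (std_rep k $$ (\<alpha>, \<beta>))"
        unfolding \<rho>_entry[OF E_G ab] using l(2)
        by (simp add: Let_def norm_mult norm_power_int E_\<nu> k_def)
      then show ?thesis using bound[OF ab, of j] by simp
    qed
    have k: "mnorm k \<le> 4 * K"
      unfolding mnorm_std_rep using entry[of 0 0] entry[of 0 1] entry[of 1 0] entry[of 1 1] by simp
    have K0: "0 \<le> K" using order_trans[OF mnorm_nonneg k] by simp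
    have "E j = rs ! 0 ** k ** inv2 (rs ! l)"
      unfolding k_def using rs_SL2R[OF n0] rs_SL2R[OF l(1)]
      by (simp add: inv2_cancel inv2_mult flip: matrix_mul_assoc)
    then have "mnorm (E j) \<le> mnorm (rs ! 0 ** k) * mnorm (rs ! l)" by (metis mnorm_mult mnorm_inv2)
    also have "\<dots> \<le> (mnorm (rs ! 0) * mnorm k) * mnorm (rs ! l)"
      by (intro mult_right_mono mnorm_mult) simp
    also have "\<dots> \<le> (R * (4 * K)) * R"
      using R_nonneg k K0 by (intro mult_mono mnorm_le_R n0 l(1)) auto
    finally show ?thesis .
  qed
  \<comment> \<open>Conjugation by B recovers the translation itself, whose off-diagonal entry is j
    h.\<close>
  define Z where "Z = mnorm B * (R * (4 * K) * R) * mnorm B"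
  have "real j * h \<le> Z" for j
  proof -
    have "transl (of_int (int j) * h) = inv2 B ** E j ** B"
      unfolding E_def B(2) using B(1) by (simp add: inv2_mult matrix_mul_assoc) (simp add: inv2_mult flip: matrix_mul_assoc)
    then have "mnorm (transl (of_int (int j) * h)) \<le> mnorm (inv2 B ** E j) * mnorm B" by (metis mnorm_mult)
    also have "\<dots> \<le> (mnorm (inv2 B) * mnorm (E j)) * mnorm B" by (intro mult_right_mono mnorm_mult) simp
    also have "\<dots> \<le> Z"
      unfolding Z_def mnorm_inv2 by (intro mult_right_mono mult_left_mono E_bound) auto
    finally show ?thesis by (simp add: mnorm_def)
  qed
  moreover obtain j :: nat where "Z < real j * h" using reals_Archimedean3[OF cw(1)] by blast
  ultimately show False by (meson not_le)
qed

lemma \<rho>_logarithmic: "logarithmic_rep G \<rho>"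
  unfolding logarithmic_rep_def
  using \<rho>_eigenvalue \<rho>_not_diagonalizable[OF c0] cusp_generator_props[OF G iso minus_G c0] by blast

text \<open>Slashing by the frame B moves the cusp to infinity, where equivariance under the
  generator becomes the shift equation by h with the matrix \<rho> T. Growth is checked factor by
  factor: the twist is controlled in both directions, the translated Poincare series is bounded and
  the linear factor is polynomial.\<close>

lemma X_log_expansion:
  assumes c: "is_cusp G c"
  shows "log_expansion G m \<rho> wt c (\<lambda>\<tau>. Matrix.vec m (\<lambda>a. X a \<tau>))"
proof -
  define h where "h = cusp_width G c"
  note cw = cusp_width_props[OF G iso minus_G c, folded h_def]
  obtain B where frame: "cusp_frame c B"
    and growth: "exp_growth (\<lambda>\<tau>. D (moebius B \<tau>) / autom B \<tau>)"
      "exp_growth (\<lambda>\<tau>. inverse (D (moebius B \<tau>) / autom B \<tau>))"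
    by (rule cusp_data[OF c]) (rule that)
  note B = cusp_frameD[OF frame]
  define T where "T = cusp_generator G c"
  have T: "T \<in> G" and par: "parabolic T"
    unfolding T_def by (rule cusp_generator_props[OF G iso minus_G c])+
  have T_B: "T = B ** transl h ** inv2 B" by (simp add: T_def cusp_generator_def h_def B(2))
  define g where "g a \<tau> = autom B \<tau> powi (- wt) * X a (moebius B \<tau>)" for a \<tau>
  have hol: "g a holomorphic_on upper_half_plane" if "a < m" for a
    unfolding g_def using X_holomorphic[OF that] moebius_upper_half_plane[OF B(1)] autom_nonzero[OF B(1)]
    by (intro holomorphic_intros holomorphic_on_compose_gen[OF moebius_holomorphic[OF B(1)], unfolded o_def, of "X a"]) auto
  have gr: "exp_growth (g a)" if a: "a < m" for a
  proof -
    define i where "i = a div 2"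
    have i: "i < length rs" using a by (simp add: i_def)
    let ?S = "(\<lambda>A. A ** B) ` coset i"
    have S: "?S \<subseteq> carrier SL2R" using coset_SL2R[OF i] B(1) by auto
    have Ssum: "(\<lambda>A. inverse (mnorm A) ^ s) summable_on ?S"
      by (rule mnorm_summable_translate[OF coset_SL2R[OF i] B(1) coset_summable[OF i]])
    have 1: "exp_growth (psum z0 s ?S)"
    proof (rule exp_growth_bounded)
      fix r :: real assume r: "r > 0"
      have r0: "r \<ge> 0" using r by simp
      show "\<exists>C Y. \<forall>\<tau>. \<bar>Re \<tau>\<bar> \<le> r \<longrightarrow> Y \<le> Im \<tau> \<longrightarrow> norm (psum z0 s ?S \<tau>) \<le> C"
        by (rule psum_bounded[of z0 r 1 ?S s, OF z0_pos r0 _ S Ssum]) (simp, blast)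
    qed
    have 2: "exp_growth (\<lambda>\<tau>. lin (inv2 (rs ! i) ** B) (a mod 2) \<tau>)"
      unfolding lin_def
      by (cases "a mod 2 = 0") (auto intro!: exp_growth_add exp_growth_mult exp_growth_const exp_growth_id)
    show ?thesis
    proof (rule exp_growth_cong[OF _ exp_growth_mult[OF exp_growth_mult[OF exp_growth_power_int[OF growth, of k0] 1] 2]])
      fix \<tau> assume \<tau>: "\<tau> \<in> upper_half_plane"
      let ?J = "autom B \<tau>"
      have J: "?J \<noteq> 0" by (rule autom_nonzero[OF B(1) \<tau>])
      have pow: "?J powi (- wt) = ?J powi (- k0) * inverse ?J ^ s * ?J"
      proof -
        have "- wt = (- k0) + (- int s) + 1" by (simp add: wt_def)
        then show ?thesis using J by (simp add: power_int_add power_int_diff power_int_minus power_inverse divide_inverse)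
      qed
      have "g a \<tau> = (D (moebius B \<tau>) powi k0 * ?J powi (- k0)) *
          (inverse ?J ^ s * psum z0 s (coset i) (moebius B \<tau>)) * (lin (inv2 (rs ! i)) (a mod 2) (moebius B \<tau>) * ?J)"
        unfolding g_def X_def pow i_def[symmetric] by (simp only: mult_ac)
      also have "D (moebius B \<tau>) powi k0 * ?J powi (- k0) = (D (moebius B \<tau>) / ?J) powi k0"
        unfolding power_int_divide_distrib power_int_minus by (rule divide_inverse[symmetric])
      finally show "g a \<tau> = (D (moebius B \<tau>) / ?J) powi k0 * psum z0 s ?S \<tau> * lin (inv2 (rs ! i) ** B) (a mod 2) \<tau>"
        unfolding psum_translate[OF coset_SL2R[OF i] B(1) \<tau>] lin_mult[OF B(1) \<tau>] .
    qed
  qed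
  have shift: "g a (\<tau> + of_real h) = (\<Sum>b<m. \<rho> T $$ (a, b) * g b \<tau>)"
    if a: "a < m" and \<tau>: "\<tau> \<in> upper_half_plane" for a \<tau>
  proof -
    note conj = conj_transl_moebius[OF B(1) \<tau>, of h, folded T_B]
    have B\<tau>: "moebius B \<tau> \<in> upper_half_plane" by (rule moebius_upper_half_plane[OF B(1) \<tau>])
    have "g a (\<tau> + of_real h) = autom B \<tau> powi (- wt) *
        (autom T (moebius B \<tau>) powi (- wt) * X a (moebius T (moebius B \<tau>)))"
      unfolding g_def conj(1) conj(2)[symmetric] power_int_mult_distrib by (simp only: mult_ac)
    also have "\<dots> = (\<Sum>b<m. \<rho> T $$ (a, b) * g b \<tau>)"
      unfolding X_slash[OF T a B\<tau>] g_def sum_distrib_left by (simp only: mult_ac)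
    finally show ?thesis .
  qed
  from log_expansion_components[OF cw(1) \<rho>_carrier[OF T] \<rho>_eigenvalue[OF T par] hol gr shift]
  obtain blocks M x where *: "jordan_nf (\<rho> T) blocks \<and> (\<forall>p j n. x p j n \<in> carrier_vec m) \<and>
    (\<forall>\<tau>\<in>upper_half_plane. \<forall>i<m.
      (\<forall>p<length blocks. \<forall>j<fst (blocks ! p). (\<lambda>n. (x p j n $v i) * qexp h \<tau> powi n) summable_on {- M..}) \<and>
      g i \<tau> = (\<Sum>p<length blocks. \<Sum>j<fst (blocks ! p).
        (2 * of_real pi * \<i> * \<tau> / of_real h) ^ j *
        exp (of_real (\<mu>_exponent (snd (blocks ! p))) * (2 * of_real pi * \<i> * \<tau> / of_real h)) *
        (\<Sum>\<^sub>\<infinity>n\<in>{- M..}. (x p j n $v i) * qexp h \<tau> powi n)))"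
    by blast
  note jnf = conjunct1[OF *] and x_carrier = conjunct1[OF conjunct2[OF *], rule_format]
    and series = conjunct2[OF conjunct2[OF *], rule_format]
  show ?thesis
    unfolding log_expansion_def T_def[symmetric]
  proof (intro exI[of _ blocks] exI[of _ M] exI[of _ x] conjI allI ballI impI jnf x_carrier)
    fix \<tau> i assume \<tau>: "\<tau> \<in> upper_half_plane" and i: "i < m"
    define \<sigma> where "\<sigma> = moebius (inv2 B) \<tau>"
    have \<sigma>: "\<sigma> \<in> upper_half_plane" "\<tau> = moebius B \<sigma>"
      using moebius_upper_half_plane[OF inv2_carrier[OF B(1)] \<tau>] moebius_inv2[OF B(1) \<tau>] by (simp_all add: \<sigma>_def)
    have logq: "log_q G c \<tau> = 2 * of_real pi * \<i> * \<sigma> / of_real h"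
      by (simp add: log_q_def B(3) \<sigma>_def h_def)
    have q: "q_cusp G c \<tau> = qexp h \<sigma>" by (simp add: q_cusp_def logq qexp_def)
    show "(\<lambda>n. (x p j n $v i) * q_cusp G c \<tau> powi n) summable_on {- M..}"
      if "p < length blocks" "j < fst (blocks ! p)" for p j
      unfolding q using conjunct1[OF series[OF \<sigma>(1) i]] that by blast
    have J: "autom B \<sigma> \<noteq> 0" by (rule autom_nonzero[OF B(1) \<sigma>(1)])
    \<comment> \<open>Undoing the slash by B costs a power of its automorphy factor, and for
      integral weight this is exactly the cusp factor.\<close>
    have "cusp_factor (of_int wt) c \<tau> = (1 / autom B \<sigma>) powr (of_int (- wt))"
      unfolding \<sigma>(2) B(4)[OF \<sigma>(1)] by simp
    also have "\<dots> = (1 / autom B \<sigma>) powi (- wt)" using J by (intro complex_powr_of_int) auto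
    also have "\<dots> = autom B \<sigma> powi wt"
      unfolding power_int_divide_distrib power_int_minus by simp
    finally have "Matrix.vec m (\<lambda>a. X a \<tau>) $v i = cusp_factor (of_int wt) c \<tau> * g i \<sigma>"
      using i J by (simp add: g_def \<sigma>(2) power_int_minus)
    then show "Matrix.vec m (\<lambda>a. X a \<tau>) $v i = cusp_factor (of_int wt) c \<tau> *
        (\<Sum>p<length blocks. \<Sum>j<fst (blocks ! p). log_q G c \<tau> ^ j *
          exp (of_real (\<mu>_exponent (snd (blocks ! p))) * log_q G c \<tau>) *
          (\<Sum>\<^sub>\<infinity>n\<in>{- M..}. (x p j n $v i) * q_cusp G c \<tau> powi n))"
      unfolding conjunct2[OF series[OF \<sigma>(1) i]] logq q .
  qed
qed

theorem logarithmic_vvaf_X: "logarithmic_vvaf G m \<rho> wt (\<lambda>\<tau>. Matrix.vec m (\<lambda>a. X a \<tau>))"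
proof -
  have slash: "slash (of_int wt) \<gamma> (\<lambda>z. Matrix.vec m (\<lambda>a. X a z) $v i) \<tau> = (\<rho> \<gamma> *\<^sub>v Matrix.vec m (\<lambda>a. X a \<tau>)) $v i"
    if "\<gamma> \<in> G" "\<tau> \<in> upper_half_plane" "i < m" for \<gamma> \<tau> i
    unfolding mult_mat_vec_entry[OF \<rho>_carrier[OF that(1)] that(3)] slash_of_int[OF G_SL2R[OF that(1)] that(2)]
      X_slash[OF that(1,3,2), symmetric]
    using that(3) by simp
  show ?thesis
    unfolding logarithmic_vvaf_def
    using \<rho>_representation \<rho>_logarithmic \<rho>_parity X_log_expansion slash X_holomorphic by auto
qed

theorem independent_components_X: "independent_components m (\<lambda>\<tau>. Matrix.vec m (\<lambda>a. X a \<tau>))"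
  unfolding independent_components_def using X_independent by auto

end

section \<open>Construction of the form from a fundamental domain and the root of \<Delta>\<close>

theorem corollary5p4:
  fixes G :: "mat2 set" and c0 :: boundary_point and w :: real
    and \<Delta> :: "complex \<Rightarrow> complex" and \<nu> :: "mat2 \<Rightarrow> complex"
    and \<rho> :: "mat2 \<Rightarrow> complex Matrix.mat"
  assumes "subgroup G SL2R" and "- I2 \<in> G"
    and "fuchsian_first_kind (to_PSL ` G)"
    and "Delta_form G c0 w \<Delta>" and "Delta_character G w \<Delta> \<nu>"
    and "\<rho> \<in> twisted_induced_reps G \<nu>"
  shows "\<exists>m k X. logarithmic_vvaf G m \<rho> k X \<and> independent_components m X"
proof -
  note G = assms(1) and mG = assms(2)
  have GS: "A \<in> carrier SL2R" if "A \<in> G" for A using subgroup_SL2R_subset[OF G] that by auto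
  have iso: "isolated_identity G"
    using assms(3) by (intro isolated_identity_discrete[OF G]) (simp add: fuchsian_first_kind_def)
  obtain z0 where z0: "z0 \<in> upper_half_plane"
    and free: "\<And>A. A \<in> G \<Longrightarrow> moebius A z0 = z0 \<Longrightarrow> A = I2 \<or> A = - I2"
  proof -
    obtain F where F: "fundamental_domain (to_PSL ` G) F"
      using assms(3) by (auto simp: fuchsian_first_kind_def)
    \<comment> \<open>A fundamental domain is the closure of its interior, so an empty interior
      would leave nothing to cover the upper half plane. A nontrivial element fixing an interior
      point would make the interior meet its own image.\<close>
    have "interior F \<noteq> {}"
    proof
      assume "interior F = {}"
      then have "F = {}" using F by (auto simp: fundamental_domain_def)
      then have "upper_half_plane = {}" using F by (auto simp: fundamental_domain_def)
      moreover have "\<i> \<in> upper_half_plane" by (simp add: upper_half_plane_def)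
      ultimately show False by auto
    qed
    then obtain z where z: "z \<in> interior F" by auto
    show thesis
    proof (rule that[of z])
      show "z \<in> upper_half_plane" using z interior_subset F by (auto simp: fundamental_domain_def)
      fix A assume A: "A \<in> G" "moebius A z = z"
      show "A = I2 \<or> A = - I2"
      proof (rule ccontr)
        assume "\<not> ?thesis"
        then have ne: "to_PSL A \<noteq> \<one>\<^bsub>PSL2R\<^esub>" by (simp add: to_PSL_one to_PSL_eq_iff)
        have mem: "A \<in> to_PSL A" by (simp add: to_PSL_eq)
        have disj: "\<forall>\<gamma>\<in>to_PSL ` G. \<gamma> \<noteq> \<one>\<^bsub>PSL2R\<^esub> \<longrightarrow>
            (\<forall>A\<in>\<gamma>. interior F \<inter> moebius A ` interior F = {})"
          using F unfolding fundamental_domain_def by (elim conjE)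
        have "interior F \<inter> moebius A ` interior F = {}"
          by (rule disj[rule_format, OF imageI[OF A(1)] ne mem])
        then show False using z A(2) by (metis disjoint_iff imageI)
      qed
    qed
  qed
  obtain s where s: "even s" "s \<ge> 10"
    "(\<Sum>\<^sub>\<infinity>A\<in>G - {I2, - I2}. norm (inverse (pker z0 A z0) ^ s)) < 2 * inverse (2 * Im z0) ^ s"
    using exists_dominating_weight[OF G iso z0 free] by blast
  obtain k0 H rs where H: "subgroup H (SL2R\<lparr>carrier := G\<rparr>)" "- I2 \<in> H" "left_transversal G H rs"
    and \<rho>: "\<And>\<gamma>. \<gamma> \<in> G \<Longrightarrow> \<rho> \<gamma> = (\<nu> \<gamma> powi k0) \<cdot>\<^sub>m induced_rep 2 rs H std_rep \<gamma>"
    using assms(6) unfolding twisted_induced_reps_def by blast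
  obtain L where L: "L holomorphic_on upper_half_plane"
    "\<And>\<tau>. \<tau> \<in> upper_half_plane \<Longrightarrow> exp (L \<tau>) = \<Delta> \<tau>"
    "\<And>\<gamma> \<tau>. \<gamma> \<in> G \<Longrightarrow> \<tau> \<in> upper_half_plane \<Longrightarrow>
      slash 1 \<gamma> (\<lambda>z. exp (L z / of_real w)) \<tau> = \<nu> \<gamma> * exp (L \<tau> / of_real w)"
    using assms(5) unfolding Delta_character_def by blast
  define D where "D \<tau> = exp (L \<tau> / of_real w)" for \<tau>
  have w: "w \<noteq> 0" and c0: "is_cusp G c0" using assms(4) by (auto simp: Delta_form_def)
  interpret induced_form G H rs D \<nu> k0 \<rho> s z0 c0
  proof (intro induced_form.intro transversal.intro induced_form_axioms.intro)
    show "subgroup H SL2R" by (rule group.incl_subgroup[OF group_SL2R G H(1)])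
    show "H \<subseteq> G" using subgroup.subset[OF H(1)] by simp
    show "D holomorphic_on upper_half_plane"
      unfolding D_def using w by (intro holomorphic_intros L(1)) auto
    show "D (moebius \<gamma> \<tau>) = \<nu> \<gamma> * autom \<gamma> \<tau> * D \<tau>"
      if "\<gamma> \<in> G" "\<tau> \<in> upper_half_plane" for \<gamma> \<tau>
    proof -
      have "inverse (autom \<gamma> \<tau>) * D (moebius \<gamma> \<tau>) = \<nu> \<gamma> * D \<tau>"
        using L(3)[OF that] slash_of_int[OF GS[OF that(1)] that(2), of 1 D]
        by (simp add: D_def[abs_def] power_int_minus)
      then show ?thesis using autom_nonzero[OF GS[OF that(1)] that(2)] by (simp add: field_simps)
    qed
    fix c assume c: "is_cusp G c"
    obtain B where frame: "cusp_frame c B" using cusp_frame_exists by blast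
    obtain \<mu> a where exp: "scalar_expansion G w c \<Delta> \<mu> a"
      using assms(4) c unfolding Delta_form_def by blast
    \<comment> \<open>The scalar expansion of \<Delta> at an arbitrary cusp enters here; the
      periodic modulus and the two growth bounds are what is kept of it.\<close>
    note growth = Delta_root_growth[OF cusp_width_props(1)[OF G iso mG c] w frame exp L(2), folded D_def]
    show "\<exists>B. cusp_frame c B \<and>
      (\<forall>\<tau>\<in>upper_half_plane. norm (D (moebius B (\<tau> + of_real (cusp_width G c))) / autom B (\<tau> + of_real (cusp_width G c))) =
        norm (D (moebius B \<tau>) / autom B \<tau>)) \<and>
      exp_growth (\<lambda>\<tau>. D (moebius B \<tau>) / autom B \<tau>) \<and>
      exp_growth (\<lambda>\<tau>. inverse (D (moebius B \<tau>) / autom B \<tau>))"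
      by (intro exI[of _ B] conjI ballI frame growth) auto
  qed (use assms iso z0 s H \<rho> c0 in \<open>auto simp: D_def\<close>)
  show ?thesis using logarithmic_vvaf_X independent_components_X by blast
qed

end
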